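(* Let $d>1$ and let $S\subseteq \mathbb{N}^d$ be a simplicial $\mathcal{C}$-semigroup. Then $S$ is Buchsbaum if and only if $\mathcal{H}(S)=\operatorname{PF}(S)$.
   Context: $\mathbb{N}$ denotes the nonnegative integers. An affine semigroup is a finitely generated submonoid $S$ of $\mathbb{N}^d$ (containing $\mathbf{0}$). Set $\mathrm{cone}(S)=\{\sum_{i} q_i\mathbf{s}_i \mid \mathbf{s}_i\in S,\ q_i\in\mathbb{Q}_{\ge 0}\}$ (finite sums), and let $\mathcal{C}=\mathrm{cone}(S)\cap\mathbb{N}^d$ be the integer cone of $S$. $S$ is called a $\mathcal{C}$-semigroup if it is an affine semigroup and $\mathcal{C}\setminus S$ is finite. A set of extremal rays of $S$ is a finite set $B\subseteq S$ such that the nonnegative rational span of $B$ is $\mathrm{cone}(S)$ and no proper subset of $B$ has this property. Let $\operatorname{G}(S)=\{\mathbf{a}-\mathbf{b}\mid \mathbf{a},\mathbf{b}\in S\}\subseteq\mathbb{Z}^d$. $S\subseteq\mathbb{N}^d$ is simplicial if the number of its extremal rays equals the rank of $\operatorname{G}(S)$; by standing convention this number is $d$. The set of gaps is $\mathcal{H}(S)=(\mathrm{cone}(S)\setminus S)\cap\mathbb{N}^d$, and the set of pseudo-Frobenius elements is $\operatorname{PF}(S)=\{\mathbf{h}\in\mathcal{H}(S)\mid \mathbf{h}+\mathbf{s}\in S \text{ for all } \mathbf{s}\in S\setminus\{\mathbf{0}\}\}$. Let $\mathbb{K}$ be a field and $\mathbb{K}[S]=\mathbb{K}[\mathbf{t}^{\mathbf{a}}\mid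 \mathbf{a}\in S]\subseteq\mathbb{K}[t_1,\dots,t_d]$. A Noetherian local ring $(A,\mathfrak{m})$ of dimension $e$ is Buchsbaum if every system of parameters $x_1,\dots,x_e$ of $A$ is a weak-regular sequence, i.e. $\mathfrak{m}\cdot\big((x_1,\dots,x_{i-1}):x_i\big)\subseteq (x_1,\dots,x_{i-1})$ for every $i=1,\dots,e$. $S$ is called Buchsbaum if the localization of $\mathbb{K}[S]$ at its maximal homogeneous ideal $(\mathbf{t}^{\mathbf{a}}\mid \mathbf{a}\in S\setminus\{\mathbf{0}\})$ is a Buchsbaum local ring. *)

theory Defs
  imports
    "HOL-Analysis.Finite_Cartesian_Product"
    "HOL-Library.Extended_Nat"
    "HOL-Library.Poly_Mapping"
    "HOL-Algebra.Algebra"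
begin

section \<open>Affine semigroups\<close>

text \<open>The ambient monoid \<open>\<nat>\<^sup>d\<close> is \<^typ>\<open>nat ^ 'd\<close>, with \<open>d = CARD('d)\<close>.\<close>

definition rat_vec :: "nat ^ 'd \<Rightarrow> rat ^ 'd" where
  "rat_vec a = (\<chi> i. of_nat (a $ i))"

definition int_vec :: "nat ^ 'd \<Rightarrow> int ^ 'd" where
  "int_vec a = (\<chi> i. int (a $ i))"

definition affine_semigroup :: "(nat ^ 'd) set \<Rightarrow> bool" where
  "affine_semigroup S \<longleftrightarrow>
     0 \<in> S \<and> (\<forall>a\<in>S. \<forall>b\<in>S. a + b \<in> S) \<and>
     (\<exists>A. finite A \<and> A \<subseteq> S \<and> (\<forall>s\<in>S. \<exists>c :: nat ^ 'd \<Rightarrow> nat. s = (\<Sum>a\<in>A. c a *s a)))"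

text \<open>Nonnegative rational span; applied both to semigroups and to sets of extremal rays.\<close>

definition rat_cone :: "(nat ^ 'd) set \<Rightarrow> (rat ^ 'd) set" where
  "rat_cone B = {(\<Sum>b\<in>F. q b *s rat_vec b) | F q. finite F \<and> F \<subseteq> B \<and> (\<forall>b\<in>F. 0 \<le> q b)}"

definition integer_cone :: "(nat ^ 'd) set \<Rightarrow> (nat ^ 'd) set" where
  "integer_cone S = {a. rat_vec a \<in> rat_cone S}"

definition gaps :: "(nat ^ 'd) set \<Rightarrow> (nat ^ 'd) set" where
  "gaps S = integer_cone S - S"

definition pseudo_frobenius :: "(nat ^ 'd) set \<Rightarrow> (nat ^ 'd) set" where
  "pseudo_frobenius S = {h \<in> gaps S. \<forall>s \<in> S - {0}. h + s \<in> S}"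

definition C_semigroup :: "(nat ^ 'd) set \<Rightarrow> bool" where
  "C_semigroup S \<longleftrightarrow> affine_semigroup S \<and> finite (integer_cone S - S)"

definition extremal_rays :: "(nat ^ 'd) set \<Rightarrow> (nat ^ 'd) set \<Rightarrow> bool" where
  "extremal_rays S B \<longleftrightarrow>
     finite B \<and> B \<subseteq> S \<and> rat_cone B = rat_cone S \<and> (\<forall>B'. B' \<subset> B \<longrightarrow> rat_cone B' \<noteq> rat_cone S)"

definition group_of :: "(nat ^ 'd) set \<Rightarrow> (int ^ 'd) set" where
  "group_of S = {int_vec a - int_vec b | a b. a \<in> S \<and> b \<in> S}"

definition int_independent :: "(int ^ 'd) set \<Rightarrow> bool" where
  "int_independent B \<longleftrightarrow>
     finite B \<and> (\<forall>c :: int ^ 'd \<Rightarrow> int. (\<Sum>b\<in>B. c b *s b) = 0 \<longrightarrow> (\<forall>b\<in>B. c b = 0))"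

text \<open>The maximum exists, since independent subsets of \<open>\<int>\<^sup>d\<close> have at most \<open>d\<close> elements.\<close>

definition int_rank :: "(int ^ 'd) set \<Rightarrow> nat" where
  "int_rank G = Max {card B | B. B \<subseteq> G \<and> int_independent B}"

text \<open>The last conjunct is the convention that a simplicial semigroup is full-dimensional.\<close>

definition simplicial :: "(nat ^ 'd) set \<Rightarrow> bool" where
  "simplicial S \<longleftrightarrow>
     (\<exists>B. extremal_rays S B \<and> card B = int_rank (group_of S) \<and> int_rank (group_of S) = CARD('d))"


section \<open>Localization and Buchsbaum local rings\<close>

text \<open>The ring of fractions \<open>M\<^sup>-\<^sup>1R\<close> of a commutative ring \<open>R\<close> at a multiplicative set \<open>M\<close>,
  for arbitrary \<open>R\<close>, hence the extra factor \<open>u\<close>. The operations take the union over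
  representatives, which all yield the same class.\<close>

definition frac_rel :: "('a, 'b) ring_scheme \<Rightarrow> 'a set \<Rightarrow> (('a \<times> 'a) \<times> ('a \<times> 'a)) set" where
  "frac_rel R M =
     {((a, s), (b, t)). a \<in> carrier R \<and> b \<in> carrier R \<and> s \<in> M \<and> t \<in> M \<and>
        (\<exists>u\<in>M. u \<otimes>\<^bsub>R\<^esub> (t \<otimes>\<^bsub>R\<^esub> a) = u \<otimes>\<^bsub>R\<^esub> (s \<otimes>\<^bsub>R\<^esub> b))}"

definition fraction :: "('a, 'b) ring_scheme \<Rightarrow> 'a set \<Rightarrow> 'a \<Rightarrow> 'a \<Rightarrow> ('a \<times> 'a) set" where
  "fraction R M a s = frac_rel R M `` {(a, s)}"

definition localization :: "('a, 'b) ring_scheme \<Rightarrow> 'a set \<Rightarrow> ('a \<times> 'a) set ring" where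
  "localization R M =
     \<lparr> carrier = (carrier R \<times> M) // frac_rel R M,
       monoid.mult = (\<lambda>U V. \<Union>(a, s)\<in>U. \<Union>(b, t)\<in>V. fraction R M (a \<otimes>\<^bsub>R\<^esub> b) (s \<otimes>\<^bsub>R\<^esub> t)),
       one = fraction R M \<one>\<^bsub>R\<^esub> \<one>\<^bsub>R\<^esub>,
       ring.zero = fraction R M \<zero>\<^bsub>R\<^esub> \<one>\<^bsub>R\<^esub>,
       add = (\<lambda>U V. \<Union>(a, s)\<in>U. \<Union>(b, t)\<in>V.
                fraction R M ((t \<otimes>\<^bsub>R\<^esub> a) \<oplus>\<^bsub>R\<^esub> (s \<otimes>\<^bsub>R\<^esub> b)) (s \<otimes>\<^bsub>R\<^esub> t)) \<rparr>"

definition localization_at :: "('a, 'b) ring_scheme \<Rightarrow> 'a set \<Rightarrow> ('a \<times> 'a) set ring" where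
  "localization_at R P = localization R (carrier R - P)"

definition krull_dim :: "('a, 'b) ring_scheme \<Rightarrow> enat" where
  "krull_dim R = Sup {enat n | n. \<exists>P :: nat \<Rightarrow> 'a set.
     (\<forall>i\<le>n. primeideal (P i) R) \<and> (\<forall>i<n. P i \<subset> P (Suc i))}"

definition noetherian_local_ring :: "('a, 'b) ring_scheme \<Rightarrow> 'a set \<Rightarrow> bool" where
  "noetherian_local_ring A m \<longleftrightarrow>
     cring A \<and> noetherian_ring A \<and> maximalideal m A \<and> (\<forall>I. maximalideal I A \<longrightarrow> I = m)"

definition ideal_radical :: "('a, 'b) ring_scheme \<Rightarrow> 'a set \<Rightarrow> 'a set" where
  "ideal_radical A I = {a \<in> carrier A. \<exists>n::nat. a [^]\<^bsub>A\<^esub> n \<in> I}"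

text \<open>\<open>dim A\<close> elements generating an ideal of definition of \<open>(A, m)\<close>.\<close>

definition system_of_parameters :: "('a, 'b) ring_scheme \<Rightarrow> 'a set \<Rightarrow> 'a list \<Rightarrow> bool" where
  "system_of_parameters A m xs \<longleftrightarrow>
     set xs \<subseteq> m \<and> enat (length xs) = krull_dim A \<and> ideal_radical A (genideal A (set xs)) = m"

definition ideal_colon :: "('a, 'b) ring_scheme \<Rightarrow> 'a set \<Rightarrow> 'a \<Rightarrow> 'a set" where
  "ideal_colon A I x = {a \<in> carrier A. a \<otimes>\<^bsub>A\<^esub> x \<in> I}"

definition weak_regular_sequence :: "('a, 'b) ring_scheme \<Rightarrow> 'a set \<Rightarrow> 'a list \<Rightarrow> bool" where
  "weak_regular_sequence A m xs \<longleftrightarrow>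
     (\<forall>i < length xs.
        ideal_prod A m (ideal_colon A (genideal A (set (take i xs))) (xs ! i))
          \<subseteq> genideal A (set (take i xs)))"

definition buchsbaum_ring :: "('a, 'b) ring_scheme \<Rightarrow> bool" where
  "buchsbaum_ring A \<longleftrightarrow>
     (\<exists>m. noetherian_local_ring A m \<and>
          (\<forall>xs. system_of_parameters A m xs \<longrightarrow> weak_regular_sequence A m xs))"


section \<open>Semigroup rings\<close>

text \<open>The type \<^typ>\<open>(nat ^ 'd) \<Rightarrow>\<^sub>0 'k\<close> with its convolution product is the polynomial ring
  \<open>K[t\<^sub>1, \<dots>, t\<^sub>d]\<close>: the monomial \<open>t\<^sup>a\<close> is \<open>Poly_Mapping.single a 1\<close>, and \<open>K[S]\<close> consists of the
  polynomials all of whose exponents lie in \<open>S\<close>.\<close>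

definition semigroup_ring :: "(nat ^ 'd) set \<Rightarrow> ((nat ^ 'd) \<Rightarrow>\<^sub>0 'k::field) ring" where
  "semigroup_ring S =
     \<lparr> carrier = {p. Poly_Mapping.keys p \<subseteq> S},
       monoid.mult = (*), one = 1, ring.zero = 0, add = (+) \<rparr>"

definition max_homogeneous_ideal :: "(nat ^ 'd) set \<Rightarrow> ((nat ^ 'd) \<Rightarrow>\<^sub>0 'k::field) set" where
  "max_homogeneous_ideal S =
     genideal (semigroup_ring S) ((\<lambda>a. Poly_Mapping.single a 1) ` (S - {0}))"

definition buchsbaum_semigroup :: "'k::field itself \<Rightarrow> (nat ^ 'd) set \<Rightarrow> bool" where
  "buchsbaum_semigroup _ S \<longleftrightarrow>
     buchsbaum_ring (localization_at
       (semigroup_ring S :: ((nat ^ 'd) \<Rightarrow>\<^sub>0 'k) ring) (max_homogeneous_ideal S))"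

end

theory Submission
  imports Defs "HOL-Analysis.Cartesian_Space" "HOL-Computational_Algebra.Polynomial"
begin

text \<open>Let \<open>C\<close> be the integer cone of \<open>S\<close>, let \<open>P\<close> be the maximal homogeneous ideal of \<open>K[S]\<close>, let
  \<open>A\<close> be the localization of \<open>K[S]\<close> at \<open>P\<close>, and let \<open>M\<close> be the complement of \<open>P\<close>, the polynomials in \<open>K[S]\<close>
  with nonzero constant term. Since \<open>S\<close> is simplicial, there are elements \<open>a\<^sub>1, \<dots>, a\<^sub>d\<close> of \<open>S\<close>, one on each
  extremal ray, that form a basis of \<open>\<rat>\<^sup>d\<close>, and \<open>C\<close> consists of the vectors in \<open>\<nat>\<^sup>d\<close> whose coordinates in this
  basis are nonnegative. In particular a vector of \<open>C\<close> whose \<open>j\<close>-th coordinate is at least \<open>n\<close> is the sum of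
  \<open>n a\<^sub>j\<close> and a vector of \<open>C\<close>, which belongs to \<open>S\<close> once it has a large coordinate, because \<open>S\<close> has finitely
  many gaps.

  A Buchsbaum semigroup has only pseudo-Frobenius gaps: for large \<open>N\<close> the monomials \<open>y\<^sub>j = t\<^bsup>N a\<^sub>j\<^esup>\<close> form a system
  of parameters of \<open>A\<close>. If \<open>h\<close> is a gap, then \<open>h + N a\<^sub>1\<close> and \<open>h + N a\<^sub>2\<close> are in \<open>S\<close>, and
  \<open>t\<^bsup>h + N a\<^sub>1\<^esup> y\<^sub>2 = t\<^bsup>h + N a\<^sub>2\<^esup> y\<^sub>1\<close> shows that \<open>t\<^bsup>h + N a\<^sub>1\<^esup>\<close> lies in \<open>(y\<^sub>1) : y\<^sub>2\<close>; this is where \<open>d > 1\<close> enters.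
  By weak regularity \<open>t\<^bsup>s + h + N a\<^sub>1\<^esup>\<close> is in \<open>y\<^sub>1 A\<close> for every nonzero \<open>s\<close> in \<open>S\<close>, and comparing exponents gives
  \<open>s + h \<in> S\<close>.

  Conversely, if every gap is pseudo-Frobenius, then \<open>P K[C] \<subseteq> K[S]\<close>. It suffices to know that every system of parameters
  \<open>x\<^sub>1, \<dots>, x\<^sub>d\<close> of \<open>A\<close> is a regular sequence on the localization of \<open>K[C]\<close> at \<open>M\<close>. If \<open>b x\<^sub>i\<close> is in the ideal
  \<open>(x\<^sub>1, \<dots>, x\<^sub>i\<^sub>-\<^sub>1)\<close> of \<open>A\<close>, then \<open>b\<close> is a combination of \<open>x\<^sub>1, \<dots>, x\<^sub>i\<^sub>-\<^sub>1\<close> over the larger ring, and multiplication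
  by an element of \<open>P\<close> makes the coefficients elements of \<open>A\<close>; so \<open>A\<close> is Buchsbaum. The regularity is a depth
  argument: powers of the monomials \<open>t\<^bsup>a\<^sub>j\<^esup>\<close> form a regular sequence on \<open>K[C]\<close> by the description of \<open>C\<close> in
  coordinates (\<open>monomials_regular\<close>), they lie in the ideal generated by the \<open>x\<^sub>i\<close> because this ideal has radical
  \<open>P\<close>, and any \<open>d\<close> elements whose ideal contains a regular sequence of length \<open>d\<close> have an acyclic Koszul
  complex (\<open>koszul_acyclic_mod\<close>). Nakayama's lemma then turns acyclicity into regularity
  (\<open>regular_seq_radical\<close>).

  Both directions use that \<open>A\<close> has dimension \<open>d\<close>. A chain of primes of length \<open>n\<close> in a subalgebra of
  \<open>K[t\<^sub>1, \<dots>, t\<^sub>d]\<close> yields \<open>n\<close> elements without algebraic relation, and counting monomials gives \<open>n \<le> d\<close>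
  (\<open>no_long_prime_chain\<close>). The ideals spanned by the monomials outside the faces of the cone form a chain of
  length \<open>d\<close> (\<open>prime_set_face\<close>).\<close>

(* The indeterminate of univariate polynomials; here X is a variable. *)
no_notation Polynomials.var (\<open>X\<index>\<close>)

abbreviation lookup where "lookup \<equiv> Poly_Mapping.lookup"
abbreviation keys where "keys \<equiv> Poly_Mapping.keys"

section \<open>Subrings, generated ideals and the Noetherian property\<close>

locale subring_of =
  fixes R :: "'r::comm_ring_1 set"
  assumes one_mem [simp, intro]: "1 \<in> R"
    and diff_mem [simp, intro]: "a \<in> R \<Longrightarrow> b \<in> R \<Longrightarrow> a - b \<in> R"
    and mult_mem [simp, intro]: "a \<in> R \<Longrightarrow> b \<in> R \<Longrightarrow> a * b \<in> R"
begin

lemma zero_mem [simp, intro]: "0 \<in> R"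
  using diff_mem[OF one_mem one_mem] by simp

lemma uminus_mem [simp, intro]: "a \<in> R \<Longrightarrow> - a \<in> R"
  using diff_mem[OF zero_mem] by simp

lemma add_mem [simp, intro]: "a \<in> R \<Longrightarrow> b \<in> R \<Longrightarrow> a + b \<in> R"
  using diff_mem[of a "- b"] by simp

lemma sum_mem: "(\<And>i. i \<in> I \<Longrightarrow> f i \<in> R) \<Longrightarrow> sum f I \<in> R"
  by (induction I rule: infinite_finite_induct) auto

lemma power_mem: "a \<in> R \<Longrightarrow> a ^ n \<in> R"
  by (induction n) auto

end

text \<open>The \<open>R\<close>-submodule generated by \<open>X\<close>. The rings \<open>K[S] \<subseteq> K[C]\<close> are treated as subsets of one polynomial ring,
  so that the coefficients have to be restricted explicitly.\<close>
inductive_set rspan :: "'r::comm_ring_1 set \<Rightarrow> 'r set \<Rightarrow> 'r set" for R X where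
  zero: "0 \<in> rspan R X"
| step: "r \<in> R \<Longrightarrow> x \<in> X \<Longrightarrow> g \<in> rspan R X \<Longrightarrow> r * x + g \<in> rspan R X"

lemma rspan_mono: "g \<in> rspan R X \<Longrightarrow> R \<subseteq> R' \<Longrightarrow> X \<subseteq> Y \<Longrightarrow> g \<in> rspan R' Y"
  by (induction rule: rspan.induct) (auto intro: rspan.intros)

lemma rspan_add: "g \<in> rspan R X \<Longrightarrow> h \<in> rspan R X \<Longrightarrow> g + h \<in> rspan R X"
  by (induction rule: rspan.induct) (auto intro: rspan.intros simp: add.assoc)

lemma rspan_sum: "(\<And>i. i \<in> I \<Longrightarrow> f i \<in> rspan R X) \<Longrightarrow> sum f I \<in> rspan R X"
  by (induction I rule: infinite_finite_induct) (auto intro: rspan.zero rspan_add)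

lemma rspan_empty [simp]: "rspan R {} = {0}"
  by (auto elim: rspan.cases intro: rspan.intros)

context subring_of
begin

lemma rspan_mult: "g \<in> rspan R X \<Longrightarrow> r \<in> R \<Longrightarrow> r * g \<in> rspan R X"
proof (induction rule: rspan.induct)
  case (step s x g)
  then have "(r * s) * x + r * g \<in> rspan R X" by (intro rspan.step) auto
  then show ?case by (simp add: algebra_simps)
qed (auto intro: rspan.intros)

lemma rspan_uminus: "g \<in> rspan R X \<Longrightarrow> - g \<in> rspan R X"
  using rspan_mult[of g X "-1"] by simp

lemma rspan_diff: "g \<in> rspan R X \<Longrightarrow> h \<in> rspan R X \<Longrightarrow> g - h \<in> rspan R X"
  using rspan_add[OF _ rspan_uminus] by fastforce

lemma rspan_base: "x \<in> X \<Longrightarrow> x \<in> rspan R X"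
  using rspan.step[OF one_mem _ rspan.zero, of x X] by simp

lemma rspan_subset: "X \<subseteq> R \<Longrightarrow> g \<in> rspan R X \<Longrightarrow> g \<in> R"
  by (rotate_tac, induction rule: rspan.induct) auto

lemma rspan_rspan:
  assumes "g \<in> rspan R Y" and "\<And>y. y \<in> Y \<Longrightarrow> y \<in> rspan R X"
  shows "g \<in> rspan R X"
  using assms(1) by (induction rule: rspan.induct) (auto intro: rspan.zero rspan_add rspan_mult assms(2))

lemma rspan_insert: "g \<in> rspan R (insert y Y) \<longleftrightarrow> (\<exists>r\<in>R. \<exists>h\<in>rspan R Y. g = r * y + h)"
proof
  assume "g \<in> rspan R (insert y Y)"
  then show "\<exists>r\<in>R. \<exists>h\<in>rspan R Y. g = r * y + h"
  proof (induction rule: rspan.induct)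
    case zero
    show ?case by (rule bexI[of _ 0], rule bexI[of _ 0]) (auto intro: rspan.zero)
  next
    case (step s x g)
    then obtain r h where r: "r \<in> R" "h \<in> rspan R Y" "g = r * y + h" by blast
    show ?case
    proof (cases "x = y")
      case True
      have "s * x + g = (s + r) * y + h" using r True by (simp add: algebra_simps)
      then show ?thesis using r step by (intro bexI[of _ "s + r"] bexI[of _ h]) auto
    next
      case False
      then have "s * x + h \<in> rspan R Y" using step r by (auto intro: rspan.step)
      moreover have "s * x + g = r * y + (s * x + h)" using r by (simp add: algebra_simps)
      ultimately show ?thesis using r(1) by (intro bexI[of _ r] bexI[of _ "s * x + h"])
    qed
  qed
next
  assume "\<exists>r\<in>R. \<exists>h\<in>rspan R Y. g = r * y + h"
  then show "g \<in> rspan R (insert y Y)"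
    using rspan_mono[of _ R Y R "insert y Y"] by (auto intro!: rspan.step)
qed

end

abbreviation dot :: "'r::comm_ring_1 list \<Rightarrow> 'r list \<Rightarrow> 'r" where
  "dot rs fs \<equiv> sum_list (map2 (*) rs fs)"

lemma (in subring_of) rspan_list:
  "g \<in> rspan R (set fs) \<longleftrightarrow> (\<exists>rs. length rs = length fs \<and> set rs \<subseteq> R \<and> g = dot rs fs)"
proof (induction fs arbitrary: g)
  case (Cons f fs)
  show ?case
  proof
    assume "g \<in> rspan R (set (f # fs))"
    then obtain r h where "r \<in> R" "h \<in> rspan R (set fs)" "g = r * f + h"
      using rspan_insert by auto
    moreover obtain rs where "length rs = length fs" "set rs \<subseteq> R" "h = dot rs fs"
      using Cons.IH[of h] \<open>h \<in> _\<close> by blast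
    ultimately show "\<exists>rs. length rs = length (f # fs) \<and> set rs \<subseteq> R \<and> g = dot rs (f # fs)"
      by (intro exI[of _ "r # rs"]) auto
  next
    assume "\<exists>rs. length rs = length (f # fs) \<and> set rs \<subseteq> R \<and> g = dot rs (f # fs)"
    then obtain rs where rs: "length rs = length (f # fs)" "set rs \<subseteq> R" "g = dot rs (f # fs)" by blast
    then obtain r rs' where "rs = r # rs'" by (cases rs) auto
    with rs Cons.IH[of "dot rs' fs"] have "dot rs' fs \<in> rspan R (set fs)" by auto
    with rs \<open>rs = r # rs'\<close> show "g \<in> rspan R (set (f # fs))"
      using rspan_insert[of g f "set fs"] by auto
  qed
qed auto

text \<open>This form of the Noetherian property passes to free modules and polynomial rings by manipulating a single
  sequence, and it asks for a relation with the earlier elements only, not for a finite generating set.\<close>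
definition noetherian :: "'r::comm_ring_1 set \<Rightarrow> bool" where
  "noetherian R \<longleftrightarrow> (\<forall>w. (\<forall>k::nat. w k \<in> R) \<longrightarrow> (\<exists>k. w k \<in> rspan R (w ` {..<k})))"

text \<open>Otherwise some element with arbitrarily large index is outside the span of everything before it, and these
  elements form a subsequence none of whose members is in the span of the previous ones.\<close>
lemma noetherian_stable:
  assumes "noetherian R" and w: "\<And>k::nat. w k \<in> R"
  obtains k where "\<And>l. l \<ge> k \<Longrightarrow> w l \<in> rspan R (w ` {..<k})"
proof (rule ccontr)
  assume "\<not> thesis"
  with that have "\<forall>k. \<exists>l\<ge>k. w l \<notin> rspan R (w ` {..<k})" by blast
  then obtain h where h: "\<And>k. h k \<ge> k" "\<And>k. w (h k) \<notin> rspan R (w ` {..<k})" by metis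
  define p where "p = rec_nat (h 0) (\<lambda>_ q. h (Suc q))"
  have p: "p 0 = h 0" "\<And>m. p (Suc m) = h (Suc (p m))" by (simp_all add: p_def)
  have "strict_mono p" unfolding strict_mono_Suc_iff using h(1) p by (metis Suc_le_eq)
  obtain m where m: "w (p m) \<in> rspan R ((\<lambda>j. w (p j)) ` {..<m})"
    using assms(1) w unfolding noetherian_def by (elim allE[of _ "\<lambda>j. w (p j)"]) blast
  show False
  proof (cases m)
    case 0
    then show ?thesis using m h(2)[of 0] p by simp
  next
    case (Suc n)
    have "j < m \<Longrightarrow> p j < Suc (p n)" for j
      using \<open>strict_mono p\<close> Suc by (simp add: less_Suc_eq_le strict_mono_less_eq)
    then have "(\<lambda>j. w (p j)) ` {..<m} \<subseteq> w ` {..<Suc (p n)}" by blast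
    from rspan_mono[OF m order_refl this] h(2)[of "Suc (p n)"] p Suc show ?thesis by simp
  qed
qed

lemma (in subring_of) rspan_image:
  assumes "finite I" "g \<in> rspan R (w ` I)"
  shows "\<exists>r. (\<forall>i\<in>I. r i \<in> R) \<and> g = (\<Sum>i\<in>I. r i * w i)"
  using assms
proof (induction I arbitrary: g)
  case (insert i I)
  then have "g \<in> rspan R (insert (w i) (w ` I))" by simp
  then obtain s h where "s \<in> R" "h \<in> rspan R (w ` I)" "g = s * w i + h"
    unfolding rspan_insert by blast
  moreover from insert.IH[OF this(2)] obtain r
    where "\<forall>i\<in>I. r i \<in> R" "h = (\<Sum>i\<in>I. r i * w i)" by blast
  moreover have "(\<Sum>j\<in>I. (r(i := s)) j * w j) = (\<Sum>j\<in>I. r j * w j)"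
    using insert.hyps by (intro sum.cong) auto
  ultimately show ?case
    using insert.hyps by (intro exI[of _ "r(i := s)"]) (auto simp del: fun_upd_apply, auto)
qed auto

text \<open>The free module \<open>R\<^bsup>X\<^esup>\<close> is Noetherian. Induction on \<open>X\<close>: from some index on, the coordinate \<open>y\<close> is a combination
  of finitely many earlier ones; subtracting this combination gives a sequence with vanishing coordinate \<open>y\<close>, to
  which the induction hypothesis applies.\<close>
lemma (in subring_of) noetherian_module:
  assumes "noetherian R" "finite X" "\<And>(k::nat) x. x \<in> X \<Longrightarrow> w k x \<in> R"
  shows "\<exists>k r. (\<forall>j<k. r j \<in> R) \<and> (\<forall>x\<in>X. w k x = (\<Sum>j<k. r j * w j x))"
  using assms(2,3)
proof (induction X arbitrary: w)
  case empty
  show ?case by (rule exI[of _ "0::nat"]) simp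
next
  case (insert y X)
  obtain k0 where k0: "\<And>l. l \<ge> k0 \<Longrightarrow> w l y \<in> rspan R ((\<lambda>j. w j y) ` {..<k0})"
    using noetherian_stable[OF assms(1), of "\<lambda>j. w j y"] insert.prems by auto
  have "\<exists>r. (\<forall>j<k0. r j \<in> R) \<and> w (k0 + l) y = (\<Sum>j<k0. r j * w j y)" for l
    using rspan_image[OF _ k0[of "k0 + l"]] by auto
  then obtain r where r: "\<And>l j. j < k0 \<Longrightarrow> r l j \<in> R"
    "\<And>l. w (k0 + l) y = (\<Sum>j<k0. r l j * w j y)" by metis
  define w' where "w' l x = w (k0 + l) x - (\<Sum>j<k0. r l j * w j x)" for l x
  have "w' l x \<in> R" if "x \<in> X" for l x
    using that insert.prems r(1) unfolding w'_def by (auto intro!: sum_mem)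
  then have "\<exists>k r. (\<forall>j<k. r j \<in> R) \<and> (\<forall>x\<in>X. w' k x = (\<Sum>j<k. r j * w' j x))"
    by (rule insert.IH)
  then obtain k s where s: "\<And>j. j < k \<Longrightarrow> s j \<in> R"
    "\<And>x. x \<in> X \<Longrightarrow> w' k x = (\<Sum>j<k. s j * w' j x)" by metis
  have y0: "w' l y = 0" for l unfolding w'_def r(2)[of l] by simp
  have s': "w' k x = (\<Sum>j<k. s j * w' j x)" if "x \<in> insert y X" for x
    using that s(2) y0 by auto
  define t where "t j = (if j < k0 then r k j - (\<Sum>i<k. s i * r i j) else s (j - k0))" for j
  have "t j \<in> R" if "j < k0 + k" for j
    using that s(1) r(1) unfolding t_def by (auto intro!: sum_mem)
  moreover have "w (k0 + k) x = (\<Sum>j<k0 + k. t j * w j x)" if x: "x \<in> insert y X" for x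
  proof -
    have split: "(\<Sum>j<k0 + k. t j * w j x) = (\<Sum>j<k0. t j * w j x) + (\<Sum>j<k. t (k0 + j) * w (k0 + j) x)"
      by (induction k) (auto simp: algebra_simps)
    have "(\<Sum>j<k0. t j * w j x) = (\<Sum>j<k0. r k j * w j x) - (\<Sum>j<k0. \<Sum>i<k. s i * r i j * w j x)"
      unfolding t_def by (simp add: left_diff_distrib sum_subtractf sum_distrib_right)
    also have "(\<Sum>j<k0. \<Sum>i<k. s i * r i j * w j x) = (\<Sum>i<k. s i * (\<Sum>j<k0. r i j * w j x))"
      by (subst sum.swap) (simp add: sum_distrib_left mult.assoc)
    finally have 1: "(\<Sum>j<k0. t j * w j x) = (\<Sum>j<k0. r k j * w j x) - (\<Sum>i<k. s i * (\<Sum>j<k0. r i j * w j x))" .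
    have 2: "(\<Sum>j<k. t (k0 + j) * w (k0 + j) x) = (\<Sum>j<k. s j * w' j x) + (\<Sum>i<k. s i * (\<Sum>j<k0. r i j * w j x))"
      unfolding t_def w'_def by (simp add: right_diff_distrib sum_subtractf)
    show ?thesis unfolding split 1 2 s'[OF x, symmetric] by (simp add: w'_def)
  qed
  ultimately show ?case by (intro exI[of _ "k0 + k"] exI[of _ t]) auto
qed

section \<open>The Koszul complex\<close>

text \<open>The Koszul complex of a list as an iterated mapping cone. A position of a chain is a basis element of the
  exterior algebra, encoded by the list of booleans that says which \<open>e\<^sub>i\<close> occur; the degree is the number of
  occurrences of \<open>True\<close>. The recursion on the list takes care of all signs.\<close>
fun koszul_d :: "'r::comm_ring_1 list \<Rightarrow> (bool list \<Rightarrow> 'r) \<Rightarrow> bool list \<Rightarrow> 'r" where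
  "koszul_d (f # fs) c (False # bs) = koszul_d fs (\<lambda>b. c (False # b)) bs + f * c (True # bs)"
| "koszul_d (f # fs) c (True # bs) = - koszul_d fs (\<lambda>b. c (True # b)) bs"
| "koszul_d _ c _ = 0"

text \<open>Exterior multiplication by \<open>\<Sum> r\<^sub>i e\<^sub>i\<close>.\<close>
fun koszul_h :: "'r::comm_ring_1 list \<Rightarrow> (bool list \<Rightarrow> 'r) \<Rightarrow> bool list \<Rightarrow> 'r" where
  "koszul_h (r # rs) c (False # bs) = koszul_h rs (\<lambda>b. c (False # b)) bs"
| "koszul_h (r # rs) c (True # bs) = r * c (False # bs) - koszul_h rs (\<lambda>b. c (True # b)) bs"
| "koszul_h _ c _ = 0"

lemma koszul_d_add: "koszul_d fs (\<lambda>b. c b + d b) bs = koszul_d fs c bs + koszul_d fs d bs"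
proof (induction fs c bs arbitrary: d rule: koszul_d.induct)
  case (1 f fs c bs)
  show ?case using 1[of "\<lambda>b. d (False # b)"] by (simp add: algebra_simps)
next
  case (2 f fs c bs)
  show ?case using 2[of "\<lambda>b. d (True # b)"] by simp
qed auto

lemma koszul_d_mult: "koszul_d fs (\<lambda>b. r * c b) bs = r * koszul_d fs c bs"
  by (induction fs c bs rule: koszul_d.induct) (auto simp: algebra_simps)

lemma koszul_d_uminus: "koszul_d fs (\<lambda>b. - c b) bs = - koszul_d fs c bs"
  using koszul_d_mult[of fs "-1" c bs] by simp

lemma koszul_d_diff: "koszul_d fs (\<lambda>b. c b - d b) bs = koszul_d fs c bs - koszul_d fs d bs"
  using koszul_d_add[of fs c "\<lambda>b. - d b" bs] by (simp add: koszul_d_uminus)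

lemma koszul_h_uminus: "koszul_h fs (\<lambda>b. - c b) bs = - koszul_h fs c bs"
  by (induction fs c bs rule: koszul_h.induct) auto

lemma koszul_h_add: "koszul_h fs (\<lambda>b. c b + d b) bs = koszul_h fs c bs + koszul_h fs d bs"
proof (induction fs c bs arbitrary: d rule: koszul_h.induct)
  case (2 f fs c bs)
  show ?case using 2[of "\<lambda>b. d (True # b)"] by (simp add: algebra_simps)
qed auto

lemma koszul_h_mult: "koszul_h fs (\<lambda>b. r * c b) bs = r * koszul_h fs c bs"
  by (induction fs c bs rule: koszul_h.induct) (auto simp: algebra_simps)

lemma koszul_d_zero [simp]: "koszul_d fs (\<lambda>b. 0) bs = 0"
  using koszul_d_mult[of fs 0 "\<lambda>b. 0" bs] by simp

lemma koszul_d_d: "koszul_d fs (koszul_d fs c) bs = 0"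
proof (induction fs arbitrary: c bs)
  case IH: (Cons f fs)
  have "(\<lambda>b. koszul_d (f # fs) c (False # b)) = (\<lambda>b. koszul_d fs (\<lambda>b. c (False # b)) b + f * c (True # b))"
    by simp
  moreover have "(\<lambda>b. koszul_d (f # fs) c (True # b)) = (\<lambda>b. - koszul_d fs (\<lambda>b. c (True # b)) b)"
    by simp
  ultimately show ?case
  proof (cases bs)
    case (Cons b bs')
    then show ?thesis
      by (cases b) (simp_all add: koszul_d_add koszul_d_mult koszul_d_uminus IH.IH)
  qed simp
qed simp

text \<open>Multiplication by an element of the ideal generated by \<open>fs\<close> is null-homotopic, hence zero on homology.\<close>
lemma koszul_homotopy:
  "length bs = length fs \<Longrightarrow> length rs = length fs \<Longrightarrow>
   koszul_d fs (koszul_h rs c) bs + koszul_h rs (koszul_d fs c) bs = dot rs fs * c bs"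
proof (induction fs arbitrary: rs c bs)
  case (Cons f fs)
  obtain r rs' where rs: "rs = r # rs'" "length rs' = length fs" using Cons.prems by (cases rs) auto
  obtain b bs' where bs: "bs = b # bs'" "length bs' = length fs" using Cons.prems by (cases bs) auto
  note IH = Cons.IH[OF bs(2) rs(2)]
  show ?case
  proof (cases b)
    case True
    have "koszul_d fs (koszul_h rs' (\<lambda>b. c (True # b))) bs' = dot rs' fs * c (True # bs') - koszul_h rs' (koszul_d fs (\<lambda>b. c (True # b))) bs'"
      using IH[of "\<lambda>b. c (True # b)"] by (simp add: algebra_simps)
    with True show ?thesis
      by (simp add: rs bs koszul_d_diff koszul_d_mult koszul_h_uminus algebra_simps)
  next
    case False
    have "koszul_d fs (koszul_h rs' (\<lambda>b. c (False # b))) bs' = dot rs' fs * c (False # bs') - koszul_h rs' (koszul_d fs (\<lambda>b. c (False # b))) bs'"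
      using IH[of "\<lambda>b. c (False # b)"] by (simp add: algebra_simps)
    with False show ?thesis
      by (simp add: rs bs koszul_h_add koszul_h_mult algebra_simps)
  qed
qed auto

lemma koszul_d_cong: "(\<And>b. length b = length bs \<Longrightarrow> c b = d b) \<Longrightarrow> koszul_d fs c bs = koszul_d fs d bs"
  by (induction fs c bs arbitrary: d rule: koszul_d.induct) auto

lemma koszul_h_cong: "(\<And>b. length b = length bs \<Longrightarrow> c b = d b) \<Longrightarrow> koszul_h fs c bs = koszul_h fs d bs"
  by (induction fs c bs arbitrary: d rule: koszul_h.induct) auto

text \<open>Only the values at lists of length \<open>n\<close> matter.\<close>
definition koszul_chain :: "'r::comm_ring_1 set \<Rightarrow> nat \<Rightarrow> nat \<Rightarrow> (bool list \<Rightarrow> 'r) \<Rightarrow> bool" where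
  "koszul_chain R n i c \<longleftrightarrow> (\<forall>bs. length bs = n \<longrightarrow> c bs \<in> R \<and> (count_list bs True \<noteq> i \<longrightarrow> c bs = 0))"

lemma (in subring_of) rspan_koszul_d:
  assumes "set fs \<subseteq> R" "\<And>b. length b = length bs \<Longrightarrow> c b \<in> rspan R X"
  shows "koszul_d fs c bs \<in> rspan R X"
  using assms
  by (induction fs c bs rule: koszul_d.induct)
     (auto intro!: rspan_add rspan_uminus rspan_mult rspan.zero)

lemma (in subring_of) rspan_koszul_h:
  assumes "set fs \<subseteq> R" "\<And>b. length b = length bs \<Longrightarrow> c b \<in> rspan R X"
  shows "koszul_h fs c bs \<in> rspan R X"
  using assms
  by (induction fs c bs rule: koszul_h.induct)
     (auto intro!: rspan_diff rspan_mult rspan.zero)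

lemma (in subring_of) rspan_one: "rspan R {1} = R"
proof -
  have "g \<in> R \<Longrightarrow> g \<in> rspan R {1}" for g
    using rspan.step[of g R 1 "{1}" 0] by (auto intro: rspan.zero)
  moreover have "g \<in> rspan R {1} \<Longrightarrow> g \<in> R" for g
    using rspan_subset[of "{1}" g] by auto
  ultimately show ?thesis by blast
qed

lemma koszul_d_degree:
  "length bs = length fs \<Longrightarrow> \<forall>b. length b = length fs \<longrightarrow> count_list b True \<noteq> i \<longrightarrow> c b = 0
    \<Longrightarrow> Suc (count_list bs True) \<noteq> i \<Longrightarrow> koszul_d fs c bs = 0"
proof (induction fs c bs arbitrary: i rule: koszul_d.induct)
  case (1 f fs c bs)
  have "koszul_d fs (\<lambda>b. c (False # b)) bs = 0"
    using 1(2-4) by (intro 1(1)[of i]) auto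
  with 1(2-4) show ?case by simp
next
  case (2 f fs c bs)
  show ?case
  proof (cases i)
    case 0
    then have "koszul_d fs (\<lambda>b. c (True # b)) bs = koszul_d fs (\<lambda>_. 0) bs"
      using 2(2-4) by (intro koszul_d_cong) auto
    then show ?thesis by simp
  next
    case (Suc j)
    with 2(2-4) show ?thesis by (auto intro!: 2(1)[of j])
  qed
qed auto

lemma koszul_h_degree:
  "length bs = length fs \<Longrightarrow> \<forall>b. length b = length fs \<longrightarrow> count_list b True \<noteq> i \<longrightarrow> c b = 0
    \<Longrightarrow> count_list bs True \<noteq> Suc i \<Longrightarrow> koszul_h fs c bs = 0"
proof (induction fs c bs arbitrary: i rule: koszul_h.induct)
  case (1 f fs c bs)
  have "koszul_h fs (\<lambda>b. c (False # b)) bs = 0"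
    using 1(2-4) by (intro 1(1)[of i]) auto
  with 1(2-4) show ?case by simp
next
  case (2 f fs c bs)
  show ?case
  proof (cases i)
    case 0
    then have "koszul_h fs (\<lambda>b. c (True # b)) bs = koszul_h fs (\<lambda>_. 0) bs"
      using 2(2-4) by (intro koszul_h_cong) auto
    moreover have "koszul_h fs (\<lambda>_. 0) bs = 0" using koszul_h_mult[of fs 0 "\<lambda>_. 0" bs] by simp
    ultimately show ?thesis using 2(2-4) 0 by auto
  next
    case (Suc j)
    with 2(2-4) have "koszul_h fs (\<lambda>b. c (True # b)) bs = 0" by (intro 2(1)[of j]) auto
    with 2(2-4) Suc show ?thesis by auto
  qed
qed auto

lemma (in subring_of) koszul_chain_d:
  assumes "set fs \<subseteq> R" "koszul_chain R (length fs) (Suc i) c"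
  shows "koszul_chain R (length fs) i (koszul_d fs c)"
  using assms rspan_koszul_d[of fs _ c "{1}"] koszul_d_degree[of _ fs "Suc i" c]
  unfolding koszul_chain_def by (auto simp: rspan_one)

lemma (in subring_of) koszul_chain_h:
  assumes "set rs \<subseteq> R" "koszul_chain R (length rs) i c"
  shows "koszul_chain R (length rs) (Suc i) (koszul_h rs c)"
  using assms rspan_koszul_h[of rs _ c "{1}"] koszul_h_degree[of _ rs i c]
  unfolding koszul_chain_def by (auto simp: rspan_one)

text \<open>The ring \<open>M\<^sup>-\<^sup>1R\<close>. Statements about its elements are phrased with denominators cleared: they hold after
  multiplication by some \<open>u \<in> M\<close>.\<close>
locale fractions_of = subring_of R for R :: "'r::comm_ring_1 set" +
  fixes M :: "'r set"
  assumes M_sub: "M \<subseteq> R" and M_one [simp, intro]: "1 \<in> M"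
    and M_mult [simp, intro]: "u \<in> M \<Longrightarrow> v \<in> M \<Longrightarrow> u * v \<in> M"
begin

definition regular_seq :: "'r list \<Rightarrow> bool" where
  "regular_seq ys \<longleftrightarrow> (\<forall>k<length ys. \<forall>r\<in>R. ys ! k * r \<in> rspan R (set (take k ys)) \<longrightarrow> r \<in> rspan R (set (take k ys)))"

text \<open>The Koszul complex of \<open>fs\<close> is acyclic in positive degrees after localization at \<open>M\<close>, provided its ideal contains a
  regular sequence \<open>ys\<close> with as many terms. More generally the homology modulo \<open>y\<^sub>1, \<dots>, y\<^sub>k\<close> vanishes in degrees
  above \<open>k\<close>. For \<open>k\<close> the full length this holds because the complex has no terms in these degrees. Going from
  \<open>k + 1\<close> to \<open>k\<close>: \<open>y\<^sub>k\<^sub>+\<^sub>1\<close> annihilates the homology by the homotopy formula, so in the long exact sequence of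
  multiplication by \<open>y\<^sub>k\<^sub>+\<^sub>1\<close> the homology in degree \<open>i\<close> is a quotient of the homology in degree \<open>i + 1\<close> modulo one
  more element.\<close>
lemma koszul_acyclic_mod:
  assumes "set fs \<subseteq> R" "set ys \<subseteq> R" "length ys = length fs" "regular_seq ys"
    and rad: "\<And>y. y \<in> set ys \<Longrightarrow> \<exists>u\<in>M. u * y \<in> rspan R (set fs)"
    and "k \<le> length ys" "k < i"
    and "koszul_chain R (length fs) i z"
    and "\<And>bs. length bs = length fs \<Longrightarrow> koszul_d fs z bs \<in> rspan R (set (take k ys))"
  shows "\<exists>u\<in>M. \<exists>v. koszul_chain R (length fs) (Suc i) v \<and>
           (\<forall>bs. length bs = length fs \<longrightarrow> u * z bs - koszul_d fs v bs \<in> rspan R (set (take k ys)))"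
  using assms(6-9)
proof (induction k arbitrary: i z rule: inc_induct)
  case base
  have "count_list bs True \<noteq> i" if "length bs = length fs" for bs
    using count_le_length[of bs True] that base assms(3) by auto
  then have "z bs = 0" if "length bs = length fs" for bs
    using base(2) that unfolding koszul_chain_def by auto
  then show ?case
    by (intro bexI[of _ 1] exI[of _ "\<lambda>_. 0"]) (auto simp: koszul_chain_def intro: rspan.zero)
next
  case (step k)
  let ?n = "length fs"
  let ?I = "rspan R (set (take k ys))" and ?I' = "rspan R (set (take (Suc k) ys))"
  define y where "y = ys ! k"
  have yin: "y \<in> set ys" "y \<in> R" using step(2) assms(2) unfolding y_def by auto
  have tk: "set (take (Suc k) ys) = insert y (set (take k ys))"
    using step(2) by (simp add: take_Suc_conv_app_nth y_def)
  have II: "g \<in> ?I'" if "g \<in> ?I" for g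
    using rspan_mono[OF that order_refl] unfolding tk by auto
  obtain u rs where u: "u \<in> M" and rs: "length rs = ?n" "set rs \<subseteq> R" "u * y = dot rs fs"
    using rad[OF yin(1)] rspan_list by auto
  have uR: "u \<in> R" using u M_sub by auto
  \<comment> \<open>The preimage of \<open>z\<close> under the connecting map: \<open>w\<close> is a cycle modulo \<open>y\<close>, with boundary \<open>u y z\<close> up to \<open>?I\<close>.\<close>
  define w where "w = koszul_h rs z"
  have wch: "koszul_chain R ?n (Suc i) w"
    using koszul_chain_h[OF rs(2), of i z] step(5) rs(1) unfolding w_def by simp
  have w1: "koszul_d fs w bs - (u * y) * z bs \<in> ?I" if "length bs = ?n" for bs
  proof -
    have "koszul_d fs w bs - (u * y) * z bs = - koszul_h rs (koszul_d fs z) bs"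
      using koszul_homotopy[of bs fs rs z] that rs unfolding w_def by (simp add: algebra_simps)
    moreover have "koszul_h rs (koszul_d fs z) bs \<in> ?I"
      using that step(6) rs(2) by (intro rspan_koszul_h) auto
    ultimately show ?thesis using rspan_uminus by simp
  qed
  have zR: "z bs \<in> R" if "length bs = ?n" for bs using that step(5) unfolding koszul_chain_def by auto
  have "koszul_d fs w bs \<in> ?I'" if "length bs = ?n" for bs
  proof -
    have "(u * z bs) * y \<in> ?I'"
      using zR[OF that] uR rspan_mult[OF rspan_base[of y], of "set (take (Suc k) ys)" "u * z bs"]
      by (simp add: tk)
    from rspan_add[OF II[OF w1[OF that]] this] show ?thesis by (simp add: algebra_simps)
  qed
  from step.IH[OF _ wch this] step(4) obtain u' v where u': "u' \<in> M" and v: "koszul_chain R ?n (Suc (Suc i)) v"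
    and v1: "\<And>bs. length bs = ?n \<Longrightarrow> u' * w bs - koszul_d fs v bs \<in> ?I'" by auto
  have u'R: "u' \<in> R" using u' M_sub by auto
  have vch: "koszul_chain R ?n (Suc i) (koszul_d fs v)" using koszul_chain_d[OF assms(1) v] .
  \<comment> \<open>Divide \<open>u' w - \<partial>v\<close> by \<open>y\<close> modulo \<open>?I\<close>, with value zero in the wrong degrees so that \<open>t\<close> is a chain.\<close>
  define t where "t bs = (if count_list bs True = Suc i then
     (SOME s. s \<in> R \<and> u' * w bs - koszul_d fs v bs - s * y \<in> ?I) else 0)" for bs
  have t: "t bs \<in> R \<and> u' * w bs - koszul_d fs v bs - t bs * y \<in> ?I" if "length bs = ?n" for bs
  proof (cases "count_list bs True = Suc i")
    case True
    have "u' * w bs - koszul_d fs v bs \<in> rspan R (insert y (set (take k ys)))"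
      using v1[OF that] unfolding tk .
    then obtain s h where sh: "s \<in> R" "h \<in> ?I" "u' * w bs - koszul_d fs v bs = s * y + h"
      unfolding rspan_insert by blast
    then have "\<exists>s. s \<in> R \<and> u' * w bs - koszul_d fs v bs - s * y \<in> ?I" by (intro exI[of _ s]) auto
    from someI_ex[OF this] show ?thesis unfolding t_def using True by simp
  next
    case False
    then show ?thesis using wch vch that unfolding t_def koszul_chain_def by (auto intro: rspan.zero)
  qed
  have tch: "koszul_chain R ?n (Suc i) t" using t unfolding koszul_chain_def t_def by auto
  have fin: "(u' * u) * z bs - koszul_d fs t bs \<in> ?I" if bs: "length bs = ?n" for bs
  proof -
    let ?g = "\<lambda>b. u' * w b - koszul_d fs v b - y * t b"
    have g: "koszul_d fs ?g bs \<in> ?I"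
      using t assms(1) bs by (intro rspan_koszul_d) (auto simp: mult.commute)
    have "koszul_d fs ?g bs = u' * koszul_d fs w bs - y * koszul_d fs t bs"
      by (simp add: koszul_d_diff koszul_d_mult koszul_d_d)
    then have "y * (u' * u * z bs - koszul_d fs t bs) = koszul_d fs ?g bs - u' * (koszul_d fs w bs - (u * y) * z bs)"
      by (simp add: algebra_simps)
    also have "\<dots> \<in> ?I" by (intro rspan_diff g rspan_mult w1 bs u'R)
    finally have "y * (u' * u * z bs - koszul_d fs t bs) \<in> ?I" .
    moreover have "koszul_d fs t bs \<in> R" using koszul_chain_d[OF assms(1) tch] bs unfolding koszul_chain_def by auto
    then have "u' * u * z bs - koszul_d fs t bs \<in> R" using zR[OF bs] uR u'R by auto
    ultimately show ?thesis using assms(4) step(2) unfolding regular_seq_def y_def by auto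
  qed
  show ?case using u u' tch fin by (intro bexI[of _ "u' * u"] exI[of _ t]) auto
qed

end

section \<open>Regular sequences and radicals\<close>

context fractions_of
begin

definition koszul_boundary :: "'r list \<Rightarrow> (bool list \<Rightarrow> 'r) \<Rightarrow> bool" where
  "koszul_boundary fs g \<longleftrightarrow> (\<exists>v. koszul_chain R (length fs) 2 v \<and> (\<forall>bs. length bs = length fs \<longrightarrow> g bs = koszul_d fs v bs))"

definition koszul_cycle :: "'r list \<Rightarrow> (bool list \<Rightarrow> 'r) \<Rightarrow> bool" where
  "koszul_cycle fs z \<longleftrightarrow> koszul_chain R (length fs) 1 z \<and> (\<forall>bs. length bs = length fs \<longrightarrow> koszul_d fs z bs = 0)"

definition H1_vanishes :: "'r list \<Rightarrow> bool" where
  "H1_vanishes fs \<longleftrightarrow> (\<forall>z. koszul_cycle fs z \<longrightarrow> (\<exists>u\<in>M. koszul_boundary fs (\<lambda>bs. u * z bs)))"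

lemma koszul_boundary_add: "koszul_boundary fs g \<Longrightarrow> koszul_boundary fs h \<Longrightarrow> koszul_boundary fs (\<lambda>bs. g bs + h bs)"
proof -
  assume "koszul_boundary fs g" "koszul_boundary fs h"
  then obtain v v' where "koszul_chain R (length fs) 2 v" "\<And>bs. length bs = length fs \<Longrightarrow> g bs = koszul_d fs v bs"
    "koszul_chain R (length fs) 2 v'" "\<And>bs. length bs = length fs \<Longrightarrow> h bs = koszul_d fs v' bs"
    unfolding koszul_boundary_def by blast
  then show ?thesis unfolding koszul_boundary_def koszul_chain_def
    by (intro exI[of _ "\<lambda>bs. v bs + v' bs"]) (auto simp: koszul_d_add)
qed

lemma koszul_boundary_mult: "koszul_boundary fs g \<Longrightarrow> r \<in> R \<Longrightarrow> koszul_boundary fs (\<lambda>bs. r * g bs)"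
proof -
  assume r: "r \<in> R" and "koszul_boundary fs g"
  then obtain v where "koszul_chain R (length fs) 2 v" "\<And>bs. length bs = length fs \<Longrightarrow> g bs = koszul_d fs v bs"
    unfolding koszul_boundary_def by blast
  then show ?thesis using r unfolding koszul_boundary_def koszul_chain_def
    by (intro exI[of _ "\<lambda>bs. r * v bs"]) (auto simp: koszul_d_mult)
qed

lemma koszul_boundary_zero: "koszul_boundary fs (\<lambda>bs. 0)"
  unfolding koszul_boundary_def koszul_chain_def by (intro exI[of _ "\<lambda>bs. 0"]) auto

lemma koszul_boundary_cong: "koszul_boundary fs g \<Longrightarrow> (\<And>bs. length bs = length fs \<Longrightarrow> g bs = h bs) \<Longrightarrow> koszul_boundary fs h"
  unfolding koszul_boundary_def by auto

text \<open>Nakayama's lemma, without generators. Extended by zero, a cycle \<open>z\<close> of the shorter complex is a cycle of the longer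
  one; a bounding chain exhibits \<open>u z\<close> as a boundary plus \<open>f\<close> times another cycle. Iteration gives a sequence of
  cycles \<open>w\<^sub>0 = z, w\<^sub>1, \<dots>\<close>, each congruent to a multiple of \<open>f\<close> times the next. As \<open>R\<close> is Noetherian, some \<open>w\<^sub>k\<close> is a
  combination of the previous ones, hence congruent to a multiple \<open>s f w\<^sub>k\<close> of itself up to some \<open>U \<in> M\<close>. The
  assumption on \<open>f\<close> says that it lies in the Jacobson radical of \<open>M\<^sup>-\<^sup>1R\<close>, so \<open>U - s f\<close> is a denominator and \<open>w\<^sub>k\<close>
  is a boundary; then so is \<open>z\<close>.\<close>
lemma H1_vanishes_tl:
  assumes "noetherian R" and fR: "f \<in> R" "set fs \<subseteq> R"
    and jac: "\<And>u r. u \<in> M \<Longrightarrow> r \<in> R \<Longrightarrow> u - r * f \<in> M"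
    and H: "H1_vanishes (f # fs)"
  shows "H1_vanishes fs"
  unfolding H1_vanishes_def
proof safe
  fix z assume z: "koszul_cycle fs z"
  let ?n = "length fs"
  have step: "\<exists>w u. koszul_cycle fs w \<and> u \<in> M \<and> koszul_boundary fs (\<lambda>bs. u * z bs - f * w bs)" if z: "koszul_cycle fs z" for z
  proof -
    define z' where "z' bs = (case bs of [] \<Rightarrow> 0 | b # bs \<Rightarrow> if b then 0 else z bs)" for bs
    have zF: "(\<lambda>b. z' (False # b)) = z" and zT: "(\<lambda>b. z' (True # b)) = (\<lambda>_. 0)"
      by (auto simp: z'_def)
    have cyc: "koszul_cycle (f # fs) z'"
      unfolding koszul_cycle_def koszul_chain_def
    proof safe
      fix bs :: "bool list" assume "length bs = length (f # fs)"
      then obtain b bs' where bs: "bs = b # bs'" "length bs' = ?n" by (cases bs) auto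
      then show "z' bs \<in> R" "koszul_d (f # fs) z' bs = 0"
        using z unfolding koszul_cycle_def koszul_chain_def
        by (cases b; auto simp: zF zT zT[THEN fun_cong] zF[THEN fun_cong])+
      assume "count_list bs True \<noteq> 1"
      then show "z' bs = 0"
        using z bs unfolding koszul_cycle_def koszul_chain_def
        by (cases b) (auto simp: zT[THEN fun_cong] zF[THEN fun_cong])
    qed
    obtain u where u: "u \<in> M" and "koszul_boundary (f # fs) (\<lambda>bs. u * z' bs)"
      using H cyc unfolding H1_vanishes_def by blast
    then obtain v where v: "koszul_chain R (Suc ?n) 2 v"
      and uv: "\<And>bs. length bs = Suc ?n \<Longrightarrow> u * z' bs = koszul_d (f # fs) v bs"
      unfolding koszul_boundary_def by auto
    have F: "u * z bs = koszul_d fs (\<lambda>b. v (False # b)) bs + f * v (True # bs)" if "length bs = ?n" for bs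
      using uv[of "False # bs"] that by (simp add: zF[THEN fun_cong])
    have T: "koszul_d fs (\<lambda>b. v (True # b)) bs = 0" if "length bs = ?n" for bs
      using uv[of "True # bs"] that by (simp add: zT[THEN fun_cong])
    have "koszul_cycle fs (\<lambda>b. v (True # b))"
      using v T unfolding koszul_cycle_def koszul_chain_def by (auto dest: spec[of _ "True # _"])
    moreover have "koszul_boundary fs (\<lambda>bs. u * z bs - f * v (True # bs))"
      unfolding koszul_boundary_def using v F by (intro exI[of _ "\<lambda>b. v (False # b)"]) (auto simp: koszul_chain_def)
    ultimately show ?thesis using u by blast
  qed
  have "\<exists>wu. \<forall>k. (koszul_cycle fs (fst (wu k)) \<and> (k = 0 \<longrightarrow> fst (wu k) = z)) \<and>
     (snd (wu (Suc k)) \<in> M \<and> koszul_boundary fs (\<lambda>bs. snd (wu (Suc k)) * fst (wu k) bs - f * fst (wu (Suc k)) bs))"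
  proof (rule dependent_nat_choice)
    show "\<exists>x. koszul_cycle fs (fst x) \<and> ((0::nat) = 0 \<longrightarrow> fst x = z)" using z by auto
  next
    fix x and k :: nat assume "koszul_cycle fs (fst x) \<and> (k = 0 \<longrightarrow> fst x = z)"
    then obtain w u where "koszul_cycle fs w \<and> u \<in> M \<and> koszul_boundary fs (\<lambda>bs. u * fst x bs - f * w bs)"
      using step by blast
    then show "\<exists>y. (koszul_cycle fs (fst y) \<and> (Suc k = 0 \<longrightarrow> fst y = z)) \<and>
         (snd y \<in> M \<and> koszul_boundary fs (\<lambda>bs. snd y * fst x bs - f * fst y bs))"
      by (intro exI[of _ "(w, u)"]) auto
  qed
  then obtain wu where wu: "\<And>k. koszul_cycle fs (fst (wu k))" "fst (wu 0) = z" "\<And>k. snd (wu (Suc k)) \<in> M"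
    "\<And>k. koszul_boundary fs (\<lambda>bs. snd (wu (Suc k)) * fst (wu k) bs - f * fst (wu (Suc k)) bs)" by metis
  define w where "w k = fst (wu k)" for k
  define u where "u k = snd (wu (Suc k))" for k
  have w: "\<And>k. koszul_cycle fs (w k)" "w 0 = z" and u: "\<And>k. u k \<in> M" "\<And>k. u k \<in> R"
    and uw: "\<And>k. koszul_boundary fs (\<lambda>bs. u k * w k bs - f * w (Suc k) bs)"
    using wu M_sub unfolding w_def u_def by auto
  let ?X = "{bs :: bool list. length bs = ?n}"
  have "finite ?X" using finite_lists_length_eq[of "UNIV :: bool set" ?n] by simp
  moreover have "w k bs \<in> R" if "bs \<in> ?X" for k bs
    using w(1)[of k] that unfolding koszul_cycle_def koszul_chain_def by auto
  ultimately obtain k r where r: "\<And>j. j < k \<Longrightarrow> r j \<in> R"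
    and wk: "\<And>bs. length bs = ?n \<Longrightarrow> w k bs = (\<Sum>j<k. r j * w j bs)"
    using noetherian_module[OF assms(1), of ?X w] by auto
  have down: "\<exists>U\<in>M. \<exists>s\<in>R. koszul_boundary fs (\<lambda>bs. U * w j bs - s * f * w k bs)" if "j < k" for j
    using that
  proof (induction rule: strict_inc_induct)
    case (base j)
    show ?case using uw[of j] u base by (intro bexI[of _ "u j"] bexI[of _ 1]) auto
  next
    case (step j)
    then obtain U s where U: "U \<in> M" "s \<in> R" "koszul_boundary fs (\<lambda>bs. U * w (Suc j) bs - s * f * w k bs)" by blast
    from U(1) M_sub have "U \<in> R" by auto
    have "koszul_boundary fs (\<lambda>bs. U * (u j * w j bs - f * w (Suc j) bs) + f * (U * w (Suc j) bs - s * f * w k bs))"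
      by (intro koszul_boundary_add koszul_boundary_mult uw U fR \<open>U \<in> R\<close>)
    then show ?case using U u fR
      by (intro bexI[of _ "U * u j"] bexI[of _ "f * s"]) (auto simp: algebra_simps)
  qed
  have sums: "\<exists>U\<in>M. \<exists>s\<in>R. koszul_boundary fs (\<lambda>bs. U * (\<Sum>j<l. r j * w j bs) - s * f * w k bs)" if "l \<le> k" for l
    using that
  proof (induction l)
    case 0
    show ?case using koszul_boundary_zero by (intro bexI[of _ 1] bexI[of _ 0]) auto
  next
    case (Suc l)
    then obtain U s where U: "U \<in> M" "s \<in> R" "koszul_boundary fs (\<lambda>bs. U * (\<Sum>j<l. r j * w j bs) - s * f * w k bs)" by auto
    obtain U' s' where U': "U' \<in> M" "s' \<in> R" "koszul_boundary fs (\<lambda>bs. U' * w l bs - s' * f * w k bs)"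
      using down[of l] Suc by auto
    have R: "U \<in> R" "U' \<in> R" "r l \<in> R" using U(1) U'(1) M_sub r Suc.prems by auto
    have "koszul_boundary fs (\<lambda>bs. U' * (U * (\<Sum>j<l. r j * w j bs) - s * f * w k bs) + (U * r l) * (U' * w l bs - s' * f * w k bs))"
      by (intro koszul_boundary_add koszul_boundary_mult U U' mult_mem R)
    then show ?case using U U' R
      by (intro bexI[of _ "U * U'"] bexI[of _ "U' * s + U * r l * s'"]) (auto simp: algebra_simps)
  qed
  obtain U s where U: "U \<in> M" "s \<in> R" "koszul_boundary fs (\<lambda>bs. U * (\<Sum>j<k. r j * w j bs) - s * f * w k bs)"
    using sums[of k] by auto
  define V where "V = U - s * f"
  have V: "V \<in> M" using jac U unfolding V_def by auto
  have Vk: "koszul_boundary fs (\<lambda>bs. V * w k bs)"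
    using U(3) by (rule koszul_boundary_cong) (simp add: wk V_def algebra_simps)
  show "\<exists>u\<in>M. koszul_boundary fs (\<lambda>bs. u * z bs)"
  proof (cases "k = 0")
    case True
    then show ?thesis using Vk V w by auto
  next
    case False
    then obtain U' s' where U': "U' \<in> M" "s' \<in> R" "koszul_boundary fs (\<lambda>bs. U' * w 0 bs - s' * f * w k bs)"
      using down[of 0] by auto
    have VR: "V \<in> R" using V M_sub by auto
    have "koszul_boundary fs (\<lambda>bs. V * (U' * w 0 bs - s' * f * w k bs) + (s' * f) * (V * w k bs))"
      by (intro koszul_boundary_add koszul_boundary_mult Vk U' VR mult_mem fR)
    then show ?thesis using V U' w by (intro bexI[of _ "V * U'"]) (auto simp: algebra_simps)
  qed
qed

lemma koszul_d_in_ideal: "set fs \<subseteq> R \<Longrightarrow> (\<And>b. length b = length bs \<Longrightarrow> c b \<in> R) \<Longrightarrow> koszul_d fs c bs \<in> rspan R (set fs)"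
proof (induction fs c bs rule: koszul_d.induct)
  case (1 f fs c bs)
  have "koszul_d fs (\<lambda>b. c (False # b)) bs \<in> rspan R (set fs)" using 1 by auto
  moreover have "c (True # bs) \<in> R" using 1 by auto
  ultimately have "c (True # bs) * f + koszul_d fs (\<lambda>b. c (False # b)) bs \<in> rspan R (set (f # fs))"
    using rspan_mono[of _ R "set fs" R "set (f # fs)"] by (intro rspan.step) auto
  then show ?case by (simp add: add.commute mult.commute)
next
  case (2 f fs c bs)
  have "koszul_d fs (\<lambda>b. c (True # b)) bs \<in> rspan R (set fs)" using 2 by auto
  then have "koszul_d fs (\<lambda>b. c (True # b)) bs \<in> rspan R (set (f # fs))"
    by (rule rspan_mono) auto
  then show ?case by (simp add: rspan_uminus)
qed (auto intro: rspan.zero)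

text \<open>A relation \<open>a f = \<Sum> r\<^sub>i f\<^sub>i\<close> is a cycle of degree one. The coefficient at \<open>f\<close> of a boundary is a combination of the
  other \<open>f\<^sub>i\<close>.\<close>
lemma H1_vanishes_regular:
  assumes "f \<in> R" "set fs \<subseteq> R" "H1_vanishes (f # fs)" "a \<in> R" "a * f \<in> rspan R (set fs)"
  shows "\<exists>u\<in>M. u * a \<in> rspan R (set fs)"
proof -
  let ?n = "length fs"
  obtain rs where rs: "length rs = ?n" "set rs \<subseteq> R" "a * f = dot rs fs"
    using assms(5) rspan_list by auto
  \<comment> \<open>The generator of the degree zero part.\<close>
  define e :: "bool list \<Rightarrow> 'r" where "e bs = (if True \<in> set bs then 0 else 1)" for bs
  have e: "koszul_chain R n 0 e" for n
    unfolding koszul_chain_def e_def by (auto simp: count_list_0_iff)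
  have ke: "koszul_d fs e bs = 0" if "length bs = ?n" for bs
    using e[of ?n] that by (intro koszul_d_degree[of _ _ 0]) (auto simp: koszul_chain_def)
  have kh: "koszul_d fs (koszul_h rs e) bs = a * f * e bs" if "length bs = ?n" for bs
  proof -
    have "koszul_h rs (koszul_d fs e) bs = koszul_h rs (\<lambda>b. 0 * e b) bs"
      using ke that by (intro koszul_h_cong) auto
    then have "koszul_h rs (koszul_d fs e) bs = 0" unfolding koszul_h_mult by simp
    then show ?thesis using koszul_homotopy[of bs fs rs e] that rs by simp
  qed
  have ch: "koszul_chain R ?n 1 (koszul_h rs e)" using koszul_chain_h[OF rs(2), of 0 e] e rs by simp
  \<comment> \<open>The relation \<open>a f - \<Sum> r\<^sub>i f\<^sub>i = 0\<close> as a chain.\<close>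
  define z where "z bs = (case bs of [] \<Rightarrow> 0 | b # bs \<Rightarrow> if b then a * e bs else - koszul_h rs e bs)" for bs
  have zF: "(\<lambda>b. z (False # b)) = (\<lambda>b. - koszul_h rs e b)" and zT: "(\<lambda>b. z (True # b)) = (\<lambda>b. a * e b)"
    by (auto simp: z_def)
  have "koszul_cycle (f # fs) z"
    unfolding koszul_cycle_def
  proof
    show "koszul_chain R (length (f # fs)) 1 z"
      using ch e[of ?n] assms(4) unfolding koszul_chain_def
      by (auto simp: length_Suc_conv z_def)
    show "\<forall>bs. length bs = length (f # fs) \<longrightarrow> koszul_d (f # fs) z bs = 0"
    proof safe
      fix bs :: "bool list" assume "length bs = length (f # fs)"
      then obtain b bs' where "bs = b # bs'" "length bs' = ?n" by (cases bs) auto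
      then show "koszul_d (f # fs) z bs = 0"
        by (cases b) (auto simp: zF zT koszul_d_uminus koszul_d_mult ke kh z_def algebra_simps)
    qed
  qed
  then obtain u where u: "u \<in> M" and "koszul_boundary (f # fs) (\<lambda>bs. u * z bs)"
    using assms(3) unfolding H1_vanishes_def by blast
  then obtain v where v: "koszul_chain R (Suc ?n) 2 v"
    and uv: "\<And>bs. length bs = Suc ?n \<Longrightarrow> u * z bs = koszul_d (f # fs) v bs"
    unfolding koszul_boundary_def by auto
  have "u * a = - koszul_d fs (\<lambda>b. v (True # b)) (replicate ?n False)"
    using uv[of "True # replicate ?n False"] by (simp add: z_def e_def)
  moreover have "koszul_d fs (\<lambda>b. v (True # b)) (replicate ?n False) \<in> rspan R (set fs)"
    using v by (intro koszul_d_in_ideal assms) (auto simp: koszul_chain_def)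
  ultimately have "u * a \<in> rspan R (set fs)" using rspan_uminus by metis
  then show ?thesis using u by blast
qed

text \<open>Over a Noetherian local ring, regularity of a sequence only depends on the radical of its ideal and its length.
  The list is reversed because the recursion of the Koszul complex removes the head, while a regular sequence is
  cut off at its end.\<close>
theorem regular_seq_radical:
  assumes "noetherian R" "set xs \<subseteq> R" "set ys \<subseteq> R" "length ys = length xs" "regular_seq ys"
    and rad: "\<And>y. y \<in> set ys \<Longrightarrow> \<exists>u\<in>M. u * y \<in> rspan R (set xs)"
    and jac: "\<And>x u r. x \<in> set xs \<Longrightarrow> u \<in> M \<Longrightarrow> r \<in> R \<Longrightarrow> u - r * x \<in> M"
    and "i < length xs" "a \<in> R" "a * xs ! i \<in> rspan R (set (take i xs))"
  shows "\<exists>u\<in>M. u * a \<in> rspan R (set (take i xs))"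
proof -
  have all: "H1_vanishes (rev xs)"
    unfolding H1_vanishes_def
  proof safe
    fix z assume z: "koszul_cycle (rev xs) z"
    have "\<exists>u\<in>M. \<exists>v. koszul_chain R (length (rev xs)) (Suc 1) v \<and>
           (\<forall>bs. length bs = length (rev xs) \<longrightarrow> u * z bs - koszul_d (rev xs) v bs \<in> rspan R (set (take 0 ys)))"
      using assms z by (intro koszul_acyclic_mod) (auto simp: koszul_cycle_def)
    then show "\<exists>u\<in>M. koszul_boundary (rev xs) (\<lambda>bs. u * z bs)"
      unfolding koszul_boundary_def by (auto simp: numeral_2_eq_2)
  qed
  have "H1_vanishes (rev (take j xs))" if "j \<le> length xs" for j
    using that
  proof (induction j rule: inc_induct)
    case (step j)
    have "rev (take (Suc j) xs) = xs ! j # rev (take j xs)"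
      using step by (simp add: take_Suc_conv_app_nth)
    with step have "H1_vanishes (xs ! j # rev (take j xs))" by auto
    moreover have x: "xs ! j \<in> set xs" using step by auto
    moreover have "set (rev (take j xs)) \<subseteq> R" "xs ! j \<in> R"
      using assms(2) x set_take_subset[of j xs] by auto
    ultimately show ?case using H1_vanishes_tl[OF assms(1)] jac by blast
  qed (simp add: all)
  from this[of "Suc i"] have "H1_vanishes (xs ! i # rev (take i xs))"
    using assms(8) by (simp add: take_Suc_conv_app_nth)
  moreover have "xs ! i \<in> R" "set (rev (take i xs)) \<subseteq> R"
    using assms(2,8) set_take_subset[of i xs] by auto
  ultimately show ?thesis
    using H1_vanishes_regular[of "xs ! i" "rev (take i xs)" a] assms(9,10) by simp
qed

end

section \<open>The Hilbert basis theorem\<close>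

definition adjoin :: "'r::comm_ring_1 set \<Rightarrow> 'r \<Rightarrow> 'r set" where
  "adjoin R x = {poly p x | p. \<forall>i. Polynomial.coeff p i \<in> R}"

lemma (in subring_of) subring_of_polys: "subring_of {p. \<forall>i. Polynomial.coeff p i \<in> R}"
  by unfold_locales (auto simp: coeff_mult intro!: sum_mem)

lemma (in subring_of) subring_of_adjoin: "subring_of (adjoin R x)"
proof -
  interpret P: subring_of "{p. \<forall>i. Polynomial.coeff p i \<in> R}" by (rule subring_of_polys)
  show ?thesis
  proof
    show "1 \<in> adjoin R x"
      unfolding adjoin_def using P.one_mem by (metis (mono_tags) mem_Collect_eq poly_1)
  next
    fix a b assume "a \<in> adjoin R x" "b \<in> adjoin R x"
    then obtain p q where pq: "a = poly p x" "b = poly q x" "p \<in> {p. \<forall>i. Polynomial.coeff p i \<in> R}"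
      "q \<in> {p. \<forall>i. Polynomial.coeff p i \<in> R}" unfolding adjoin_def by auto
    have "a - b = poly (p - q) x" "a * b = poly (p * q) x" using pq by simp_all
    with P.diff_mem[OF pq(3,4)] P.mult_mem[OF pq(3,4)] show "a - b \<in> adjoin R x" "a * b \<in> adjoin R x"
      unfolding adjoin_def by blast+
  qed
qed

lemma adjoin_supset: "subring_of R \<Longrightarrow> R \<subseteq> adjoin R x" "subring_of R \<Longrightarrow> x \<in> adjoin R x"
proof -
  assume "subring_of R"
  then interpret subring_of R .
  show "R \<subseteq> adjoin R x"
  proof
    fix r assume "r \<in> R"
    then show "r \<in> adjoin R x" unfolding adjoin_def
      by (intro CollectI exI[of _ "[:r:]"]) (auto simp: coeff_pCons split: nat.split)
  qed
  show "x \<in> adjoin R x" unfolding adjoin_def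
    by (intro CollectI exI[of _ "[:0, 1:]"]) (auto simp: coeff_pCons split: nat.split)
qed

lemma adjoin_subset:
  assumes "subring_of A" "R \<subseteq> A" "x \<in> A"
  shows "adjoin R x \<subseteq> A"
proof -
  interpret subring_of A by fact
  have "poly p x \<in> A" if "\<forall>i. Polynomial.coeff p i \<in> R" for p
    unfolding poly_altdef using assms(2,3) that by (intro sum_mem mult_mem power_mem) auto
  then show ?thesis unfolding adjoin_def by auto
qed

text \<open>Hilbert's argument. If some sequence \<open>w\<close> violates the Noetherian property of \<open>R[x]\<close>, no finite part of the ideal
  \<open>I\<close> generated by it spans \<open>I\<close>. Choose polynomials \<open>p\<^sub>0, p\<^sub>1, \<dots>\<close> successively, each of least degree among those whose
  value at \<open>x\<close> is in \<open>I\<close> but not in the span of the previous values. A relation between their leading coefficients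
  allows to cancel a leading term, which contradicts the minimality.\<close>
lemma (in subring_of) noetherian_adjoin:
  assumes "noetherian R"
  shows "noetherian (adjoin R x)"
  unfolding noetherian_def
proof (intro allI impI, rule ccontr)
  fix w :: "nat \<Rightarrow> 'r"
  let ?A = "adjoin R x" and ?P = "{p. \<forall>i. Polynomial.coeff p i \<in> R}"
  let ?ev = "\<lambda>p. poly p x"
  assume wA: "\<forall>k. w k \<in> ?A" and "\<not> (\<exists>k. w k \<in> rspan ?A (w ` {..<k}))"
  then have bad: "w k \<notin> rspan ?A (w ` {..<k})" for k by auto
  interpret A: subring_of ?A by (rule subring_of_adjoin)
  interpret P: subring_of ?P by (rule subring_of_polys)
  define I where "I = rspan ?A (range w)"
  have fin_sub: "\<exists>m. g \<in> rspan ?A (w ` {..<m})" if "g \<in> I" for g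
    using that unfolding I_def
  proof (induction rule: rspan.induct)
    case zero
    show ?case by (auto intro: rspan.zero)
  next
    case (step r y g)
    then obtain m j where "g \<in> rspan ?A (w ` {..<m})" "y = w j" by auto
    then have "r * y + g \<in> rspan ?A (w ` {..<max m (Suc j)})"
      using step(1) rspan_mono[OF \<open>g \<in> rspan ?A (w ` {..<m})\<close> order_refl image_mono[of "{..<m}" "{..<max m (Suc j)}" w]]
      by (intro rspan.step) auto
    then show ?case by blast
  qed
  have escape: "\<exists>g\<in>I. g \<notin> rspan ?A X" if "finite X" "X \<subseteq> I" for X
  proof -
    have "\<exists>m. \<forall>g\<in>X. g \<in> rspan ?A (w ` {..<m})"
      using that
    proof (induction X)
      case (insert g X)
      then obtain m n where mn: "\<forall>g\<in>X. g \<in> rspan ?A (w ` {..<m})" "g \<in> rspan ?A (w ` {..<n})"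
        using fin_sub by blast
      have "h \<in> rspan ?A (w ` {..<max m n})" if "h \<in> rspan ?A (w ` {..<l})" "l = m \<or> l = n" for h l
        using that by (intro rspan_mono[OF that(1) order_refl image_mono]) auto
      with mn show ?case by (intro exI[of _ "max m n"]) auto
    qed auto
    then obtain m where m: "\<And>g. g \<in> X \<Longrightarrow> g \<in> rspan ?A (w ` {..<m})" by blast
    have "w m \<in> I" unfolding I_def by (intro A.rspan_base) auto
    moreover have "w m \<notin> rspan ?A X"
      using A.rspan_rspan[OF _ m] bad[of m] by blast
    ultimately show ?thesis by blast
  qed
  have IA: "g \<in> ?A" if "g \<in> I" for g
    using A.rspan_subset[of "range w" g] that wA unfolding I_def by auto
  define cand where "cand p k r \<longleftrightarrow> r \<in> ?P \<and> ?ev r \<in> I \<and> ?ev r \<notin> rspan ?A (?ev ` p ` {..<k})"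
    for p :: "nat \<Rightarrow> 'r poly" and k r
  have "\<exists>p. \<forall>k. cand p k (p k) \<and> (\<forall>q. cand p k q \<longrightarrow> Polynomial.degree (p k) \<le> Polynomial.degree q)"
  proof (rule dependent_wellorder_choice)
    fix r :: "'r poly" and f g :: "nat \<Rightarrow> 'r poly" and k
    assume "\<And>y. y < k \<Longrightarrow> f y = g y"
    then have "f ` {..<k} = g ` {..<k}" by auto
    then show "(cand f k r \<and> (\<forall>q. cand f k q \<longrightarrow> Polynomial.degree r \<le> Polynomial.degree q)) =
               (cand g k r \<and> (\<forall>q. cand g k q \<longrightarrow> Polynomial.degree r \<le> Polynomial.degree q))"
      unfolding cand_def by simp
  next
    fix k and f :: "nat \<Rightarrow> 'r poly"
    assume "\<And>y. y < k \<Longrightarrow> cand f y (f y) \<and> (\<forall>q. cand f y q \<longrightarrow> Polynomial.degree (f y) \<le> Polynomial.degree q)"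
    then have "?ev ` f ` {..<k} \<subseteq> I" unfolding cand_def by auto
    from escape[OF _ this] obtain g where g: "g \<in> I" "g \<notin> rspan ?A (?ev ` f ` {..<k})" by auto
    from IA[OF g(1)] obtain p where "p \<in> ?P" "g = ?ev p" unfolding adjoin_def by blast
    with g have "cand f k p" unfolding cand_def by auto
    from ex_has_least_nat[of "cand f k", OF this, of Polynomial.degree]
    show "\<exists>r. cand f k r \<and> (\<forall>q. cand f k q \<longrightarrow> Polynomial.degree r \<le> Polynomial.degree q)" by auto
  qed
  then obtain p where p: "\<And>k. cand p k (p k)" and pmin: "\<And>k q. cand p k q \<Longrightarrow> Polynomial.degree (p k) \<le> Polynomial.degree q"
    by blast
  have mono: "Polynomial.degree (p j) \<le> Polynomial.degree (p k)" if "j < k" for j k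
  proof (rule pmin)
    have "?ev ` p ` {..<j} \<subseteq> ?ev ` p ` {..<k}" using that by auto
    then have "rspan ?A (?ev ` p ` {..<j}) \<subseteq> rspan ?A (?ev ` p ` {..<k})"
      using rspan_mono by blast
    then show "cand p j (p k)" using p[of k] unfolding cand_def by blast
  qed
  have "\<forall>k. lead_coeff (p k) \<in> R" using p unfolding cand_def by auto
  with assms[unfolded noetherian_def, rule_format, of "\<lambda>k. lead_coeff (p k)"]
  obtain k where "lead_coeff (p k) \<in> rspan R ((\<lambda>j. lead_coeff (p j)) ` {..<k})" by auto
  from rspan_image[OF _ this] obtain r where r: "\<And>j. j < k \<Longrightarrow> r j \<in> R"
    "lead_coeff (p k) = (\<Sum>j<k. r j * lead_coeff (p j))" by auto
  define s where "s j = Polynomial.monom (r j) (Polynomial.degree (p k) - Polynomial.degree (p j))" for j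
  have sP: "s j \<in> ?P" if "j < k" for j using r(1)[OF that] unfolding s_def by auto
  define q where "q = p k - (\<Sum>j<k. s j * p j)"
  have qP: "q \<in> ?P" unfolding q_def
    using p sP unfolding cand_def by (intro P.diff_mem P.sum_mem P.mult_mem) auto
  have sA: "?ev (s j) \<in> ?A" if "j < k" for j using sP[OF that] unfolding adjoin_def by auto
  have evq: "?ev q = ?ev (p k) - (\<Sum>j<k. ?ev (s j) * ?ev (p j))"
    unfolding q_def by (simp add: poly_sum)
  have sumin: "(\<Sum>j<l. ?ev (s j) * ?ev (p j)) \<in> rspan ?A (?ev ` p ` {..<k})" if "l \<le> k" for l
    using that
  proof (induction l)
    case (Suc l)
    have "?ev (p l) \<in> rspan ?A (?ev ` p ` {..<k})" using Suc by (intro A.rspan_base) auto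
    then show ?case using Suc sA[of l] by (auto intro!: rspan_add A.rspan_mult)
  qed (auto intro: rspan.zero)
  have sumI: "(\<Sum>j<k. ?ev (s j) * ?ev (p j)) \<in> I"
    using A.rspan_rspan[OF sumin[OF order_refl]] p unfolding cand_def I_def by blast
  have "cand p k q"
    unfolding cand_def
  proof (intro conjI qP notI)
    show "?ev q \<in> I" unfolding evq using p[of k] sumI unfolding I_def cand_def
      by (intro A.rspan_diff) auto
    assume "?ev q \<in> rspan ?A (?ev ` p ` {..<k})"
    from rspan_add[OF this sumin[OF order_refl]] p[of k] show False
      unfolding evq cand_def by auto
  qed
  then have "Polynomial.degree (p k) \<le> Polynomial.degree q" by (rule pmin)
  moreover have "Polynomial.degree (s j * p j) \<le> Polynomial.degree (p k)" if "j < k" for j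
  proof -
    have "Polynomial.degree (s j * p j) \<le> Polynomial.degree (s j) + Polynomial.degree (p j)" by (rule degree_mult_le)
    also have "\<dots> \<le> (Polynomial.degree (p k) - Polynomial.degree (p j)) + Polynomial.degree (p j)"
      unfolding s_def by (intro add_right_mono degree_monom_le)
    finally show ?thesis using mono[OF that] by simp
  qed
  then have "Polynomial.degree q \<le> Polynomial.degree (p k)" unfolding q_def
    by (intro degree_diff_le degree_sum_le) auto
  moreover have "Polynomial.coeff q (Polynomial.degree (p k)) = 0"
  proof -
    have "Polynomial.coeff (s j * p j) (Polynomial.degree (p k)) = r j * lead_coeff (p j)" if "j < k" for j
      using mono[OF that] unfolding s_def by (simp add: coeff_monom_mult)
    then show ?thesis unfolding q_def by (simp add: coeff_sum r(2))
  qed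
  ultimately have "q = 0" by (metis le_antisym leading_coeff_0_iff)
  then show False using \<open>cand p k q\<close> rspan.zero unfolding cand_def by auto
qed

section \<open>Chains of primes in subrings of a polynomial ring\<close>

text \<open>Gaussian elimination of one equation.\<close>
lemma homogeneous_system_nontrivial:
  fixes g :: "'i \<Rightarrow> 'x \<Rightarrow> 'k::field"
  assumes "finite X" "finite I" "card X < card I"
  shows "\<exists>c. (\<exists>i\<in>I. c i \<noteq> 0) \<and> (\<forall>x\<in>X. (\<Sum>i\<in>I. c i * g i x) = 0)"
  using assms
proof (induction X arbitrary: I g)
  case empty
  then show ?case by (intro exI[of _ "\<lambda>_. 1"]) (auto simp: card_gt_0_iff)
next
  case (insert y X)
  show ?case
  proof (cases "\<forall>i\<in>I. g i y = 0")
    case True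
    have "card X < card I" using insert by simp
    from insert.IH[OF insert.prems(1) this, of g] obtain c
      where "\<exists>i\<in>I. c i \<noteq> 0" "\<forall>x\<in>X. (\<Sum>i\<in>I. c i * g i x) = 0" by blast
    with True show ?thesis by (intro exI[of _ c]) auto
  next
    case False
    then obtain j where j: "j \<in> I" "g j y \<noteq> 0" by blast
    define h where "h i x = g i x - g i y / g j y * g j x" for i x
    have "card X < card (I - {j})" using insert j by (auto simp: card_Diff_singleton_if)
    from insert.IH[OF _ this, of h] insert.prems(1) obtain c where
      c: "\<exists>i\<in>I - {j}. c i \<noteq> 0" "\<And>x. x \<in> X \<Longrightarrow> (\<Sum>i\<in>I - {j}. c i * h i x) = 0" by blast
    define a where "a = - (\<Sum>i\<in>I - {j}. c i * (g i y / g j y))"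
    define c' where "c' = c(j := a)"
    have sum: "(\<Sum>i\<in>I. c' i * g i x) = (\<Sum>i\<in>I - {j}. c i * h i x)" for x
    proof -
      have "(\<Sum>i\<in>I. c' i * g i x) = a * g j x + (\<Sum>i\<in>I - {j}. c' i * g i x)"
        using j insert by (subst sum.remove[of I j]) (auto simp: c'_def)
      also have "(\<Sum>i\<in>I - {j}. c' i * g i x) = (\<Sum>i\<in>I - {j}. c i * g i x)"
        by (intro sum.cong) (auto simp: c'_def)
      also have "a * g j x = - (\<Sum>i\<in>I - {j}. c i * (g i y / g j y) * g j x)"
        unfolding a_def by (simp add: sum_distrib_right)
      finally show ?thesis
        unfolding h_def by (simp add: right_diff_distrib sum_subtractf mult.assoc)
    qed
    have "h i y = 0" for i using j unfolding h_def by simp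
    then have "(\<Sum>i\<in>I. c' i * g i y) = 0" unfolding sum by simp
    moreover have "\<exists>i\<in>I. c' i \<noteq> 0" using c(1) unfolding c'_def by auto
    ultimately show ?thesis using sum c(2) by (intro exI[of _ c']) auto
  qed
qed

fun eval_monomial :: "'r::comm_ring_1 list \<Rightarrow> nat list \<Rightarrow> 'r" where
  "eval_monomial (f # fs) (a # as) = f ^ a * eval_monomial fs as"
| "eval_monomial _ _ = 1"

definition prime_set :: "'r::comm_ring_1 set \<Rightarrow> 'r set \<Rightarrow> bool" where
  "prime_set R P \<longleftrightarrow> P \<subseteq> R \<and> 0 \<in> P \<and> (\<forall>a\<in>P. \<forall>b\<in>P. a + b \<in> P) \<and> (\<forall>r\<in>R. \<forall>a\<in>P. r * a \<in> P) \<and>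
     1 \<notin> P \<and> (\<forall>a\<in>R. \<forall>b\<in>R. a * b \<in> P \<longrightarrow> a \<in> P \<or> b \<in> P)"

lemma prime_setD:
  assumes "prime_set R P"
  shows "P \<subseteq> R" "0 \<in> P" "1 \<notin> P" "a \<in> P \<Longrightarrow> b \<in> P \<Longrightarrow> a + b \<in> P" "r \<in> R \<Longrightarrow> a \<in> P \<Longrightarrow> r * a \<in> P"
    "a \<in> R \<Longrightarrow> b \<in> R \<Longrightarrow> a * b \<in> P \<Longrightarrow> a \<in> P \<or> b \<in> P"
  using assms unfolding prime_set_def by auto

lemma prime_set_power:
  assumes "subring_of R" "prime_set R P" "f \<in> R" "f \<notin> P" "g \<in> R" "f ^ n * g \<in> P"
  shows "g \<in> P"
  using assms(6)
proof (induction n)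
  case (Suc n)
  interpret subring_of R by fact
  have "f * (f ^ n * g) \<in> P" using Suc by (simp add: mult.assoc)
  moreover have "f ^ n * g \<in> R" using assms by (intro mult_mem power_mem)
  ultimately have "f ^ n * g \<in> P" using assms unfolding prime_set_def by blast
  then show ?case by (rule Suc.IH)
qed auto

definition exponent_lists :: "nat \<Rightarrow> nat \<Rightarrow> nat list set" where
  "exponent_lists N n = {as. set as \<subseteq> {..N} \<and> length as = n}"

lemma exponent_lists_Suc: "exponent_lists N (Suc n) = (\<lambda>(a, as). a # as) ` ({..N} \<times> exponent_lists N n)"
  unfolding exponent_lists_def by (auto simp: length_Suc_conv image_iff)

lemma sum_exponent_lists_Suc: "(\<Sum>as\<in>exponent_lists N (Suc n). h as) = (\<Sum>a\<le>N. \<Sum>as\<in>exponent_lists N n. h (a # as))"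
  unfolding exponent_lists_Suc
  by (subst sum.reindex) (auto simp: inj_on_def sum.cartesian_product case_prod_beta)

lemma eval_monomial_mem: "subring_of R \<Longrightarrow> set fs \<subseteq> R \<Longrightarrow> eval_monomial fs as \<in> R"
proof (induction fs as rule: eval_monomial.induct)
  case (1 f fs a as)
  interpret subring_of R by fact
  show ?case using 1 by (auto intro!: power_mem)
qed (auto simp: subring_of.one_mem)

text \<open>Let \<open>f\<^sub>i\<close> be an element of the \<open>i + 1\<close>-st but not of the \<open>i\<close>-th prime. In a relation between the monomials in the
  \<open>f\<^sub>i\<close> modulo the first prime, divide by the lowest power of the first element that occurs, which is allowed because this
  element is not in the prime. Modulo the second prime all terms divisible by the first element vanish, and what
  remains is a relation between the monomials in the other elements.\<close>
lemma chain_monomials_independent: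
  fixes c :: "nat list \<Rightarrow> 'k::field" and emb :: "'k \<Rightarrow> 'r::comm_ring_1"
  assumes R: "subring_of R" and emb: "\<And>x y. emb (x * y) = emb x * emb y" "emb 1 = 1" "\<And>x. emb x \<in> R"
    and fs: "set fs \<subseteq> R"
    and Q: "\<And>i. i \<le> length fs \<Longrightarrow> prime_set R (Q i)"
    and step: "\<And>i. i < length fs \<Longrightarrow> Q i \<subseteq> Q (Suc i) \<and> fs ! i \<in> Q (Suc i) - Q i"
    and zero: "(\<Sum>as\<in>exponent_lists N (length fs). emb (c as) * eval_monomial fs as) \<in> Q 0"
    and emb0: "emb 0 = 0"
  shows "\<forall>as\<in>exponent_lists N (length fs). c as = 0"
  using fs Q step zero
proof (induction fs arbitrary: Q c)
  case Nil
  have e: "exponent_lists N 0 = {[]}" unfolding exponent_lists_def by auto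
  have "emb (c []) \<in> Q 0" using Nil(4) by (simp add: e)
  have "c [] = 0"
  proof (rule ccontr)
    assume "c [] \<noteq> 0"
    then have "emb (inverse (c [])) * emb (c []) = 1" using emb(1)[of "inverse (c [])" "c []"] emb(2) by simp
    moreover have "emb (inverse (c [])) * emb (c []) \<in> Q 0"
      using Nil(2)[of 0] emb(3) \<open>emb (c []) \<in> Q 0\<close> unfolding prime_set_def by simp
    ultimately show False using Nil(2)[of 0] unfolding prime_set_def by simp
  qed
  then show ?case by (simp add: e)
next
  case (Cons f fs)
  interpret subring_of R by fact
  let ?n = "length fs"
  define G where "G a = (\<Sum>as\<in>exponent_lists N ?n. emb (c (a # as)) * eval_monomial fs as)" for a
  have GR: "G a \<in> R" for a unfolding G_def
    using emb(3) eval_monomial_mem[OF R] Cons.prems(1) by (intro sum_mem mult_mem) auto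
  have sumG: "(\<Sum>as\<in>exponent_lists N (length (f # fs)). emb (c as) * eval_monomial (f # fs) as) = (\<Sum>a\<le>N. f ^ a * G a)"
    unfolding length_Cons sum_exponent_lists_Suc G_def sum_distrib_left
    by (intro sum.cong) (auto simp: algebra_simps)
  have P0: "prime_set R (Q 0)" "prime_set R (Q 1)" using Cons.prems(2)[of 0] Cons.prems(2)[of 1] by auto
  have f: "f \<in> Q 1" "f \<notin> Q 0" "f \<in> R" "Q 0 \<subseteq> Q 1"
    using Cons.prems(3)[of 0] Cons.prems(1) by auto
  have IH: "\<forall>as\<in>exponent_lists N ?n. c (a # as) = 0" if "G a \<in> Q 1" for a
    using Cons.prems that unfolding G_def
    by (intro Cons.IH[of "\<lambda>i. Q (Suc i)" "\<lambda>as. c (a # as)"]) force+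
  have "\<forall>as\<in>exponent_lists N ?n. c (a # as) = 0" if "a \<le> N" for a
    using that
  proof (induction a rule: less_induct)
    case (less a)
    have z: "G b = 0" if "b < a" for b
      using less.IH[of b] that less.prems unfolding G_def by (simp add: emb0)
    have "(\<Sum>a\<le>N. f ^ a * G a) = (\<Sum>b\<in>{a..N}. f ^ b * G b)"
      using z by (intro sum.mono_neutral_right) (auto simp: not_le)
    also have "\<dots> = f ^ a * G a + (\<Sum>b\<in>{Suc a..N}. f ^ b * G b)"
      using less.prems by (simp add: sum.atLeast_Suc_atMost)
    also have "(\<Sum>b\<in>{Suc a..N}. f ^ b * G b) = f ^ a * (f * (\<Sum>b\<in>{Suc a..N}. f ^ (b - Suc a) * G b))"
      unfolding sum_distrib_left
    proof (intro sum.cong refl)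
      fix b assume "b \<in> {Suc a..N}"
      then have "f ^ b = f ^ (a + (1 + (b - Suc a)))" by simp
      also have "\<dots> = f ^ a * (f * f ^ (b - Suc a))" by (simp only: power_add power_one_right)
      finally show "f ^ b * G b = f ^ a * (f * (f ^ (b - Suc a) * G b))" by (simp add: mult.assoc)
    qed
    finally have eq: "(\<Sum>a\<le>N. f ^ a * G a) = f ^ a * (G a + f * (\<Sum>b\<in>{Suc a..N}. f ^ (b - Suc a) * G b))"
      by (simp add: distrib_left)
    define r where "r = (\<Sum>b\<in>{Suc a..N}. f ^ (b - Suc a) * G b)"
    have rR: "r \<in> R" unfolding r_def using GR f by (intro sum_mem mult_mem power_mem) auto
    have "f ^ a * (G a + f * r) \<in> Q 0" using Cons.prems(4) unfolding sumG eq r_def .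
    then have "G a + f * r \<in> Q 0" using prime_set_power[OF R P0(1) f(3,2)] GR rR f by auto
    then have "G a + f * r \<in> Q 1" using f by auto
    moreover have "(- r) * f \<in> Q 1" using rR f by (intro prime_setD(5)[OF P0(2)]) auto
    ultimately have "(G a + f * r) + (- r) * f \<in> Q 1" by (rule prime_setD(4)[OF P0(2)])
    then show ?case by (intro IH) (simp add: algebra_simps)
  qed
  then show ?case unfolding length_Cons exponent_lists_Suc by auto
qed

definition exponent_box :: "nat \<Rightarrow> (nat ^ 'd) set" where
  "exponent_box N = {a. \<forall>i. a $ i \<le> N}"

lemma finite_exponent_box: "finite (exponent_box N :: (nat ^ 'd) set)" (is ?fin)
  and card_exponent_box: "card (exponent_box N :: (nat ^ 'd) set) \<le> Suc N ^ CARD('d)" (is ?card)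
proof -
  have eq: "(exponent_box N :: (nat ^ 'd) set) = vec_lambda ` (PiE UNIV (\<lambda>_. {..N}))"
    unfolding exponent_box_def by (auto simp: image_iff PiE_def Pi_def intro!: exI[of _ "vec_nth _"])
  show ?fin unfolding eq by (intro finite_imageI finite_PiE) auto
  have "card (exponent_box N :: (nat ^ 'd) set) \<le> card (PiE (UNIV :: 'd set) (\<lambda>_. {..N}))"
    unfolding eq by (intro card_image_le finite_PiE) auto
  then show ?card by (simp add: card_PiE)
qed

lemma exponent_box_add: "a \<in> exponent_box m \<Longrightarrow> b \<in> exponent_box n \<Longrightarrow> a + b \<in> exponent_box (m + n)"
  unfolding exponent_box_def by (auto intro: add_mono)

lemma keys_mult_box:
  "keys p \<subseteq> exponent_box m \<Longrightarrow> keys q \<subseteq> exponent_box n \<Longrightarrow> keys (p * q) \<subseteq> exponent_box (m + n)"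
  using keys_mult[of p q] exponent_box_add by fastforce

lemma exponent_box_mono: "m \<le> n \<Longrightarrow> exponent_box m \<subseteq> exponent_box n"
  unfolding exponent_box_def using order_trans by blast

lemma keys_one_box: "keys (1 :: (nat ^ 'd) \<Rightarrow>\<^sub>0 'k::field) \<subseteq> exponent_box n"
  unfolding exponent_box_def by simp

lemma keys_power_box:
  fixes p :: "(nat ^ 'd) \<Rightarrow>\<^sub>0 'k::field"
  shows "keys p \<subseteq> exponent_box m \<Longrightarrow> keys (p ^ n) \<subseteq> exponent_box (n * m)"
proof (induction n)
  case (Suc n)
  then show ?case using keys_mult_box[of p m "p ^ n" "n * m"] by simp
qed (use keys_one_box in auto)

lemma keys_eval_monomial_box:
  fixes fs :: "((nat ^ 'd) \<Rightarrow>\<^sub>0 'k::field) list"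
  assumes "\<And>f. f \<in> set fs \<Longrightarrow> keys f \<subseteq> exponent_box D" "set as \<subseteq> {..N}"
  shows "keys (eval_monomial fs as) \<subseteq> exponent_box (length fs * (N * D))"
  using assms
proof (induction fs as rule: eval_monomial.induct)
  case (1 f fs a as)
  have "keys (f ^ a) \<subseteq> exponent_box (a * D)" using 1 by (intro keys_power_box) auto
  moreover have "exponent_box (a * D) \<subseteq> (exponent_box (N * D) :: (nat ^ 'd) set)" using 1 by (intro exponent_box_mono) auto
  ultimately have "keys (f ^ a) \<subseteq> exponent_box (N * D)" by blast
  moreover have "keys (eval_monomial fs as) \<subseteq> exponent_box (length fs * (N * D))" using 1 by auto
  ultimately show ?case using keys_mult_box[of "f ^ a" "N * D" "eval_monomial fs as"] by simp
qed (use keys_one_box in auto)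

text \<open>Otherwise there are \<open>m = d + 1\<close> elements whose monomials are linearly independent. The \<open>(N + 1)\<^sup>m\<close> monomials with
  exponents up to \<open>N\<close> have coefficients supported in a box with \<open>(L N + 1)\<^sup>d\<close> points, where \<open>L\<close> does not depend on
  \<open>N\<close>; for large \<open>N\<close> this is fewer.\<close>
theorem no_long_prime_chain:
  fixes R :: "((nat ^ 'd) \<Rightarrow>\<^sub>0 'k::field) set"
  assumes R: "subring_of R" and emb: "\<And>x. Poly_Mapping.single 0 x \<in> R"
    and Q: "\<And>i. i \<le> n \<Longrightarrow> prime_set R (Q i)"
    and chain: "\<And>i. i < n \<Longrightarrow> Q i \<subset> Q (Suc i)"
  shows "n \<le> CARD('d)"
proof (rule ccontr)
  assume "\<not> n \<le> CARD('d)"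
  define m where "m = Suc CARD('d)"
  have mn: "m \<le> n" using \<open>\<not> n \<le> _\<close> unfolding m_def by simp
  have "\<forall>i. \<exists>f. i < n \<longrightarrow> f \<in> Q (Suc i) - Q i" using chain by blast
  then obtain f where f: "\<And>i. i < n \<Longrightarrow> f i \<in> Q (Suc i) - Q i" by metis
  define fs where "fs = map f [0..<m]"
  have "f i \<in> R" if "i < n" for i
    using f[OF that] Q[of "Suc i"] that unfolding prime_set_def by auto
  then have fsR: "set fs \<subseteq> R" using mn unfolding fs_def by auto
  define D where "D = Max (insert 0 (\<Union>g\<in>set fs. \<Union>a\<in>keys g. range (\<lambda>i. a $ i)))"
  have D: "keys g \<subseteq> exponent_box D" if "g \<in> set fs" for g
    using that unfolding D_def exponent_box_def by (auto intro!: Max_ge)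
  define L where "L = m * D"
  \<comment> \<open>With this choice \<open>(L N + 1)\<^sup>d \<le> ((L + 1) (N + 1))\<^sup>d = N (N + 1)\<^sup>d < (N + 1)\<^bsup>d + 1\<^esup>\<close>.\<close>
  define N where "N = Suc L ^ CARD('d)"
  let ?X = "exponent_box (L * N) :: (nat ^ 'd) set"
  have cX: "card ?X < card (exponent_lists N m)"
  proof -
    have "card ?X \<le> Suc (L * N) ^ CARD('d)" by (rule card_exponent_box)
    also have "\<dots> \<le> (Suc L * Suc N) ^ CARD('d)" by (intro power_mono) auto
    also have "\<dots> = N * Suc N ^ CARD('d)" unfolding N_def power_mult_distrib ..
    also have "\<dots> < Suc N * Suc N ^ CARD('d)" by simp
    also have "\<dots> = card (exponent_lists N m)" unfolding exponent_lists_def m_def by (subst card_lists_length_eq) auto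
    finally show ?thesis .
  qed
  have "finite (exponent_lists N m)" unfolding exponent_lists_def by (rule finite_lists_length_eq) simp
  from homogeneous_system_nontrivial[OF finite_exponent_box this cX, of "\<lambda>as. lookup (eval_monomial fs as)"]
  obtain c where c: "\<exists>as\<in>exponent_lists N m. c as \<noteq> 0"
    "\<And>x. x \<in> ?X \<Longrightarrow> (\<Sum>as\<in>exponent_lists N m. c as * lookup (eval_monomial fs as) x) = 0" by auto
  have lookup: "lookup (Poly_Mapping.single 0 a * g) x = a * lookup g x"
    for a :: 'k and g :: "(nat ^ 'd) \<Rightarrow>\<^sub>0 'k" and x
    by (subst mult_map_scale_conv_mult[symmetric]) (simp add: Poly_Mapping.map.rep_eq when_def)
  have "(\<Sum>as\<in>exponent_lists N m. Poly_Mapping.single 0 (c as) * eval_monomial fs as) = 0"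
  proof (rule poly_mapping_eqI)
    fix x
    have "(\<Sum>as\<in>exponent_lists N m. c as * lookup (eval_monomial fs as) x) = 0"
    proof (cases "x \<in> ?X")
      case False
      have "lookup (eval_monomial fs as) x = 0" if "as \<in> exponent_lists N m" for as
        using keys_eval_monomial_box[OF D, of fs as N] that False unfolding exponent_lists_def L_def fs_def
        by (auto simp: in_keys_iff mult.assoc mult.commute mult.left_commute)
      then show ?thesis by simp
    qed (rule c(2))
    then show "lookup (\<Sum>as\<in>exponent_lists N m. Poly_Mapping.single 0 (c as) * eval_monomial fs as) x = lookup 0 x"
      by (simp add: lookup_sum lookup)
  qed
  moreover have "0 \<in> Q 0" using Q[of 0] unfolding prime_set_def by auto
  ultimately have "(\<Sum>as\<in>exponent_lists N (length fs). Poly_Mapping.single 0 (c as) * eval_monomial fs as) \<in> Q 0"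
    by (simp add: fs_def)
  note sum0 = this
  have "\<forall>as\<in>exponent_lists N (length fs). c as = 0"
  proof (rule chain_monomials_independent[OF R _ _ emb fsR])
    fix i
    show "i \<le> length fs \<Longrightarrow> prime_set R (Q i)" using Q[of i] mn by (simp add: fs_def)
    show "i < length fs \<Longrightarrow> Q i \<subseteq> Q (Suc i) \<and> fs ! i \<in> Q (Suc i) - Q i"
      using f[of i] chain[of i] mn by (auto simp: fs_def)
    show "(\<Sum>as\<in>exponent_lists N (length fs). Poly_Mapping.single 0 (c as) * eval_monomial fs as) \<in> Q 0" by (rule sum0)
    show "Poly_Mapping.single 0 0 = (0 :: (nat ^ 'd) \<Rightarrow>\<^sub>0 'k)" by (rule single_zero)
  qed (simp_all add: mult_single)
  then show False using c(1) by (simp add: fs_def)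
qed

section \<open>Localization\<close>

definition ideal_set :: "'r::comm_ring_1 set \<Rightarrow> 'r set \<Rightarrow> bool" where
  "ideal_set R P \<longleftrightarrow> P \<subseteq> R \<and> 0 \<in> P \<and> (\<forall>a\<in>P. \<forall>b\<in>P. a + b \<in> P) \<and> (\<forall>r\<in>R. \<forall>a\<in>P. r * a \<in> P)"

lemma ideal_setD:
  assumes "ideal_set R P"
  shows "P \<subseteq> R" "0 \<in> P" "a \<in> P \<Longrightarrow> b \<in> P \<Longrightarrow> a + b \<in> P" "r \<in> R \<Longrightarrow> a \<in> P \<Longrightarrow> r * a \<in> P"
  using assms unfolding ideal_set_def by auto

lemma prime_set_ideal: "prime_set R P \<Longrightarrow> ideal_set R P"
  unfolding prime_set_def ideal_set_def by auto

lemma (in subring_of) ideal_set_rspan: "X \<subseteq> R \<Longrightarrow> ideal_set R (rspan R X)"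
  unfolding ideal_set_def using rspan_subset[of X]
  by (auto intro: rspan.zero rspan_add rspan_mult)

text \<open>A subring of a type-class ring as a structure of its own; \<open>semigroup_ring S\<close> is of this form.\<close>
definition subring_record :: "'r::comm_ring_1 set \<Rightarrow> 'r ring" where
  "subring_record R = \<lparr> carrier = R, monoid.mult = (*), one = 1, ring.zero = 0, add = (+) \<rparr>"

context fractions_of
begin

definition frac_of :: "'r \<Rightarrow> 'r \<Rightarrow> ('r \<times> 'r) set" where
  "frac_of = fraction (subring_record R) M"

definition L :: "('r \<times> 'r) set ring" where
  "L = localization (subring_record R) M"

lemma M_R: "s \<in> M \<Longrightarrow> s \<in> R"
  using M_sub by auto

abbreviation rel where "rel \<equiv> frac_rel (subring_record R) M"

lemma rel_iff: "((a, s), (b, t)) \<in> rel \<longleftrightarrow>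
    a \<in> R \<and> b \<in> R \<and> s \<in> M \<and> t \<in> M \<and> (\<exists>u\<in>M. u * (t * a) = u * (s * b))"
  unfolding frac_rel_def subring_record_def by simp

lemma equiv_rel: "equiv (R \<times> M) rel"
proof (rule equivI)
  show "rel \<subseteq> (R \<times> M) \<times> (R \<times> M)" by (auto simp: rel_iff)
  show "refl_on (R \<times> M) rel" by (auto simp: refl_on_def rel_iff)
  show "sym rel" by (rule symI) (auto simp: rel_iff eq_commute)
  show "trans rel"
  proof (rule transI, clarify)
    fix a s b t c r
    assume "((a, s), (b, t)) \<in> rel" "((b, t), (c, r)) \<in> rel"
    then obtain u v where uv: "u \<in> M" "v \<in> M" "u * (t * a) = u * (s * b)" "v * (r * b) = v * (t * c)"
      and mem: "a \<in> R" "c \<in> R" "s \<in> M" "r \<in> M" "t \<in> M"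
      unfolding rel_iff by auto
    have "(u * v * t) * (r * a) = v * r * (u * (t * a))" by (simp add: algebra_simps)
    also have "\<dots> = u * s * (v * (r * b))" unfolding uv(3) by (simp add: algebra_simps)
    also have "\<dots> = (u * v * t) * (s * c)" unfolding uv(4) by (simp add: algebra_simps)
    finally show "((a, s), (c, r)) \<in> rel" unfolding rel_iff using mem uv by auto
  qed
qed

lemma frac_eq_iff:
  assumes "a \<in> R" "b \<in> R" "s \<in> M" "t \<in> M"
  shows "frac_of a s = frac_of b t \<longleftrightarrow> (\<exists>u\<in>M. u * (t * a) = u * (s * b))"
  using eq_equiv_class_iff[OF equiv_rel, of "(a, s)" "(b, t)"] assms
  unfolding frac_of_def fraction_def by (auto simp: rel_iff)

lemma frac_eqI:
  assumes "a \<in> R" "b \<in> R" "s \<in> M" "t \<in> M" "t * a = s * b"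
  shows "frac_of a s = frac_of b t"
  using assms frac_eq_iff[of a b s t] by (auto intro!: bexI[of _ 1])

lemma frac_zero: "s \<in> M \<Longrightarrow> frac_of 0 s = frac_of 0 1"
  by (intro frac_eqI) auto

lemma in_frac: "(a, s) \<in> frac_of b t \<longleftrightarrow> ((b, t), (a, s)) \<in> rel"
  unfolding frac_of_def fraction_def by auto

lemma carrier_L: "carrier L = {frac_of a s | a s. a \<in> R \<and> s \<in> M}"
  unfolding L_def localization_def frac_of_def fraction_def subring_record_def quotient_def by auto

lemma frac_carrier [simp, intro]: "a \<in> R \<Longrightarrow> s \<in> M \<Longrightarrow> frac_of a s \<in> carrier L"
  unfolding carrier_L by auto

lemma carrier_LE:
  assumes "x \<in> carrier L" obtains a s where "x = frac_of a s" "a \<in> R" "s \<in> M"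
  using assms unfolding carrier_L by auto

lemma one_L: "\<one>\<^bsub>L\<^esub> = frac_of 1 1" and zero_L: "\<zero>\<^bsub>L\<^esub> = frac_of 0 1"
  unfolding L_def localization_def frac_of_def subring_record_def by simp_all

text \<open>The union in the definition of the operations of a localization ranges over representatives that all yield the
  same class.\<close>
lemma union_const:
  assumes "(a, s) \<in> U" "(b, t) \<in> V"
    and "\<And>a s b t. (a, s) \<in> U \<Longrightarrow> (b, t) \<in> V \<Longrightarrow> F a s b t = W"
  shows "(\<Union>(a, s)\<in>U. \<Union>(b, t)\<in>V. F a s b t) = W"
  using assms by fast

lemma mult_L:
  assumes "a \<in> R" "b \<in> R" "s \<in> M" "t \<in> M"
  shows "frac_of a s \<otimes>\<^bsub>L\<^esub> frac_of b t = frac_of (a * b) (s * t)"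
proof -
  have "frac_of a s \<otimes>\<^bsub>L\<^esub> frac_of b t = (\<Union>(a, s)\<in>frac_of a s. \<Union>(b, t)\<in>frac_of b t. frac_of (a * b) (s * t))"
    unfolding L_def localization_def frac_of_def[symmetric] by (simp add: subring_record_def)
  also have "\<dots> = frac_of (a * b) (s * t)"
  proof (rule union_const)
    show "(a, s) \<in> frac_of a s" "(b, t) \<in> frac_of b t"
      using assms by (auto simp: in_frac rel_iff)
    fix a' s' b' t' assume "(a', s') \<in> frac_of a s" "(b', t') \<in> frac_of b t"
    then obtain u v where uv: "u \<in> M" "v \<in> M" "u * (s' * a) = u * (s * a')" "v * (t' * b) = v * (t * b')"
      and mem: "a' \<in> R" "b' \<in> R" "s' \<in> M" "t' \<in> M" unfolding in_frac rel_iff by auto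
    have "(u * v) * ((s * t) * (a' * b')) = (u * (s * a')) * (v * (t * b'))" by (simp add: algebra_simps)
    also have "\<dots> = (u * v) * ((s' * t') * (a * b))" unfolding uv(3,4)[symmetric] by (simp add: algebra_simps)
    finally show "frac_of (a' * b') (s' * t') = frac_of (a * b) (s * t)"
      using uv mem assms by (subst frac_eq_iff) auto
  qed
  finally show ?thesis .
qed

lemma add_L:
  assumes "a \<in> R" "b \<in> R" "s \<in> M" "t \<in> M"
  shows "frac_of a s \<oplus>\<^bsub>L\<^esub> frac_of b t = frac_of (t * a + s * b) (s * t)"
proof -
  have "frac_of a s \<oplus>\<^bsub>L\<^esub> frac_of b t = (\<Union>(a, s)\<in>frac_of a s. \<Union>(b, t)\<in>frac_of b t. frac_of (t * a + s * b) (s * t))"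
    unfolding L_def localization_def frac_of_def[symmetric] by (simp add: subring_record_def)
  also have "\<dots> = frac_of (t * a + s * b) (s * t)"
  proof (rule union_const)
    show "(a, s) \<in> frac_of a s" "(b, t) \<in> frac_of b t"
      using assms by (auto simp: in_frac rel_iff)
    fix a' s' b' t' assume "(a', s') \<in> frac_of a s" "(b', t') \<in> frac_of b t"
    then obtain u v where uv: "u \<in> M" "v \<in> M" "u * (s' * a) = u * (s * a')" "v * (t' * b) = v * (t * b')"
      and mem: "a' \<in> R" "b' \<in> R" "s' \<in> M" "t' \<in> M" unfolding in_frac rel_iff by auto
    have "(u * v) * ((s * t) * (t' * a' + s' * b')) = v * t * t' * (u * (s * a')) + u * s * s' * (v * (t * b'))"
      by (simp add: algebra_simps)
    also have "\<dots> = (u * v) * ((s' * t') * (t * a + s * b))"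
      unfolding uv(3,4)[symmetric] by (simp add: algebra_simps)
    finally show "frac_of (t' * a' + s' * b') (s' * t') = frac_of (t * a + s * b) (s * t)"
      using uv mem assms M_R by (subst frac_eq_iff) auto
  qed
  finally show ?thesis .
qed

lemma cring_L: "cring L"
proof (rule cringI)
  show "abelian_group L"
  proof (rule abelian_groupI)
    show "\<zero>\<^bsub>L\<^esub> \<in> carrier L" unfolding zero_L by auto
  next
    fix x y assume "x \<in> carrier L" "y \<in> carrier L"
    then show "x \<oplus>\<^bsub>L\<^esub> y \<in> carrier L" "x \<oplus>\<^bsub>L\<^esub> y = y \<oplus>\<^bsub>L\<^esub> x"
      by (auto elim!: carrier_LE simp: add_L M_R algebra_simps)
  next
    fix x y z assume "x \<in> carrier L" "y \<in> carrier L" "z \<in> carrier L"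
    then show "(x \<oplus>\<^bsub>L\<^esub> y) \<oplus>\<^bsub>L\<^esub> z = x \<oplus>\<^bsub>L\<^esub> (y \<oplus>\<^bsub>L\<^esub> z)"
      by (auto elim!: carrier_LE simp: add_L M_R algebra_simps)
  next
    fix x assume "x \<in> carrier L"
    then obtain a s where x: "x = frac_of a s" "a \<in> R" "s \<in> M" by (rule carrier_LE)
    show "\<zero>\<^bsub>L\<^esub> \<oplus>\<^bsub>L\<^esub> x = x" using x by (simp add: zero_L add_L)
    show "\<exists>y\<in>carrier L. y \<oplus>\<^bsub>L\<^esub> x = \<zero>\<^bsub>L\<^esub>"
      using x by (intro bexI[of _ "frac_of (- a) s"]) (simp_all add: zero_L add_L M_R frac_zero[of "s * s"])
  qed
next
  show "Group.comm_monoid L"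
  proof (rule comm_monoidI)
    show "\<one>\<^bsub>L\<^esub> \<in> carrier L" unfolding one_L by auto
  next
    fix x y assume "x \<in> carrier L" "y \<in> carrier L"
    then show "x \<otimes>\<^bsub>L\<^esub> y \<in> carrier L" "x \<otimes>\<^bsub>L\<^esub> y = y \<otimes>\<^bsub>L\<^esub> x"
      by (auto elim!: carrier_LE simp: mult_L M_R algebra_simps)
  next
    fix x y z assume "x \<in> carrier L" "y \<in> carrier L" "z \<in> carrier L"
    then show "(x \<otimes>\<^bsub>L\<^esub> y) \<otimes>\<^bsub>L\<^esub> z = x \<otimes>\<^bsub>L\<^esub> (y \<otimes>\<^bsub>L\<^esub> z)"
      by (auto elim!: carrier_LE simp: mult_L M_R algebra_simps)
  next
    fix x assume "x \<in> carrier L"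
    then show "\<one>\<^bsub>L\<^esub> \<otimes>\<^bsub>L\<^esub> x = x"
      by (auto elim!: carrier_LE simp: mult_L one_L M_R)
  qed
next
  fix x y z assume "x \<in> carrier L" "y \<in> carrier L" "z \<in> carrier L"
  then obtain a s b t c r where x: "x = frac_of a s" "y = frac_of b t" "z = frac_of c r"
    and mem: "a \<in> R" "b \<in> R" "c \<in> R" "s \<in> M" "t \<in> M" "r \<in> M"
    by (auto elim!: carrier_LE)
  have "frac_of ((t * a + s * b) * c) (s * t * r) = frac_of (t * r * (a * c) + s * r * (b * c)) (s * r * (t * r))"
    using mem M_R by (intro frac_eqI) (auto simp: algebra_simps)
  then show "(x \<oplus>\<^bsub>L\<^esub> y) \<otimes>\<^bsub>L\<^esub> z = x \<otimes>\<^bsub>L\<^esub> z \<oplus>\<^bsub>L\<^esub> y \<otimes>\<^bsub>L\<^esub> z"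
    using mem M_R unfolding x by (simp add: mult_L add_L)
qed

sublocale L: cring L by (rule cring_L)

lemma ideal_frac_iff:
  assumes "ideal I L" "a \<in> R" "s \<in> M"
  shows "frac_of a s \<in> I \<longleftrightarrow> frac_of a 1 \<in> I"
proof
  interpret ideal I L by fact
  assume "frac_of a s \<in> I"
  then have "frac_of s 1 \<otimes>\<^bsub>L\<^esub> frac_of a s \<in> I" using assms M_R by (intro I_l_closed) auto
  moreover have "frac_of s 1 \<otimes>\<^bsub>L\<^esub> frac_of a s = frac_of a 1"
    using assms M_R frac_eqI[of "s * a" a s 1] by (simp add: mult_L)
  ultimately show "frac_of a 1 \<in> I" by simp
next
  interpret ideal I L by fact
  assume "frac_of a 1 \<in> I"
  then have "frac_of 1 s \<otimes>\<^bsub>L\<^esub> frac_of a 1 \<in> I" using assms M_R by (intro I_l_closed) auto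
  then show "frac_of a s \<in> I" using assms M_R by (auto simp: mult_L)
qed

lemma ideal_frac_add:
  assumes "ideal I L" "a \<in> R" "b \<in> R" "frac_of a 1 \<in> I" "frac_of b 1 \<in> I"
  shows "frac_of (a + b) 1 \<in> I"
proof -
  interpret ideal I L by fact
  have "frac_of a 1 \<oplus>\<^bsub>L\<^esub> frac_of b 1 \<in> I" using assms by auto
  then show ?thesis using assms by (simp add: add_L)
qed

lemma ideal_frac_mult:
  assumes "ideal I L" "a \<in> R" "b \<in> R" "frac_of b 1 \<in> I"
  shows "frac_of (a * b) 1 \<in> I"
proof -
  interpret ideal I L by fact
  have "frac_of a 1 \<otimes>\<^bsub>L\<^esub> frac_of b 1 \<in> I" using assms by (intro I_l_closed) auto
  then show ?thesis using assms by (simp add: mult_L)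
qed

definition ext :: "'r set \<Rightarrow> ('r \<times> 'r) set set" where
  "ext P = {frac_of p s | p s. p \<in> P \<and> s \<in> M}"

lemma ext_iff:
  assumes P: "ideal_set R P" and "p \<in> R" "s \<in> M"
  shows "frac_of p s \<in> ext P \<longleftrightarrow> (\<exists>u\<in>M. u * p \<in> P)"
proof
  assume "frac_of p s \<in> ext P"
  then obtain q t where q: "frac_of p s = frac_of q t" "q \<in> P" "t \<in> M" unfolding ext_def by auto
  then have "q \<in> R" using ideal_setD(1)[OF P] by auto
  with q assms obtain u where u: "u \<in> M" "u * (t * p) = u * (s * q)" using frac_eq_iff by auto
  have "u * s * q \<in> P" using u assms q M_R by (intro ideal_setD(4)[OF P]) auto
  then have "(u * t) * p \<in> P" using u by (simp add: mult.assoc)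
  then show "\<exists>u\<in>M. u * p \<in> P" using u q by blast
next
  assume "\<exists>u\<in>M. u * p \<in> P"
  then obtain u where u: "u \<in> M" "u * p \<in> P" by blast
  then have "frac_of p s = frac_of (u * p) (u * s)"
    using assms M_R by (intro frac_eqI) (auto simp: algebra_simps)
  then show "frac_of p s \<in> ext P" unfolding ext_def using u assms by auto
qed

lemma ideal_ext:
  assumes P: "ideal_set R P"
  shows "ideal (ext P) L"
proof (rule idealI)
  show "ring L" by (rule L.ring_axioms)
  note PR = subsetD[OF ideal_setD(1)[OF P]]
  show "subgroup (ext P) (add_monoid L)"
  proof
    show "ext P \<subseteq> carrier (add_monoid L)" using PR unfolding ext_def by auto
    show "\<one>\<^bsub>add_monoid L\<^esub> \<in> ext P" using ideal_setD(2)[OF P] unfolding ext_def by (auto simp: zero_L)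
  next
    fix x y assume "x \<in> ext P" "y \<in> ext P"
    then obtain p s q t where *: "x = frac_of p s" "y = frac_of q t" "p \<in> P" "q \<in> P" "s \<in> M" "t \<in> M"
      unfolding ext_def by auto
    then have "t * p + s * q \<in> P" using M_R by (intro ideal_setD(3,4)[OF P]) auto
    with * show "x \<otimes>\<^bsub>add_monoid L\<^esub> y \<in> ext P" using PR by (auto simp: add_L ext_def)
  next
    fix x assume "x \<in> ext P"
    then obtain p s where *: "x = frac_of p s" "p \<in> P" "s \<in> M" unfolding ext_def by auto
    have m: "- p \<in> P" using ideal_setD(4)[OF P, of "-1" p] * by auto
    have "frac_of (- p) s \<oplus>\<^bsub>L\<^esub> x = \<zero>\<^bsub>L\<^esub>"
      using * PR M_R by (simp add: add_L zero_L frac_zero[of "s * s"])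
    then have "\<ominus>\<^bsub>L\<^esub> x = frac_of (- p) s"
      using * PR by (intro L.minus_equality) auto
    then show "inv\<^bsub>add_monoid L\<^esub> x \<in> ext P"
      using m * unfolding a_inv_def[symmetric] ext_def by auto
  qed
  fix x y assume "x \<in> ext P" "y \<in> carrier L"
  then obtain p s a t where *: "x = frac_of p s" "p \<in> P" "s \<in> M" "y = frac_of a t" "a \<in> R" "t \<in> M"
    unfolding ext_def carrier_L by auto
  then have "a * p \<in> P" by (intro ideal_setD(4)[OF P])
  then show "y \<otimes>\<^bsub>L\<^esub> x \<in> ext P" "x \<otimes>\<^bsub>L\<^esub> y \<in> ext P"
    using * PR by (auto simp: mult_L ext_def mult.commute[of p a])
qed

text \<open>Generators of an ideal of the localization may be replaced by their numerators.\<close>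
lemma genideal_frac:
  assumes F: "F \<subseteq> R"
    and "\<And>x. x \<in> X \<Longrightarrow> \<exists>f\<in>F. \<exists>s\<in>M. x = frac_of f s" "\<And>f. f \<in> F \<Longrightarrow> \<exists>s\<in>M. frac_of f s \<in> X"
    and ps: "p \<in> R" "s \<in> M"
  shows "frac_of p s \<in> genideal L X \<longleftrightarrow> (\<exists>u\<in>M. u * p \<in> rspan R F)"
proof -
  have XL: "X \<subseteq> carrier L" using assms by fastforce
  have I: "ideal (genideal L X) L" by (rule L.genideal_ideal[OF XL])
  note S = ideal_set_rspan[OF F]
  have "X \<subseteq> ext (rspan R F)"
    using assms(2) rspan_base unfolding ext_def by blast
  then have 1: "genideal L X \<subseteq> ext (rspan R F)" by (rule L.genideal_minimal[OF ideal_ext[OF S]])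
  have 2: "frac_of g 1 \<in> genideal L X" if "g \<in> rspan R F" for g
    using that
  proof (induction rule: rspan.induct)
    case zero
    show ?case using additive_subgroup.zero_closed[OF ideal.axioms(1)[OF I]] unfolding zero_L .
  next
    case (step r f g)
    obtain s where "s \<in> M" "frac_of f s \<in> X" using assms(3)[OF step(2)] by auto
    then have "frac_of f 1 \<in> genideal L X"
      using ideal_frac_iff[OF I, of f s] L.genideal_self[OF XL] F step by auto
    with step show ?case using F rspan_subset[OF F] 
      by (intro ideal_frac_add[OF I] ideal_frac_mult[OF I]) auto
  qed
  show ?thesis
  proof
    assume "frac_of p s \<in> genideal L X"
    then show "\<exists>u\<in>M. u * p \<in> rspan R F" using 1 ext_iff[OF S ps] by auto
  next
    assume "\<exists>u\<in>M. u * p \<in> rspan R F"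
    then obtain u where u: "u \<in> M" "u * p \<in> rspan R F" by auto
    then have "frac_of (u * p) (u * s) \<in> genideal L X"
      using ideal_frac_iff[OF I, of "u * p" "u * s"] 2 ps M_R by auto
    moreover have "frac_of (u * p) (u * s) = frac_of p s"
      using u ps M_R by (intro frac_eqI) (auto simp: algebra_simps)
    ultimately show "frac_of p s \<in> genideal L X" by simp
  qed
qed

lemma ext_prime_iff:
  assumes P: "prime_set R P" "P \<inter> M = {}" and "p \<in> R" "s \<in> M"
  shows "frac_of p s \<in> ext P \<longleftrightarrow> p \<in> P"
proof -
  have "u * p \<in> P \<Longrightarrow> u \<in> M \<Longrightarrow> p \<in> P" for u
    using prime_setD(6)[OF P(1), of u p] P(2) M_R assms by auto
  moreover have "p \<in> P \<Longrightarrow> 1 * p \<in> P" by simp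
  ultimately show ?thesis using ext_iff[OF prime_set_ideal[OF P(1)] assms(3,4)] M_one by blast
qed

lemma prime_ext:
  assumes P: "prime_set R P" "P \<inter> M = {}"
  shows "primeideal (ext P) L"
proof (rule primeidealI)
  show "ideal (ext P) L" by (rule ideal_ext[OF prime_set_ideal[OF P(1)]])
  show "cring L" by (rule cring_L)
  have "frac_of 1 1 \<notin> ext P" using ext_prime_iff[OF P, of 1 1] prime_setD(3)[OF P(1)] by auto
  then show "carrier L \<noteq> ext P" by auto
  fix x y assume "x \<in> carrier L" "y \<in> carrier L" and xy: "x \<otimes>\<^bsub>L\<^esub> y \<in> ext P"
  then obtain a s b t where *: "x = frac_of a s" "a \<in> R" "s \<in> M" "y = frac_of b t" "b \<in> R" "t \<in> M"
    by (auto elim!: carrier_LE)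
  with xy have "a * b \<in> P" by (auto simp: mult_L ext_prime_iff[OF P])
  then show "x \<in> ext P \<or> y \<in> ext P" using * prime_setD(6)[OF P(1)] by (auto simp: ext_prime_iff[OF P])
qed

definition contr :: "('r \<times> 'r) set set \<Rightarrow> 'r set" where
  "contr I = {a \<in> R. frac_of a 1 \<in> I}"

lemma prime_contr:
  assumes "primeideal I L"
  shows "prime_set R (contr I)"
proof -
  interpret primeideal I L by fact
  have I: "ideal I L" by (rule ideal_axioms)
  have "frac_of 1 1 \<notin> I" using one_imp_carrier I_notcarr unfolding one_L by blast
  moreover have "frac_of 0 1 \<in> I" using zero_closed unfolding zero_L .
  moreover have "a \<in> contr I \<or> b \<in> contr I" if "a \<in> R" "b \<in> R" "a * b \<in> contr I" for a b
    using I_prime[of "frac_of a 1" "frac_of b 1"] that unfolding contr_def by (auto simp: mult_L)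
  ultimately show ?thesis
    unfolding prime_set_def contr_def using ideal_frac_add[OF I] ideal_frac_mult[OF I] by auto
qed

lemma contr_strict:
  assumes "ideal I L" "ideal J L" "I \<subset> J"
  shows "contr I \<subset> contr J"
proof -
  obtain x where x: "x \<in> J" "x \<notin> I" using assms by auto
  from ideal.Icarr[OF assms(2) x(1)] obtain a s where as: "x = frac_of a s" "a \<in> R" "s \<in> M"
    by (rule carrier_LE)
  have "a \<in> contr J" "a \<notin> contr I"
    using x ideal_frac_iff[OF assms(1) as(2,3)] ideal_frac_iff[OF assms(2) as(2,3)] as(2)
    unfolding contr_def as(1) by blast+
  then show ?thesis using assms(3) unfolding contr_def by auto
qed

text \<open>If an ideal is not finitely generated, successively chosen numerators outside the ideal generated by the previous
  ones contradict the Noetherian property of \<open>R\<close>.\<close>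
lemma noetherian_L:
  assumes "noetherian R"
  shows "noetherian_ring L"
proof (rule L.noetherian_ringI)
  fix I assume I: "ideal I L"
  note IL = ideal.Icarr[OF I]
  show "\<exists>A\<subseteq>carrier L. finite A \<and> I = genideal L A"
  proof (rule ccontr)
    assume no: "\<not> ?thesis"
    have pick: "\<exists>a\<in>contr I. frac_of a 1 \<notin> genideal L ((\<lambda>a. frac_of a 1) ` X)" if "finite X" "X \<subseteq> contr I" for X
    proof -
      let ?A = "(\<lambda>a. frac_of a 1) ` X"
      have AI: "?A \<subseteq> I" and AL: "?A \<subseteq> carrier L" using that unfolding contr_def by auto
      have "genideal L ?A \<subseteq> I" by (rule L.genideal_minimal[OF I AI])
      moreover have "I \<noteq> genideal L ?A" using no that AL by blast
      ultimately obtain x where x: "x \<in> I" "x \<notin> genideal L ?A" by blast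
      obtain a s where as: "x = frac_of a s" "a \<in> R" "s \<in> M" using IL[OF x(1)] by (rule carrier_LE)
      then show ?thesis using x ideal_frac_iff[OF I] ideal_frac_iff[OF L.genideal_ideal[OF AL]]
        unfolding contr_def by blast
    qed
    define Q where "Q f k a \<longleftrightarrow> a \<in> contr I \<and> frac_of a 1 \<notin> genideal L ((\<lambda>a. frac_of a 1) ` f ` {..<k})"
      for f :: "nat \<Rightarrow> 'r" and k a
    have "\<exists>w. \<forall>k. Q w k (w k)"
    proof (rule dependent_wellorder_choice)
      fix r and f g :: "nat \<Rightarrow> 'r" and k assume "\<And>y. y < k \<Longrightarrow> f y = g y"
      then have "f ` {..<k} = g ` {..<k}" by auto
      then show "Q f k r = Q g k r" unfolding Q_def by simp
    next
      fix k and f :: "nat \<Rightarrow> 'r" assume "\<And>y. y < k \<Longrightarrow> Q f y (f y)"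
      then have "f ` {..<k} \<subseteq> contr I" unfolding Q_def by auto
      from pick[OF _ this] show "\<exists>r. Q f k r" unfolding Q_def by auto
    qed
    then obtain w where w: "\<And>k. Q w k (w k)" by blast
    have wR: "w k \<in> R" for k using w[of k] unfolding Q_def contr_def by auto
    then obtain k where k: "w k \<in> rspan R (w ` {..<k})" using assms unfolding noetherian_def by blast
    have "frac_of (w k) 1 \<in> genideal L ((\<lambda>a. frac_of a 1) ` w ` {..<k})"
    proof (subst genideal_frac[where F = "w ` {..<k}"])
      show "\<exists>u\<in>M. u * w k \<in> rspan R (w ` {..<k})" using k by (intro bexI[of _ 1]) auto
    qed (use wR M_one in blast)+
    with w[of k] show False unfolding Q_def by blast
  qed
qed

lemma local_L:
  assumes P: "prime_set R P" and M: "M = R - P"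
  shows "maximalideal (ext P) L" "maximalideal I L \<Longrightarrow> I = ext P"
proof -
  have PM: "P \<inter> M = {}" using M by auto
  interpret E: primeideal "ext P" L by (rule prime_ext[OF P PM])
  have key: "J = carrier L" if J: "ideal J L" "\<not> J \<subseteq> ext P" for J
  proof -
    obtain x where x: "x \<in> J" "x \<notin> ext P" using J by auto
    from ideal.Icarr[OF J(1) x(1)] obtain a s where as: "x = frac_of a s" "a \<in> R" "s \<in> M"
      by (rule carrier_LE)
    have "a \<notin> P" using x(2) ext_prime_iff[OF P PM as(2,3)] unfolding as(1) by blast
    then have "a \<in> M" unfolding M using as(2) by blast
    have "frac_of a 1 \<in> J" using x(1) ideal_frac_iff[OF J(1) as(2,3)] unfolding as(1) by blast
    then have "frac_of 1 a \<otimes>\<^bsub>L\<^esub> frac_of a 1 \<in> J"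
      using \<open>a \<in> M\<close> by (intro ideal.I_l_closed[OF J(1)] frac_carrier one_mem)
    moreover have "frac_of 1 a \<otimes>\<^bsub>L\<^esub> frac_of a 1 = \<one>\<^bsub>L\<^esub>"
      unfolding one_L using \<open>a \<in> M\<close> as frac_eqI[of a 1 a 1] by (simp add: mult_L)
    ultimately show ?thesis using ideal.one_imp_carrier[OF J(1)] by simp
  qed
  show "maximalideal (ext P) L"
  proof (rule maximalidealI)
    show "ideal (ext P) L" by (rule E.ideal_axioms)
    show "carrier L \<noteq> ext P" by (rule E.I_notcarr)
    show "J = ext P \<or> J = carrier L" if "ideal J L" "ext P \<subseteq> J" for J
      using key[OF that(1)] that(2) by blast
  qed
  assume I: "maximalideal I L"
  then interpret I: maximalideal I L .
  have "I \<subseteq> ext P" using key[OF I.ideal_axioms] I.I_notcarr by blast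
  moreover have "ext P \<subseteq> carrier L" using E.Icarr by blast
  ultimately show "I = ext P" using I.I_maximal[OF E.ideal_axioms] E.I_notcarr by blast
qed

text \<open>Chains of primes of the localization contract to chains of primes of \<open>R\<close>, and a chain in \<open>R\<close> that avoids \<open>M\<close> extends
  to the localization.\<close>
lemma krull_dim_L:
  assumes upper: "\<And>n Q. (\<And>i. i \<le> n \<Longrightarrow> prime_set R (Q i)) \<Longrightarrow> (\<And>i. i < n \<Longrightarrow> Q i \<subset> Q (Suc i)) \<Longrightarrow> n \<le> d"
    and lower: "\<And>i. i \<le> d \<Longrightarrow> prime_set R (Q i) \<and> Q i \<inter> M = {}" "\<And>i. i < d \<Longrightarrow> Q i \<subset> Q (Suc i)"
  shows "krull_dim L = enat d"
  unfolding krull_dim_def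
proof (rule antisym)
  show "Sup {enat n |n. \<exists>P. (\<forall>i\<le>n. primeideal (P i) L) \<and> (\<forall>i<n. P i \<subset> P (Suc i))} \<le> enat d"
  proof (rule Sup_least, clarify)
    fix n :: nat and P
    assume P: "\<forall>i\<le>n. primeideal (P i) L" "\<forall>i<n. P i \<subset> P (Suc i)"
    have "n \<le> d"
    proof (rule upper)
      fix i assume "i \<le> n" then show "prime_set R (contr (P i))" using P prime_contr by auto
    next
      fix i assume "i < n" then show "contr (P i) \<subset> contr (P (Suc i))"
        using P by (intro contr_strict primeideal.axioms(1)) auto
    qed
    then show "enat n \<le> enat d" by simp
  qed
  have "ext (Q i) \<subset> ext (Q (Suc i))" if "i < d" for i
  proof -
    have "Q i \<subset> Q (Suc i)" using lower(2) that .
    then obtain a where a: "a \<in> Q (Suc i)" "a \<notin> Q i" by auto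
    have "a \<in> R" using a lower(1)[of "Suc i"] that prime_setD(1) by fastforce
    then have "frac_of a 1 \<in> ext (Q (Suc i))" "frac_of a 1 \<notin> ext (Q i)"
      using a lower(1)[of "Suc i"] lower(1)[of i] that by (auto simp: ext_prime_iff)
    moreover have "ext (Q i) \<subseteq> ext (Q (Suc i))" using \<open>Q i \<subset> Q (Suc i)\<close> unfolding ext_def by auto
    ultimately show ?thesis by auto
  qed
  then have "\<exists>P. (\<forall>i\<le>d. primeideal (P i) L) \<and> (\<forall>i<d. P i \<subset> P (Suc i))"
    using lower(1) prime_ext by (intro exI[of _ "\<lambda>i. ext (Q i)"]) auto
  then show "enat d \<le> Sup {enat n |n. \<exists>P. (\<forall>i\<le>n. primeideal (P i) L) \<and> (\<forall>i<n. P i \<subset> P (Suc i))}"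
    by (intro Sup_upper) auto
qed

end

context subring_of
begin

lemma cring_subring_record: "cring (subring_record R)"
proof (rule cringI)
  show "abelian_group (subring_record R)"
  proof (rule abelian_groupI)
    fix x assume "x \<in> carrier (subring_record R)"
    then show "\<exists>y\<in>carrier (subring_record R). y \<oplus>\<^bsub>subring_record R\<^esub> x = \<zero>\<^bsub>subring_record R\<^esub>"
      by (intro bexI[of _ "- x"]) (auto simp: subring_record_def)
  qed (auto simp: subring_record_def algebra_simps)
  show "Group.comm_monoid (subring_record R)"
    by (rule comm_monoidI) (auto simp: subring_record_def algebra_simps)
qed (auto simp: subring_record_def algebra_simps)

lemma rspan_mult_right: "g \<in> rspan R X \<Longrightarrow> r \<in> R \<Longrightarrow> g * r \<in> rspan R X"
  using rspan_mult[of g X r] by (simp add: mult.commute)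

lemma genideal_subring_record:
  assumes "X \<subseteq> R"
  shows "genideal (subring_record R) X = rspan R X"
proof
  interpret r: cring "subring_record R" by (rule cring_subring_record)
  have X: "X \<subseteq> carrier (subring_record R)" using assms by (simp add: subring_record_def)
  note S = ideal_set_rspan[OF assms]
  have "ideal (rspan R X) (subring_record R)"
  proof (rule idealI)
    show "ring (subring_record R)" by (rule r.ring_axioms)
    show "subgroup (rspan R X) (add_monoid (subring_record R))"
    proof (rule r.add.subgroupI)
      show "rspan R X \<subseteq> carrier (subring_record R)" using ideal_setD(1)[OF S] by (simp add: subring_record_def)
      show "rspan R X \<noteq> {}" using rspan.zero by blast
      fix x assume x: "x \<in> rspan R X"
      then have "x \<in> R" using ideal_setD(1)[OF S] by auto
      then have "\<ominus>\<^bsub>subring_record R\<^esub> x = - x"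
        by (intro r.minus_equality) (auto simp: subring_record_def)
      then show "\<ominus>\<^bsub>subring_record R\<^esub> x \<in> rspan R X" using rspan_uminus[OF x] by simp
    next
      fix x y assume "x \<in> rspan R X" "y \<in> rspan R X"
      then show "x \<oplus>\<^bsub>subring_record R\<^esub> y \<in> rspan R X" by (simp add: subring_record_def rspan_add)
    qed
  qed (auto simp: subring_record_def rspan_mult rspan_mult_right)
  then show "genideal (subring_record R) X \<subseteq> rspan R X"
    by (rule r.genideal_minimal) (auto intro: rspan_base)
  have I: "ideal (genideal (subring_record R) X) (subring_record R)" by (rule r.genideal_ideal[OF X])
  show "rspan R X \<subseteq> genideal (subring_record R) X"
  proof
    fix g assume "g \<in> rspan R X"
    then show "g \<in> genideal (subring_record R) X"
    proof (induction rule: rspan.induct)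
      case zero
      show ?case using additive_subgroup.zero_closed[OF ideal.axioms(1)[OF I]] by (simp add: subring_record_def)
    next
      case (step r x g)
      have "r \<otimes>\<^bsub>subring_record R\<^esub> x \<in> genideal (subring_record R) X"
        using step r.genideal_self[OF X] by (intro ideal.I_l_closed[OF I]) (auto simp: subring_record_def)
      from additive_subgroup.a_closed[OF ideal.axioms(1)[OF I] this step(4)]
      show ?case by (simp add: subring_record_def)
    qed
  qed
qed

end

lemma (in fractions_of) frac_extI: "p \<in> P \<Longrightarrow> s \<in> M \<Longrightarrow> frac_of p s \<in> ext P"
  unfolding ext_def by blast

lemma (in fractions_of) frac_of_power:
  assumes "p \<in> R" "s \<in> M"
  shows "frac_of p s [^]\<^bsub>L\<^esub> (n::nat) = frac_of (p ^ n) (s ^ n) \<and> p ^ n \<in> R \<and> s ^ n \<in> M"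
proof (induction n)
  case 0
  show ?case by (simp add: one_L)
next
  case (Suc n)
  then show ?case using assms by (simp add: mult_L mult.commute)
qed

section \<open>Monoid algebras\<close>

lemma lookup_mult_sum:
  fixes p q :: "(nat ^ 'd) \<Rightarrow>\<^sub>0 'k::field"
  shows "lookup (p * q) c = (\<Sum>l\<in>keys p. \<Sum>m\<in>keys q. lookup p l * (lookup q m when c = l + m))"
proof -
  have inner: "(\<Sum>m. lookup q m when c = l + m) = (\<Sum>m\<in>keys q. lookup q m when c = l + m)" for l
    by (rule Sum_any.expand_superset) (auto simp: in_keys_iff)
  have "lookup (p * q) c = (\<Sum>l\<in>keys p. lookup p l * (\<Sum>m. lookup q m when c = l + m))"
    unfolding lookup_mult by (rule Sum_any.expand_superset) (auto simp: in_keys_iff)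
  then show ?thesis unfolding inner sum_distrib_left .
qed

lemma lookup_mult_unique:
  fixes p q :: "(nat ^ 'd) \<Rightarrow>\<^sub>0 'k::field"
  assumes "\<And>l m. l \<in> keys p \<Longrightarrow> m \<in> keys q \<Longrightarrow> l + m = a + b \<Longrightarrow> l = a \<and> m = b"
  shows "lookup (p * q) (a + b) = lookup p a * lookup q b"
proof -
  have "lookup (p * q) (a + b) = (\<Sum>l\<in>keys p. \<Sum>m\<in>keys q. (if l = a then if m = b then lookup p a * lookup q b else 0 else 0))"
    unfolding lookup_mult_sum using assms by (intro sum.cong refl) (auto simp: when_def)
  also have "\<dots> = (\<Sum>l\<in>keys p. if l = a then \<Sum>m\<in>keys q. (if m = b then lookup p a * lookup q b else 0) else 0)"
    by (intro sum.cong) auto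
  also have "\<dots> = lookup p a * lookup q b"
    by (auto simp: in_keys_iff)
  finally show ?thesis .
qed

lemma lookup_mult_0:
  fixes p q :: "(nat ^ 'd) \<Rightarrow>\<^sub>0 'k::field"
  shows "lookup (p * q) 0 = lookup p 0 * lookup q 0"
  using lookup_mult_unique[of p q 0 0] by (auto simp: vec_eq_iff)

lemma lookup_single_mult:
  fixes q :: "(nat ^ 'd) \<Rightarrow>\<^sub>0 'k::field"
  shows "lookup (Poly_Mapping.single a x * q) (a + b) = x * lookup q b"
  using lookup_mult_unique[of "Poly_Mapping.single a x" q a b]
  by (cases "x = 0") auto

lemma keys_single_mult:
  fixes q :: "(nat ^ 'd) \<Rightarrow>\<^sub>0 'k::field"
  shows "keys (Poly_Mapping.single a 1 * q) = (+) a ` keys q"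
proof
  show "keys (Poly_Mapping.single a 1 * q) \<subseteq> (+) a ` keys q"
    using keys_mult[of "Poly_Mapping.single a 1" q] by auto
  show "(+) a ` keys q \<subseteq> keys (Poly_Mapping.single a 1 * q)"
    by (auto simp: in_keys_iff lookup_single_mult)
qed

abbreviation monomial :: "nat ^ 'd \<Rightarrow> (nat ^ 'd) \<Rightarrow>\<^sub>0 'k::field" where
  "monomial a \<equiv> Poly_Mapping.single a 1"

lemma sum_of_terms: "p = (\<Sum>c\<in>keys p. Poly_Mapping.single c (lookup p c))"
  by (rule poly_mapping_eqI) (auto simp: lookup_sum lookup_single when_def in_keys_iff)

definition monoid_algebra :: "(nat ^ 'd) set \<Rightarrow> ((nat ^ 'd) \<Rightarrow>\<^sub>0 'k::field) set" where
  "monoid_algebra T = {p. keys p \<subseteq> T}"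

definition submonoid_set :: "(nat ^ 'd) set \<Rightarrow> bool" where
  "submonoid_set T \<longleftrightarrow> 0 \<in> T \<and> (\<forall>a\<in>T. \<forall>b\<in>T. a + b \<in> T)"

lemma subring_of_monoid_algebra:
  assumes "submonoid_set T"
  shows "subring_of (monoid_algebra T :: ((nat ^ 'd) \<Rightarrow>\<^sub>0 'k::field) set)"
proof
  show "1 \<in> (monoid_algebra T :: ((nat ^ 'd) \<Rightarrow>\<^sub>0 'k) set)" using assms unfolding monoid_algebra_def submonoid_set_def by auto
  fix p q :: "(nat ^ 'd) \<Rightarrow>\<^sub>0 'k" assume pq: "p \<in> monoid_algebra T" "q \<in> monoid_algebra T"
  have "keys (p - q) \<subseteq> keys p \<union> keys q" by (auto simp: in_keys_iff lookup_minus)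
  then show "p - q \<in> monoid_algebra T" using pq unfolding monoid_algebra_def by auto
  have "a + b \<in> T" if "a \<in> keys p" "b \<in> keys q" for a b
    using that pq assms unfolding monoid_algebra_def submonoid_set_def by blast
  then show "p * q \<in> monoid_algebra T" using keys_mult[of p q] unfolding monoid_algebra_def by blast
qed

lemma rspan_monomials:
  fixes p :: "(nat ^ 'd) \<Rightarrow>\<^sub>0 'k::field"
  assumes T: "submonoid_set T" and E: "E \<subseteq> T"
  shows "p \<in> rspan (monoid_algebra T) (monomial ` E) \<longleftrightarrow> (\<forall>c\<in>keys p. \<exists>e\<in>E. \<exists>t\<in>T. c = e + t)"
proof
  interpret subring_of "monoid_algebra T :: ((nat ^ 'd) \<Rightarrow>\<^sub>0 'k) set" by (rule subring_of_monoid_algebra[OF T])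
  assume "p \<in> rspan (monoid_algebra T) (monomial ` E)"
  then show "\<forall>c\<in>keys p. \<exists>e\<in>E. \<exists>t\<in>T. c = e + t"
  proof (induction rule: rspan.induct)
    case (step r x g)
    then obtain e where e: "e \<in> E" "x = monomial e" by auto
    have "keys (r * x) = (+) e ` keys r" unfolding e(2) mult.commute[of r] by (rule keys_single_mult)
    then have "\<forall>c\<in>keys (r * x). \<exists>e\<in>E. \<exists>t\<in>T. c = e + t" using e step(1) unfolding monoid_algebra_def by auto
    then show ?case using step(4) Poly_Mapping.keys_add[of "r * x" g] by blast
  qed auto
next
  interpret subring_of "monoid_algebra T :: ((nat ^ 'd) \<Rightarrow>\<^sub>0 'k) set" by (rule subring_of_monoid_algebra[OF T])
  assume *: "\<forall>c\<in>keys p. \<exists>e\<in>E. \<exists>t\<in>T. c = e + t"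
  have "Poly_Mapping.single c x \<in> rspan (monoid_algebra T) (monomial ` E)" if c: "c \<in> keys p" for c and x :: 'k
  proof -
    obtain e t where et: "e \<in> E" "t \<in> T" "c = e + t" using bspec[OF * c] by auto
    have "Poly_Mapping.single t x \<in> monoid_algebra T" using et(2) unfolding monoid_algebra_def by simp
    from rspan.step[OF this imageI[OF et(1), of monomial] rspan.zero] show ?thesis
      unfolding et(3) by (simp add: mult_single add.commute)
  qed
  then have "(\<Sum>c\<in>keys p. Poly_Mapping.single c (lookup p c)) \<in> rspan (monoid_algebra T) (monomial ` E)"
    by (rule rspan_sum)
  then show "p \<in> rspan (monoid_algebra T) (monomial ` E)" using sum_of_terms[of p] by simp
qed

lemma noetherian_constants: "noetherian (range (Poly_Mapping.single 0) :: ((nat ^ 'd) \<Rightarrow>\<^sub>0 'k::field) set)"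
  unfolding noetherian_def
proof safe
  let ?K = "range (Poly_Mapping.single 0) :: ((nat ^ 'd) \<Rightarrow>\<^sub>0 'k::field) set"
  fix w :: "nat \<Rightarrow> (nat ^ 'd) \<Rightarrow>\<^sub>0 'k" assume w: "\<forall>k. w k \<in> ?K"
  show "\<exists>k. w k \<in> rspan ?K (w ` {..<k})"
  proof (cases "w 0 = 0")
    case True
    then show ?thesis by (intro exI[of _ 0]) (auto intro: rspan.zero)
  next
    case False
    obtain x y where xy: "w 0 = Poly_Mapping.single 0 x" "w 1 = Poly_Mapping.single 0 y" using w by (meson rangeE)
    have "x \<noteq> 0" using False xy by auto
    then have "w 1 = Poly_Mapping.single 0 (y / x) * w 0 + 0" using xy by (simp add: mult_single)
    also have "\<dots> \<in> rspan ?K (w ` {..<1})" by (intro rspan.step rspan.zero) auto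
    finally show ?thesis by blast
  qed
qed

lemma subring_of_constants: "subring_of (range (Poly_Mapping.single 0) :: ((nat ^ 'd) \<Rightarrow>\<^sub>0 'k::field) set)"
proof
  show "1 \<in> (range (Poly_Mapping.single 0) :: ((nat ^ 'd) \<Rightarrow>\<^sub>0 'k) set)"
    using single_one by (metis rangeI)
  fix p q :: "(nat ^ 'd) \<Rightarrow>\<^sub>0 'k"
  assume "p \<in> range (Poly_Mapping.single 0)" "q \<in> range (Poly_Mapping.single 0)"
  then obtain x y where "p = Poly_Mapping.single 0 x" "q = Poly_Mapping.single 0 y" by blast
  then show "p - q \<in> range (Poly_Mapping.single 0)" "p * q \<in> range (Poly_Mapping.single 0)"
    by (auto simp: single_diff[symmetric] mult_single)
qed

text \<open>The algebra arises from the constants by adjoining the monomials of the generators.\<close>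
lemma noetherian_monoid_algebra:
  fixes T :: "(nat ^ 'd) set"
  assumes T: "submonoid_set T" and "finite G" "G \<subseteq> T"
    and gen: "\<And>T'. submonoid_set T' \<Longrightarrow> G \<subseteq> T' \<Longrightarrow> T \<subseteq> T'"
  shows "noetherian (monoid_algebra T :: ((nat ^ 'd) \<Rightarrow>\<^sub>0 'k::field) set)"
proof -
  let ?K = "range (Poly_Mapping.single 0) :: ((nat ^ 'd) \<Rightarrow>\<^sub>0 'k) set"
  interpret monoid_algebra: subring_of "monoid_algebra T :: ((nat ^ 'd) \<Rightarrow>\<^sub>0 'k) set" by (rule subring_of_monoid_algebra[OF T])
  have "\<exists>A. subring_of A \<and> noetherian A \<and> ?K \<subseteq> A \<and> monomial ` G \<subseteq> A \<and> A \<subseteq> monoid_algebra T"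
    using assms(2,3)
  proof (induction G)
    case empty
    have "?K \<subseteq> monoid_algebra T" using T unfolding monoid_algebra_def submonoid_set_def by (auto split: if_splits)
    then show ?case using subring_of_constants noetherian_constants by blast
  next
    case (insert g G)
    then obtain A where A: "subring_of A" "noetherian A" "?K \<subseteq> A" "monomial ` G \<subseteq> A" "A \<subseteq> monoid_algebra T" by auto
    have g: "monomial g \<in> monoid_algebra T" using insert.prems unfolding monoid_algebra_def by auto
    show ?case
      using A subring_of.subring_of_adjoin[OF A(1), of "monomial g"] subring_of.noetherian_adjoin[OF A(1,2), of "monomial g"]
        adjoin_supset[OF A(1), of "monomial g"] adjoin_subset[OF monoid_algebra.subring_of_axioms A(5) g]
      by (intro exI[of _ "adjoin A (monomial g)"]) auto
  qed
  then obtain A where A: "subring_of A" "noetherian A" "?K \<subseteq> A" "monomial ` G \<subseteq> A" "A \<subseteq> monoid_algebra T" by blast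
  interpret A: subring_of A by fact
  have "submonoid_set {a. monomial a \<in> A}"
    unfolding submonoid_set_def
  proof (intro conjI ballI CollectI)
    fix a b assume ab: "a \<in> {a. monomial a \<in> A}" "b \<in> {a. monomial a \<in> A}"
    have "monomial a * monomial b \<in> A" using ab by (intro A.mult_mem) auto
    then show "monomial (a + b) \<in> A" by (simp add: mult_single)
  qed simp
  then have TA: "T \<subseteq> {a. monomial a \<in> A}" using A(4) by (intro gen) auto
  have "monoid_algebra T \<subseteq> A"
  proof
    fix p :: "(nat ^ 'd) \<Rightarrow>\<^sub>0 'k" assume p: "p \<in> monoid_algebra T"
    have "Poly_Mapping.single c (lookup p c) \<in> A" if "c \<in> keys p" for c
    proof -
      have "Poly_Mapping.single 0 (lookup p c) * monomial c \<in> A"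
        using A(3) TA that p unfolding monoid_algebra_def by (intro A.mult_mem) auto
      then show ?thesis by (simp add: mult_single)
    qed
    then have "(\<Sum>c\<in>keys p. Poly_Mapping.single c (lookup p c)) \<in> A" by (intro A.sum_mem)
    then show "p \<in> A" using sum_of_terms[of p] by simp
  qed
  then show ?thesis using A by simp
qed

definition sqnorm :: "nat ^ 'd \<Rightarrow> nat" where
  "sqnorm a = (\<Sum>i\<in>UNIV. (a $ i) ^ 2)"

text \<open>With \<open>a' = a + \<delta>\<close> and \<open>b' = b - \<delta>\<close> the sums \<open>a' + b\<close> and \<open>a + b'\<close> are \<open>a + b \<plusminus> \<delta>\<close>, and the parallelogram law gives
  the inequality.\<close>
lemma sqnorm_parallelogram:
  fixes a b a' b' :: "nat ^ 'd"
  assumes "a' + b' = a + b" "a' \<noteq> a"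
  shows "2 * sqnorm (a + b) < sqnorm (a' + b) + sqnorm (a + b')"
proof -
  have eq: "a' $ i + b' $ i = a $ i + b $ i" for i using assms(1) by (metis vector_add_component)
  have le: "2 * ((a + b) $ i)\<^sup>2 \<le> ((a' + b) $ i)\<^sup>2 + ((a + b') $ i)\<^sup>2"
    and lt: "a' $ i \<noteq> a $ i \<Longrightarrow> 2 * ((a + b) $ i)\<^sup>2 < ((a' + b) $ i)\<^sup>2 + ((a + b') $ i)\<^sup>2" for i
  proof -
    have b: "int (b $ i) = int (a' $ i) + int (b' $ i) - int (a $ i)" using eq[of i] by linarith
    have id: "(int (a' $ i + b $ i))\<^sup>2 + (int (a $ i + b' $ i))\<^sup>2 =
        2 * (int (a $ i + b $ i))\<^sup>2 + 2 * (int (a' $ i) - int (a $ i))\<^sup>2"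
      unfolding of_nat_add b by (simp add: power2_eq_square algebra_simps)
    have "0 \<le> (int (a' $ i) - int (a $ i))\<^sup>2" by simp
    with id have "2 * (int (a $ i + b $ i))\<^sup>2 \<le> (int (a' $ i + b $ i))\<^sup>2 + (int (a $ i + b' $ i))\<^sup>2" by linarith
    then show "2 * ((a + b) $ i)\<^sup>2 \<le> ((a' + b) $ i)\<^sup>2 + ((a + b') $ i)\<^sup>2"
      unfolding vector_add_component by (simp flip: of_nat_power of_nat_add of_nat_mult add: of_nat_le_iff)
    assume "a' $ i \<noteq> a $ i"
    then have "0 < (int (a' $ i) - int (a $ i))\<^sup>2" by simp
    with id have "2 * (int (a $ i + b $ i))\<^sup>2 < (int (a' $ i + b $ i))\<^sup>2 + (int (a $ i + b' $ i))\<^sup>2" by linarith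
    then show "2 * ((a + b) $ i)\<^sup>2 < ((a' + b) $ i)\<^sup>2 + ((a + b') $ i)\<^sup>2"
      unfolding vector_add_component by (simp flip: of_nat_power of_nat_add of_nat_mult add: of_nat_less_iff)
  qed
  obtain i where "a' $ i \<noteq> a $ i" using assms(2) by (auto simp: vec_eq_iff)
  then show ?thesis
    unfolding sqnorm_def sum_distrib_left sum.distrib[symmetric]
    using le lt by (intro sum_strict_mono_ex1) auto
qed

text \<open>Restriction of the exponents to a face \<open>F\<close> is a homomorphism onto the monoid algebra of \<open>F\<close>, and this algebra is a
  domain. To see that a product of two polynomials with exponents in \<open>F\<close> does not vanish, take exponents \<open>a\<close> and
  \<open>b\<close> of the factors such that \<open>a + b\<close> has maximal Euclidean length: a second decomposition \<open>a' + b'\<close> of this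
  sum would make \<open>a' + b\<close> or \<open>a + b'\<close> longer. So the coefficient at \<open>a + b\<close> is a single product.\<close>
lemma prime_set_face:
  fixes T :: "(nat ^ 'd) set"
  assumes T: "submonoid_set T" and F: "F \<subseteq> T" "0 \<in> F"
    and face: "\<And>a b. a \<in> T \<Longrightarrow> b \<in> T \<Longrightarrow> a + b \<in> F \<longleftrightarrow> a \<in> F \<and> b \<in> F"
  shows "prime_set (monoid_algebra T) {p \<in> monoid_algebra T :: ((nat ^ 'd) \<Rightarrow>\<^sub>0 'k::field) set. keys p \<inter> F = {}}"
    (is "prime_set _ ?P")
proof -
  interpret subring_of "monoid_algebra T :: ((nat ^ 'd) \<Rightarrow>\<^sub>0 'k) set" by (rule subring_of_monoid_algebra[OF T])
  have sum: "p + q \<in> ?P" if "p \<in> ?P" "q \<in> ?P" for p q :: "(nat ^ 'd) \<Rightarrow>\<^sub>0 'k"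
    using that Poly_Mapping.keys_add[of p q] by auto
  have mult: "r * p \<in> ?P" if "r \<in> monoid_algebra T" "p \<in> ?P" for r p :: "(nat ^ 'd) \<Rightarrow>\<^sub>0 'k"
  proof -
    have "c \<notin> F" if "c \<in> keys (r * p)" for c
    proof -
      obtain a b where "c = a + b" "a \<in> keys r" "b \<in> keys p" using keys_mult[of r p] \<open>c \<in> _\<close> by auto
      then show ?thesis using face[of a b] \<open>r \<in> _\<close> \<open>p \<in> _\<close> unfolding monoid_algebra_def by auto
    qed
    then show ?thesis using that by auto
  qed
  have prime: "p \<in> ?P \<or> q \<in> ?P" if p: "p \<in> monoid_algebra T" and q: "q \<in> monoid_algebra T" and pq: "p * q \<in> ?P" for p q :: "(nat ^ 'd) \<Rightarrow>\<^sub>0 'k"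
  proof (rule ccontr)
    assume "\<not> ?thesis"
    then have ne: "keys p \<inter> F \<noteq> {}" "keys q \<inter> F \<noteq> {}" using p q by auto
    let ?X = "(keys p \<inter> F) \<times> (keys q \<inter> F)"
    let ?N = "\<lambda>(a, b). sqnorm (a + b)"
    have "finite (?N ` ?X)" "?N ` ?X \<noteq> {}" using ne by auto
    from Max_in[OF this] obtain a b where ab: "(a, b) \<in> ?X" "sqnorm (a + b) = Max (?N ` ?X)" by auto
    have max: "sqnorm (a' + b') \<le> sqnorm (a + b)" if "a' \<in> keys p \<inter> F" "b' \<in> keys q \<inter> F" for a' b'
      unfolding ab(2) using that by (intro Max_ge) auto
    have "a + b \<in> F" using face[of a b] ab F(1) by auto
    have "lookup (p * q) (a + b) = lookup p a * lookup q b"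
    proof (rule lookup_mult_unique)
      fix a' b' assume ab': "a' \<in> keys p" "b' \<in> keys q" "a' + b' = a + b"
      then have "a' \<in> F" "b' \<in> F" using face[of a' b'] \<open>a + b \<in> F\<close> p q unfolding monoid_algebra_def by auto
      then have "sqnorm (a' + b) \<le> sqnorm (a + b)" "sqnorm (a + b') \<le> sqnorm (a + b)"
        using max ab' ab(1) by auto
      then have "a' = a" using sqnorm_parallelogram[OF ab'(3)] by fastforce
      then show "a' = a \<and> b' = b" using ab'(3) by auto
    qed
    then have "a + b \<in> keys (p * q)" using ab(1) by (auto simp: in_keys_iff)
    then show False using pq \<open>a + b \<in> F\<close> by auto
  qed
  show ?thesis
    unfolding prime_set_def
  proof (intro conjI)
    show "?P \<subseteq> monoid_algebra T" "0 \<in> ?P" by auto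
    show "1 \<notin> ?P" using F(2) by auto
    show "\<forall>p\<in>?P. \<forall>q\<in>?P. p + q \<in> ?P" using sum by blast
    show "\<forall>r\<in>monoid_algebra T. \<forall>p\<in>?P. r * p \<in> ?P" using mult by blast
    show "\<forall>p\<in>monoid_algebra T. \<forall>q\<in>monoid_algebra T. p * q \<in> ?P \<longrightarrow> p \<in> ?P \<or> q \<in> ?P" using prime by blast
  qed
qed

section \<open>Coordinates on a simplicial cone\<close>

definition int_to_rat_vec :: "int ^ 'd \<Rightarrow> rat ^ 'd" where
  "int_to_rat_vec a = (\<chi> i. of_int (a $ i))"

lemma int_to_rat_vec_simps:
  "int_to_rat_vec (a - b) = int_to_rat_vec a - int_to_rat_vec b"
  "int_to_rat_vec (int_vec c) = rat_vec c"
  "int_to_rat_vec (n *s a) = of_int n *s int_to_rat_vec a"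
  "int_to_rat_vec 0 = 0"
  "int_to_rat_vec (a + b) = int_to_rat_vec a + int_to_rat_vec b"
  unfolding int_to_rat_vec_def rat_vec_def int_vec_def by (auto simp: vec_eq_iff)

lemma int_to_rat_vec_sum: "int_to_rat_vec (\<Sum>i\<in>I. f i) = (\<Sum>i\<in>I. int_to_rat_vec (f i))"
  by (induction I rule: infinite_finite_induct) (auto simp: int_to_rat_vec_simps)

lemma inj_int_to_rat_vec: "inj int_to_rat_vec"
  by (auto simp: inj_def int_to_rat_vec_def vec_eq_iff)

lemma inj_rat_vec: "inj rat_vec"
  by (auto simp: inj_def rat_vec_def vec_eq_iff)

lemma common_denominator:
  fixes q :: "'a \<Rightarrow> rat"
  assumes "finite B"
  shows "\<exists>n::int. n > 0 \<and> (\<forall>b\<in>B. \<exists>z. of_int n * q b = of_int z)"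
  using assms
proof (induction B)
  case empty
  show ?case by (intro exI[of _ 1]) auto
next
  case (insert b B)
  then obtain n :: int where n: "n > 0" "\<forall>b\<in>B. \<exists>z. of_int n * q b = of_int z" by auto
  obtain x y where xy: "q b = Fract x y" "y > 0" by (cases "q b") auto
  then have qb: "of_int y * q b = of_int x" by (simp add: Fract_of_int_quotient)
  have "\<exists>z. of_int (n * y) * q c = of_int z" if "c \<in> insert b B" for c
  proof (cases "c = b")
    case True
    then have "of_int (n * y) * q c = of_int (n * x)" using qb by (simp add: mult.assoc)
    then show ?thesis by blast
  next
    case False
    then have "c \<in> B" using that by simp
    then obtain z where "of_int n * q c = of_int z" using n(2) by blast
    then have "of_int (n * y) * q c = of_int (z * y)" by (simp add: algebra_simps)
    then show ?thesis by blast
  qed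
  then show ?case using n xy by (intro exI[of _ "n * y"]) auto
qed

lemma int_independent_imp_independent:
  fixes B :: "(int ^ 'd) set"
  assumes "int_independent B"
  shows "vec.independent (int_to_rat_vec ` B)"
proof
  have fin: "finite B" using assms unfolding int_independent_def by auto
  assume "vec.dependent (int_to_rat_vec ` B)"
  then obtain u where u: "\<exists>v\<in>int_to_rat_vec ` B. u v \<noteq> 0" "(\<Sum>v\<in>int_to_rat_vec ` B. u v *s v) = 0"
    using vec.dependent_finite[of "int_to_rat_vec ` B"] fin by blast
  define q where "q b = u (int_to_rat_vec b)" for b
  have sum: "(\<Sum>b\<in>B. q b *s int_to_rat_vec b) = 0"
    using u(2) unfolding q_def
    by (subst (asm) sum.reindex) (auto intro: inj_on_subset[OF inj_int_to_rat_vec])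
  obtain n :: int where n: "n > 0" "\<forall>b\<in>B. \<exists>z. of_int n * q b = of_int z"
    using common_denominator[OF fin] by blast
  then obtain z where z: "\<And>b. b \<in> B \<Longrightarrow> of_int n * q b = of_int (z b)" by metis
  have "int_to_rat_vec (\<Sum>b\<in>B. z b *s b) = (\<Sum>b\<in>B. of_int n *s (q b *s int_to_rat_vec b))"
    unfolding int_to_rat_vec_sum int_to_rat_vec_simps
    by (intro sum.cong) (auto simp: z vec.scale_scale)
  also have "\<dots> = 0" unfolding vec.scale_sum_right[symmetric] sum by simp
  finally have "(\<Sum>b\<in>B. z b *s b) = 0"
    using inj_int_to_rat_vec int_to_rat_vec_simps(4) by (metis injD)
  then have "\<forall>b\<in>B. z b = 0" using assms unfolding int_independent_def by blast
  then have "\<forall>b\<in>B. q b = 0" using z n(1) by force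
  then show False using u(1) unfolding q_def by auto
qed

lemma int_independent_card:
  fixes B :: "(int ^ 'd) set"
  assumes "int_independent B"
  shows "card B \<le> CARD('d)"
proof -
  have "card B = card (int_to_rat_vec ` B)"
    by (rule card_image[symmetric]) (rule inj_on_subset[OF inj_int_to_rat_vec], simp)
  also have "\<dots> \<le> vec.dim (UNIV :: (rat ^ 'd) set)"
    by (rule vec.independent_card_le_dim[OF subset_UNIV int_independent_imp_independent[OF assms]])
  finally show ?thesis unfolding vec_dim_card .
qed

lemma int_rank_attained: "\<exists>B\<subseteq>G. int_independent B \<and> card B = int_rank (G :: (int ^ 'd) set)"
proof -
  let ?X = "{card B | B. B \<subseteq> G \<and> int_independent B}"
  have "?X \<subseteq> {..CARD('d)}" using int_independent_card by auto
  then have "finite ?X" by (rule finite_subset) simp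
  moreover have "0 \<in> ?X" by (auto simp: int_independent_def intro!: exI[of _ "{}"])
  ultimately have "Max ?X \<in> ?X" by (intro Max_in) auto
  then show ?thesis unfolding int_rank_def by auto
qed

lemma rat_cone_subset_span: "rat_cone B \<subseteq> vec.span (rat_vec ` B)"
  unfolding rat_cone_def by (auto intro!: vec.span_sum intro: vec.span_scale vec.span_base)

lemma rat_cone_self: "b \<in> B \<Longrightarrow> rat_vec b \<in> rat_cone B"
  unfolding rat_cone_def by (intro CollectI exI[of _ "{b}"] exI[of _ "\<lambda>_. 1"]) auto

lemma rat_cone_nonneg:
  fixes B :: "(nat ^ 'd) set"
  assumes "v \<in> rat_cone B"
  shows "0 \<le> v $ i"
  using assms unfolding rat_cone_def by (auto simp: rat_vec_def intro!: sum_nonneg)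

text \<open>By the rank condition the group of \<open>S\<close> contains \<open>d\<close> independent vectors, so \<open>S\<close> spans \<open>\<rat>\<^sup>d\<close>, and so do the \<open>d\<close>
  extremal rays; hence they are a basis. The functionals \<open>lam j\<close> are the coordinates in this basis, and the cone
  generated by a basis consists of the vectors with nonnegative coordinates.\<close>
theorem simplicial_coordinates:
  fixes S :: "(nat ^ 'd) set"
  assumes "simplicial S"
  obtains a :: "nat \<Rightarrow> nat ^ 'd" and lam :: "nat \<Rightarrow> rat ^ 'd \<Rightarrow> rat" where
    "\<And>j. j < CARD('d) \<Longrightarrow> a j \<in> S"
    "\<And>j v w. lam j (v + w) = lam j v + lam j w"
    "\<And>j c v. lam j (c *s v) = c * lam j v"
    "\<And>j k. j < CARD('d) \<Longrightarrow> k < CARD('d) \<Longrightarrow> lam j (rat_vec (a k)) = (if j = k then 1 else 0)"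
    "\<And>v. v = (\<Sum>j<CARD('d). lam j v *s rat_vec (a j))"
    "rat_cone S = {v. \<forall>j<CARD('d). 0 \<le> lam j v}"
proof -
  obtain B where B: "finite B" "B \<subseteq> S" "rat_cone B = rat_cone S" "card B = CARD('d)"
    and rank: "int_rank (group_of S) = CARD('d)"
    using assms unfolding simplicial_def extremal_rays_def by auto
  let ?B = "rat_vec ` B"
  have inj: "inj_on rat_vec B" by (rule inj_on_subset[OF inj_rat_vec]) simp
  obtain C where C: "C \<subseteq> group_of S" "int_independent C" "card C = CARD('d)"
    using int_rank_attained[of "group_of S"] rank by auto
  have "card (int_to_rat_vec ` C) = CARD('d)"
    using C(3) card_image[OF inj_on_subset[OF inj_int_to_rat_vec], of C] by simp
  then have "UNIV \<subseteq> vec.span (int_to_rat_vec ` C)"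
    by (intro vec.card_ge_dim_independent int_independent_imp_independent C) (simp_all only: vec_dim_card subset_UNIV order_refl)
  moreover have "int_to_rat_vec ` C \<subseteq> vec.span ?B"
  proof safe
    fix c assume "c \<in> C"
    then obtain x y where "c = int_vec x - int_vec y" "x \<in> S" "y \<in> S"
      using C(1) unfolding group_of_def by blast
    moreover from this have "rat_vec x \<in> vec.span ?B" "rat_vec y \<in> vec.span ?B"
      using rat_cone_self[of _ S] rat_cone_subset_span[of B] B(3) by auto
    ultimately show "int_to_rat_vec c \<in> vec.span ?B"
      by (simp add: int_to_rat_vec_simps vec.span_diff)
  qed
  ultimately have span: "vec.span ?B = UNIV"
    using vec.span_minimal[OF _ vec.subspace_span] by blast
  have ind: "vec.independent ?B"
  proof (rule vec.card_le_dim_spanning[of _ UNIV])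
    show "card ?B \<le> vec.dim (UNIV :: (rat ^ 'd) set)"
      unfolding vec_dim_card using B(4) card_image[OF inj] by simp
  qed (use span B(1) in auto)
  obtain a where a: "bij_betw a {..<CARD('d)} B"
    using ex_bij_betw_nat_finite[OF B(1)] B(4) by (metis atLeast0LessThan)
  define lam where "lam j v = vec.representation ?B v (rat_vec (a j))" for j v
  have aB: "a j \<in> B" if "j < CARD('d)" for j using a that unfolding bij_betw_def by auto
  show ?thesis
  proof
    show "a j \<in> S" if "j < CARD('d)" for j using aB[OF that] B(2) by auto
    show add: "lam j (v + w) = lam j v + lam j w" for j v w
      unfolding lam_def by (subst vec.representation_add[OF ind]) (auto simp: span)
    show scale: "lam j (c *s v) = c * lam j v" for j c v
      unfolding lam_def by (subst vec.representation_scale[OF ind]) (auto simp: span)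
    show basis: "lam j (rat_vec (a k)) = (if j = k then 1 else 0)" if "j < CARD('d)" "k < CARD('d)" for j k
    proof -
      have "rat_vec (a j) = rat_vec (a k) \<longleftrightarrow> j = k"
        using a that inj_rat_vec unfolding bij_betw_def inj_on_def inj_def by blast
      then show ?thesis unfolding lam_def using aB[OF that(2)]
        by (subst vec.representation_basis[OF ind]) auto
    qed
    show expand: "v = (\<Sum>j<CARD('d). lam j v *s rat_vec (a j))" for v
    proof -
      have "v = (\<Sum>b\<in>?B. vec.representation ?B v b *s b)"
        using B(1) by (subst vec.sum_representation_eq[OF ind]) (auto simp: span)
      also have "\<dots> = (\<Sum>b\<in>B. vec.representation ?B v (rat_vec b) *s rat_vec b)"
        by (subst sum.reindex[OF inj]) simp
      also have "\<dots> = (\<Sum>j<CARD('d). lam j v *s rat_vec (a j))"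
        unfolding lam_def by (rule sum.reindex_bij_betw[OF a, symmetric])
      finally show ?thesis .
    qed
    have lam0: "lam j 0 = 0" for j using scale[of j 0 0] by simp
    have lam_sum: "lam j (\<Sum>b\<in>F. f b) = (\<Sum>b\<in>F. lam j (f b))" if "finite F" for j F and f :: "nat ^ 'd \<Rightarrow> rat ^ 'd"
      using that by (induction F) (auto simp: add lam0)
    have "0 \<le> lam j v" if v: "v \<in> rat_cone B" and j: "j < CARD('d)" for v j
    proof -
      obtain F q where F: "v = (\<Sum>b\<in>F. q b *s rat_vec b)" "finite F" "F \<subseteq> B" "\<forall>b\<in>F. 0 \<le> q b"
        using v unfolding rat_cone_def by blast
      have "0 \<le> lam j (rat_vec b)" if "b \<in> F" for b
      proof -
        have "b \<in> a ` {..<CARD('d)}" using a that F(3) unfolding bij_betw_def by auto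
        then show ?thesis using basis[OF j] by auto
      qed
      then show ?thesis unfolding F(1) lam_sum[OF F(2)] scale using F(4) by (auto intro!: sum_nonneg)
    qed
    moreover have "v \<in> rat_cone B" if v: "\<forall>j<CARD('d). 0 \<le> lam j v" for v
    proof -
      have "v = (\<Sum>b\<in>B. vec.representation ?B v (rat_vec b) *s rat_vec b)"
        using expand[of v] unfolding lam_def
        by (subst (asm) sum.reindex_bij_betw[OF a, of "\<lambda>b. vec.representation ?B v (rat_vec b) *s rat_vec b"])
      moreover have "0 \<le> vec.representation ?B v (rat_vec b)" if "b \<in> B" for b
      proof -
        have "b \<in> a ` {..<CARD('d)}" using a that unfolding bij_betw_def by auto
        then show ?thesis using v unfolding lam_def by auto
      qed
      ultimately show ?thesis unfolding rat_cone_def using B(1)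
        by (intro CollectI exI[of _ B] exI[of _ "\<lambda>b. vec.representation ?B v (rat_vec b)"]) auto
    qed
    ultimately show "rat_cone S = {v. \<forall>j<CARD('d). 0 \<le> lam j v}" unfolding B(3)[symmetric] by auto
  qed
qed

section \<open>Buchsbaum simplicial semigroups\<close>

text \<open>The coordinates of the preceding theorem are parameters here. The parameter \<open>K\<close> only fixes the coefficient
  field.\<close>
locale simplicial_C_semigroup =
  fixes S :: "(nat ^ 'd) set" and a :: "nat \<Rightarrow> nat ^ 'd" and lam :: "nat \<Rightarrow> rat ^ 'd \<Rightarrow> rat"
    and d :: nat and K :: "'k::field itself"
  assumes C_semigroup: "C_semigroup S" and d_eq: "d = CARD('d)" and dim_gt_1: "d > 1"
    and a_in_S: "\<And>j. j < d \<Longrightarrow> a j \<in> S"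
    and lam_add: "\<And>j v w. lam j (v + w) = lam j v + lam j w"
    and lam_scale: "\<And>j c v. lam j (c *s v) = c * lam j v"
    and lam_a: "\<And>j k. j < d \<Longrightarrow> k < d \<Longrightarrow> lam j (rat_vec (a k)) = (if j = k then 1 else 0)"
    and lam_expand: "\<And>v. v = (\<Sum>j<d. lam j v *s rat_vec (a j))"
    and cone_eq: "rat_cone S = {v. \<forall>j<d. 0 \<le> lam j v}"
begin

abbreviation C :: "(nat ^ 'd) set" where "C \<equiv> integer_cone S"

definition coord :: "nat \<Rightarrow> nat ^ 'd \<Rightarrow> rat" where
  "coord j c = lam j (rat_vec c)"

lemma rat_vec_add: "rat_vec (x + y) = rat_vec x + rat_vec y"
  by (simp add: rat_vec_def vec_eq_iff)

lemma rat_vec_smult: "rat_vec (n *s x) = of_nat n *s rat_vec x"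
  by (simp add: rat_vec_def vec_eq_iff)

lemma coord_add: "coord j (x + y) = coord j x + coord j y"
  unfolding coord_def rat_vec_add lam_add ..

lemma coord_smult: "coord j (n *s x) = of_nat n * coord j x"
  unfolding coord_def rat_vec_smult lam_scale ..

lemma coord_a: "j < d \<Longrightarrow> k < d \<Longrightarrow> coord j (a k) = (if j = k then 1 else 0)"
  unfolding coord_def by (rule lam_a)

lemma C_iff: "c \<in> C \<longleftrightarrow> (\<forall>j<d. 0 \<le> coord j c)"
  unfolding integer_cone_def coord_def cone_eq by simp

lemma coord_0: "coord j 0 = 0"
  using coord_add[of j 0 0] by simp

lemma coord_eq_0: "(\<And>j. j < d \<Longrightarrow> coord j c = 0) \<Longrightarrow> c = 0"
proof -
  assume "\<And>j. j < d \<Longrightarrow> coord j c = 0"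
  then have "rat_vec c = 0" using lam_expand[of "rat_vec c"] unfolding coord_def by simp
  then show "c = 0" by (simp add: rat_vec_def vec_eq_iff)
qed

lemma submonoid_S: "submonoid_set S" and S_sub_C: "S \<subseteq> C" and finite_gaps: "finite (gaps S)"
  using C_semigroup rat_cone_self[of _ S]
  unfolding C_semigroup_def affine_semigroup_def submonoid_set_def integer_cone_def gaps_def by auto

lemma submonoid_C: "submonoid_set C"
  unfolding submonoid_set_def by (auto simp: C_iff coord_add coord_0)

lemma zero_S: "0 \<in> S" and add_S: "x \<in> S \<Longrightarrow> y \<in> S \<Longrightarrow> x + y \<in> S"
  using submonoid_S unfolding submonoid_set_def by auto

lemma smult_S: "x \<in> S \<Longrightarrow> n *s x \<in> S" for n :: nat
proof (induction n)
  case 0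
  have "0 *s x = 0" by (simp add: vec_eq_iff)
  then show ?case using zero_S by simp
next
  case (Suc n)
  have "Suc n *s x = x + n *s x" by (simp add: vec_eq_iff)
  then show ?case using Suc add_S by auto
qed

text \<open>The coordinates of \<open>c - n a\<^sub>j\<close> are nonnegative, so this vector is in the rational cone; hence its entries are
  nonnegative, and the subtraction takes place in \<open>\<nat>\<^sup>d\<close>.\<close>
lemma subtract:
  assumes "c \<in> C" "j < d" "of_nat n \<le> coord j c"
  shows "\<exists>e\<in>C. c = n *s a j + e"
proof -
  let ?v = "rat_vec c - rat_vec (n *s a j)"
  have diff: "lam i ?v = coord i c - coord i (n *s a j)" for i
    using lam_add[of i ?v "rat_vec (n *s a j)"] unfolding coord_def by simp
  have "0 \<le> lam i ?v" if "i < d" for i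
    using assms that C_iff unfolding diff coord_smult by (auto simp: coord_a)
  then have v: "?v \<in> rat_cone S" unfolding cone_eq by simp
  have le: "(n *s a j) $ i \<le> c $ i" for i
    using rat_cone_nonneg[OF v, of i] by (simp add: rat_vec_def flip: of_nat_mult)
  define e where "e = (\<chi> i. c $ i - (n *s a j) $ i)"
  have ce: "c = n *s a j + e" unfolding e_def using le by (simp add: vec_eq_iff)
  then have "rat_vec e = ?v" by (simp add: rat_vec_add)
  then have "e \<in> C" using v unfolding integer_cone_def by simp
  then show ?thesis using ce by blast
qed

lemma gaps_bounded: "\<exists>N::nat. \<forall>h\<in>gaps S. \<forall>j<d. coord j h < of_nat N"
proof -
  let ?V = "(\<lambda>(h, j). coord j h) ` (gaps S \<times> {..<d})"
  have fin: "finite ?V" using finite_gaps by simp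
  obtain N :: nat where N: "Max (insert 0 ?V) < of_nat N" using reals_Archimedean2 by blast
  have "coord j h < of_nat N" if "h \<in> gaps S" "j < d" for h j
  proof -
    have "coord j h \<le> Max (insert 0 ?V)" using that fin by (intro Max_ge) force+
    then show ?thesis using N by simp
  qed
  then show ?thesis by blast
qed

text \<open>The monoid \<open>C\<close> is finitely generated because adding the finitely many gaps to generators of \<open>S\<close> gives generators.\<close>
lemma noetherian_KS: "noetherian (monoid_algebra S :: ((nat ^ 'd) \<Rightarrow>\<^sub>0 'k) set)"
  and noetherian_KC: "noetherian (monoid_algebra C :: ((nat ^ 'd) \<Rightarrow>\<^sub>0 'k) set)"
proof -
  obtain A where A: "finite A" "A \<subseteq> S" "\<And>s. s \<in> S \<Longrightarrow> \<exists>c :: nat ^ 'd \<Rightarrow> nat. s = (\<Sum>x\<in>A. c x *s x)"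
    using C_semigroup unfolding C_semigroup_def affine_semigroup_def by blast
  have gen: "S \<subseteq> T" if T: "submonoid_set T" and AT: "A \<subseteq> T" for T
  proof
    have mult: "n *s x \<in> T" if "x \<in> T" for n :: nat and x
    proof (induction n)
      case 0
      have "0 *s x = 0" by (simp add: vec_eq_iff)
      then show ?case using T unfolding submonoid_set_def by simp
    next
      case (Suc n)
      have "Suc n *s x = x + n *s x" by (simp add: vec_eq_iff)
      then show ?case using Suc \<open>x \<in> T\<close> T unfolding submonoid_set_def by auto
    qed
    have sum: "(\<Sum>x\<in>I. f x) \<in> T" if "\<And>x. x \<in> I \<Longrightarrow> f x \<in> T" for I and f :: "nat ^ 'd \<Rightarrow> nat ^ 'd"
      using that T unfolding submonoid_set_def by (induction I rule: infinite_finite_induct) auto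
    fix s assume "s \<in> S"
    then obtain c where "s = (\<Sum>x\<in>A. c x *s x)" using A(3) by blast
    then show "s \<in> T" using AT mult by (auto intro!: sum)
  qed
  show "noetherian (monoid_algebra S :: ((nat ^ 'd) \<Rightarrow>\<^sub>0 'k) set)"
    by (rule noetherian_monoid_algebra[OF submonoid_S A(1,2) gen])
  show "noetherian (monoid_algebra C :: ((nat ^ 'd) \<Rightarrow>\<^sub>0 'k) set)"
  proof (rule noetherian_monoid_algebra[OF submonoid_C])
    show "finite (A \<union> gaps S)" "A \<union> gaps S \<subseteq> C" using A S_sub_C finite_gaps by (auto simp: gaps_def)
    show "C \<subseteq> T" if "submonoid_set T" "A \<union> gaps S \<subseteq> T" for T
      using gen[OF that(1)] that(2) unfolding gaps_def by auto
  qed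
qed

abbreviation KS :: "((nat ^ 'd) \<Rightarrow>\<^sub>0 'k) set" where "KS \<equiv> monoid_algebra S"
abbreviation KC :: "((nat ^ 'd) \<Rightarrow>\<^sub>0 'k) set" where "KC \<equiv> monoid_algebra C"

definition M :: "((nat ^ 'd) \<Rightarrow>\<^sub>0 'k) set" where "M = {p \<in> KS. lookup p 0 \<noteq> 0}"
definition P :: "((nat ^ 'd) \<Rightarrow>\<^sub>0 'k) set" where "P = {p \<in> KS. lookup p 0 = 0}"

lemma KS_sub_KC: "KS \<subseteq> KC"
  using S_sub_C unfolding monoid_algebra_def by auto

text \<open>The ring \<open>A.L\<close> is the localization of \<open>K[S]\<close> at its maximal homogeneous ideal, while \<open>B\<close> concerns \<open>K[C]\<close> with the
  same denominators.\<close>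
sublocale A: fractions_of KS M
proof -
  interpret subring_of KS by (rule subring_of_monoid_algebra[OF submonoid_S])
  show "fractions_of KS M" by unfold_locales (auto simp: M_def lookup_mult_0)
qed

sublocale B: fractions_of KC M
proof -
  interpret subring_of KC by (rule subring_of_monoid_algebra[OF submonoid_C])
  show "fractions_of KC M"
    using A.M_one A.M_mult A.M_sub KS_sub_KC by unfold_locales auto
qed

text \<open>The faces spanned by \<open>a i, \<dots>, a (d - 1)\<close>, a decreasing chain from \<open>S\<close> to \<open>{0}\<close>.\<close>
definition face :: "nat \<Rightarrow> (nat ^ 'd) set" where
  "face i = {s \<in> S. \<forall>j<i. coord j s = 0}"

definition face_prime :: "nat \<Rightarrow> ((nat ^ 'd) \<Rightarrow>\<^sub>0 'k) set" where
  "face_prime i = {p \<in> KS. keys p \<inter> face i = {}}"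

lemma coord_nonneg: "s \<in> S \<Longrightarrow> j < d \<Longrightarrow> 0 \<le> coord j s"
  using S_sub_C C_iff by blast

lemma prime_face_prime: "i \<le> d \<Longrightarrow> prime_set KS (face_prime i)"
  unfolding face_prime_def
proof (rule prime_set_face[OF submonoid_S])
  show "face i \<subseteq> S" "0 \<in> face i" unfolding face_def using zero_S by (auto simp: coord_0)
  fix x y assume "x \<in> S" "y \<in> S" "i \<le> d"
  then have "coord j x + coord j y = 0 \<longleftrightarrow> coord j x = 0 \<and> coord j y = 0" if "j < i" for j
    using coord_nonneg that by (intro add_nonneg_eq_0_iff) auto
  then show "x + y \<in> face i \<longleftrightarrow> x \<in> face i \<and> y \<in> face i"
    using \<open>x \<in> S\<close> \<open>y \<in> S\<close> add_S unfolding face_def by (auto simp: coord_add)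
qed

lemma face_prime_d: "face_prime d = P"
proof -
  have "face d = {0}" unfolding face_def using coord_eq_0 zero_S by (auto simp: coord_0)
  then show ?thesis unfolding face_prime_def P_def by (auto simp: in_keys_iff)
qed

lemma prime_P: "prime_set KS P"
  using prime_face_prime[of d] face_prime_d by simp

lemma face_prime_M: "face_prime i \<inter> M = {}"
proof -
  have "0 \<in> face i" unfolding face_def using zero_S by (auto simp: coord_0)
  then show ?thesis unfolding face_prime_def M_def by (auto simp: in_keys_iff)
qed

lemma face_prime_strict: "i < d \<Longrightarrow> face_prime i \<subset> face_prime (Suc i)"
proof -
  assume i: "i < d"
  have "face_prime i \<subseteq> face_prime (Suc i)" unfolding face_prime_def face_def by auto
  moreover have "monomial (a i) \<in> face_prime (Suc i)" "monomial (a i) \<notin> face_prime i"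
    using a_in_S[OF i] i unfolding face_prime_def face_def monoid_algebra_def by (auto simp: coord_a)
  ultimately show ?thesis by auto
qed

lemma krull_dim_A: "krull_dim A.L = enat d"
proof (rule A.krull_dim_L[where Q = face_prime])
  fix n and Q :: "nat \<Rightarrow> ((nat ^ 'd) \<Rightarrow>\<^sub>0 'k) set"
  assume "\<And>i. i \<le> n \<Longrightarrow> prime_set KS (Q i)" "\<And>i. i < n \<Longrightarrow> Q i \<subset> Q (Suc i)"
  then show "n \<le> d"
    unfolding d_eq using zero_S by (intro no_long_prime_chain[OF A.subring_of_axioms, of n Q]) (auto simp: monoid_algebra_def)
qed (use prime_face_prime face_prime_M face_prime_strict in auto)

lemma M_eq: "M = KS - P"
  unfolding M_def P_def by auto

lemma local_A: "noetherian_local_ring A.L m \<longleftrightarrow> m = A.ext P"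
  unfolding noetherian_local_ring_def
  using A.cring_L A.noetherian_L[OF noetherian_KS] A.local_L[OF prime_P M_eq] by blast

lemma max_homogeneous_ideal_eq: "max_homogeneous_ideal S = P"
proof -
  have sub: "(monomial ` (S - {0}) :: ((nat ^ 'd) \<Rightarrow>\<^sub>0 'k) set) \<subseteq> KS" by (auto simp: monoid_algebra_def)
  have "max_homogeneous_ideal S = genideal (subring_record KS) (monomial ` (S - {0}))"
    unfolding max_homogeneous_ideal_def semigroup_ring_def subring_record_def monoid_algebra_def ..
  also have "\<dots> = rspan KS (monomial ` (S - {0}))" by (rule A.genideal_subring_record[OF sub])
  also have "\<dots> = P"
  proof (rule Set.set_eqI)
    fix p :: "(nat ^ 'd) \<Rightarrow>\<^sub>0 'k"
    have "(\<exists>e\<in>S - {0}. \<exists>t\<in>S. c = e + t) \<longleftrightarrow> c \<in> S \<and> c \<noteq> 0" for c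
    proof
      assume "\<exists>e\<in>S - {0}. \<exists>t\<in>S. c = e + t"
      then obtain e t where et: "c = e + t" "e \<in> S" "e \<noteq> 0" "t \<in> S" by blast
      have "e + t \<noteq> 0" using et(3) by (auto simp: vec_eq_iff)
      then show "c \<in> S \<and> c \<noteq> 0" using et add_S by simp
    next
      assume "c \<in> S \<and> c \<noteq> 0"
      then show "\<exists>e\<in>S - {0}. \<exists>t\<in>S. c = e + t" using zero_S by (intro bexI[of _ c] bexI[of _ 0]) auto
    qed
    then show "p \<in> rspan KS (monomial ` (S - {0})) \<longleftrightarrow> p \<in> P"
      unfolding rspan_monomials[OF submonoid_S Diff_subset] unfolding P_def monoid_algebra_def
      by (auto simp: in_keys_iff)
  qed
  finally show ?thesis .
qed

lemma localization_eq: "localization_at (semigroup_ring S) (max_homogeneous_ideal S) = A.L"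
proof -
  have "semigroup_ring S = subring_record KS"
    unfolding semigroup_ring_def subring_record_def monoid_algebra_def ..
  moreover have "carrier (subring_record KS) - P = M" unfolding M_eq subring_record_def by simp
  ultimately show ?thesis unfolding localization_at_def max_homogeneous_ideal_eq A.L_def by simp
qed

lemma buchsbaum_iff:
  "buchsbaum_semigroup K S \<longleftrightarrow>
     (\<forall>xs. system_of_parameters A.L (A.ext P) xs \<longrightarrow> weak_regular_sequence A.L (A.ext P) xs)"
  unfolding buchsbaum_semigroup_def localization_eq buchsbaum_ring_def local_A by auto

lemma monomial_mem_P: "s \<in> S \<Longrightarrow> s \<noteq> 0 \<Longrightarrow> monomial s \<in> P"
  unfolding P_def monoid_algebra_def by (auto simp: lookup_single)

lemma monomial_power: "(monomial c :: (nat ^ 'd) \<Rightarrow>\<^sub>0 'k) ^ n = monomial (n *s c)"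
proof (induction n)
  case 0
  have "0 *s c = 0" by (simp add: vec_eq_iff)
  then show ?case by simp
next
  case (Suc n)
  have "c + n *s c = Suc n *s c" by (simp add: vec_eq_iff)
  then show ?case using Suc by (simp add: mult_single)
qed

lemma a_nonzero: "j < d \<Longrightarrow> a j \<noteq> 0"
  using coord_a[of j j] coord_0[of j] by auto

lemma extP_iff: "p \<in> KS \<Longrightarrow> s \<in> M \<Longrightarrow> A.frac_of p s \<in> A.ext P \<longleftrightarrow> p \<in> P"
  by (rule A.ext_prime_iff[OF prime_P]) (use M_eq in auto)

text \<open>Let \<open>c\<close> be an exponent of \<open>r\<close>. If \<open>n\<^sub>k a\<^sub>k + c\<close> is in \<open>n\<^sub>j a\<^sub>j + C\<close> for some \<open>j \<noteq> k\<close>, then the \<open>j\<close>-th coordinate of \<open>c\<close> is at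
  least \<open>n\<^sub>j\<close>, because adding \<open>n\<^sub>k a\<^sub>k\<close> does not change it. So \<open>c\<close> is in \<open>n\<^sub>j a\<^sub>j + C\<close> already.\<close>
lemma monomials_regular:
  "B.regular_seq (map (\<lambda>j. monomial (n j *s a j)) [0..<d])"
  unfolding B.regular_seq_def
proof (intro allI impI ballI)
  let ?ys = "map (\<lambda>j. monomial (n j *s a j)) [0..<d] :: ((nat ^ 'd) \<Rightarrow>\<^sub>0 'k) list"
  fix k r assume k: "k < length ?ys" and r: "r \<in> KC" and yr: "?ys ! k * r \<in> rspan KC (set (take k ?ys))"
  let ?E = "(\<lambda>j. n j *s a j) ` {..<k}"
  have kd: "k < d" using k by simp
  have set: "set (take k ?ys) = monomial ` ?E"
    using kd by (auto simp: take_map image_image)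
  have E: "?E \<subseteq> C" using kd a_in_S smult_S S_sub_C by auto
  have "\<exists>e\<in>?E. \<exists>t\<in>C. c = e + t" if c: "c \<in> keys r" for c
  proof -
    have cC: "c \<in> C" using r c unfolding monoid_algebra_def by auto
    have "n k *s a k + c \<in> keys (?ys ! k * r)" using kd c by (simp add: keys_single_mult)
    then obtain j t where j: "j < k" "t \<in> C" "n k *s a k + c = n j *s a j + t"
      using yr unfolding set rspan_monomials[OF submonoid_C E] by blast
    have "coord j c = coord j (n k *s a k + c)" using j(1) kd by (simp add: coord_add coord_smult coord_a)
    also have "\<dots> = of_nat (n j) + coord j t" unfolding j(3) using j(1) kd by (simp add: coord_add coord_smult coord_a)
    finally have "of_nat (n j) \<le> coord j c" using j kd C_iff by auto
    from subtract[OF cC _ this] j(1) kd show ?thesis by auto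
  qed
  then show "r \<in> rspan KC (set (take k ?ys))"
    unfolding set rspan_monomials[OF submonoid_C E] by blast
qed

text \<open>A system of parameters \<open>f\<^sub>i / g\<^sub>i\<close> of the localization is regular over \<open>K[C]\<close> up to denominators, because its ideal
  contains powers of the monomials of the \<open>a\<^sub>j\<close>. Since all gaps are pseudo-Frobenius, elements of the maximal ideal
  multiply coefficients from \<open>K[C]\<close> into \<open>K[S]\<close>.\<close>
lemma buchsbaum_if:
  assumes gaps: "gaps S \<subseteq> pseudo_frobenius S"
  shows "buchsbaum_semigroup K S"
  unfolding buchsbaum_iff
proof (intro allI impI)
  fix xs assume sop: "system_of_parameters A.L (A.ext P) xs"
  then have len: "length xs = d" and xsP: "set xs \<subseteq> A.ext P"
    and rad: "ideal_radical A.L (genideal A.L (set xs)) = A.ext P"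
    unfolding system_of_parameters_def krull_dim_A by auto
  \<comment> \<open>The maximal ideal is even an ideal of \<open>K[C]\<close>, and its elements are in the Jacobson radical of the localization of \<open>K[C]\<close>.\<close>
  have absorb: "q * r \<in> P" if q: "q \<in> P" and r: "r \<in> KC" for q r
  proof -
    have "c \<in> S" if "c \<in> keys (q * r)" for c
    proof -
      obtain s t where st: "c = s + t" "s \<in> keys q" "t \<in> keys r" using keys_mult[of q r] \<open>c \<in> _\<close> by auto
      then have s: "s \<in> S - {0}" and t: "t \<in> C" using q r unfolding P_def monoid_algebra_def by (auto simp: in_keys_iff)
      show ?thesis
      proof (cases "t \<in> S")
        case True then show ?thesis using s add_S st by auto
      next
        case False
        then have "t \<in> pseudo_frobenius S" using gaps t unfolding gaps_def by auto
        then have "t + s \<in> S" using s unfolding pseudo_frobenius_def by auto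
        then show ?thesis using st by (simp add: add.commute)
      qed
    qed
    then show ?thesis using q unfolding P_def monoid_algebra_def by (auto simp: lookup_mult_0)
  qed
  have "\<exists>f s. f \<in> P \<and> s \<in> M \<and> xs ! i = A.frac_of f s" if "i < d" for i
  proof -
    have "xs ! i \<in> A.ext P" using xsP len that nth_mem by blast
    then show ?thesis unfolding A.ext_def by blast
  qed
  then obtain f g where f: "\<And>i. i < d \<Longrightarrow> f i \<in> P" and g: "\<And>i. i < d \<Longrightarrow> g i \<in> M"
    and xs: "\<And>i. i < d \<Longrightarrow> xs ! i = A.frac_of (f i) (g i)" by metis
  have PR: "P \<subseteq> KS" unfolding P_def by auto
  let ?fs = "map f [0..<d]"
  have "set ?fs \<subseteq> KS" using f PR by auto
  then have fsR: "set (take k ?fs) \<subseteq> KS" for k using set_take_subset[of k ?fs] by (rule order_trans[rotated])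
  have gen: "A.frac_of p s \<in> genideal A.L (set (take k xs)) \<longleftrightarrow> (\<exists>u\<in>M. u * p \<in> rspan KS (set (take k ?fs)))"
    if "p \<in> KS" "s \<in> M" "k \<le> d" for p s k
  proof -
    have tk: "set (take k ?fs) = f ` {..<k}" using that(3) by (auto simp: take_map)
    have tx: "set (take k xs) = (\<lambda>i. A.frac_of (f i) (g i)) ` {..<k}"
    proof -
      have "take k xs = map (\<lambda>i. A.frac_of (f i) (g i)) [0..<k]"
        using that(3) len xs by (intro nth_equalityI) auto
      then show ?thesis by auto
    qed
    have gM: "g i \<in> M" if "i < k" for i using g[of i] \<open>k \<le> d\<close> that by simp
    show ?thesis
    proof (rule A.genideal_frac[OF fsR])
      fix x assume "x \<in> set (take k xs)"
      then obtain i where i: "i < k" "x = A.frac_of (f i) (g i)" unfolding tx by blast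
      then show "\<exists>f\<in>set (take k ?fs). \<exists>s\<in>M. x = A.frac_of f s" using gM[OF i(1)] unfolding tk by blast
    next
      fix q assume "q \<in> set (take k ?fs)"
      then obtain i where i: "i < k" "q = f i" unfolding tk by blast
      then have "A.frac_of q (g i) \<in> set (take k xs)" unfolding tx by blast
      then show "\<exists>s\<in>M. A.frac_of q s \<in> set (take k xs)" using gM[OF i(1)] by blast
    qed (use that in auto)
  qed
  have "\<exists>n. \<exists>u\<in>M. u * monomial (n *s a j) \<in> rspan KS (set ?fs)" if "j < d" for j
  proof -
    have xa: "monomial (a j) \<in> P" using that a_in_S a_nonzero by (intro monomial_mem_P)
    then have "A.frac_of (monomial (a j)) 1 \<in> A.ext P" unfolding A.ext_def using A.M_one by blast
    then obtain n :: nat where "A.frac_of (monomial (a j)) 1 [^]\<^bsub>A.L\<^esub> n \<in> genideal A.L (set xs)"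
      unfolding rad[symmetric] ideal_radical_def by auto
    then have "A.frac_of (monomial (n *s a j)) 1 \<in> genideal A.L (set (take d xs))"
      using A.frac_of_power[of "monomial (a j)" 1 n] xa PR len by (auto simp: monomial_power)
    then have "\<exists>u\<in>M. u * monomial (n *s a j) \<in> rspan KS (set (take d ?fs))"
      using that a_in_S smult_S by (subst (asm) gen) (auto simp: monoid_algebra_def)
    then show ?thesis by auto
  qed
  then obtain n where n: "\<And>j. j < d \<Longrightarrow> \<exists>u\<in>M. u * monomial (n j *s a j) \<in> rspan KS (set ?fs)" by metis
  let ?ys = "map (\<lambda>j. monomial (n j *s a j)) [0..<d] :: ((nat ^ 'd) \<Rightarrow>\<^sub>0 'k) list"
  have rspan_SC: "rspan KS X \<subseteq> rspan KC X" for X using rspan_mono[of _ KS X KC X] KS_sub_KC by auto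
  have reg: "\<exists>u\<in>M. u * b \<in> rspan KC (set (take i ?fs))"
    if "i < d" "b \<in> KC" "b * f i \<in> rspan KC (set (take i ?fs))" for i b
  proof -
    have "\<exists>u\<in>M. u * b \<in> rspan KC (set (take i ?fs))"
    proof (rule B.regular_seq_radical[OF noetherian_KC _ _ _ monomials_regular])
      have "f i \<in> KC" if "i < d" for i using f[OF that] PR KS_sub_KC by blast
      then show "set ?fs \<subseteq> KC" by auto
      have "n j *s a j \<in> C" if "j < d" for j using smult_S[OF a_in_S[OF that]] S_sub_C by blast
      then show "set ?ys \<subseteq> KC" by (auto simp: monoid_algebra_def)
      show "\<exists>u\<in>M. u * y \<in> rspan KC (set ?fs)" if "y \<in> set ?ys" for y
        using n rspan_SC that by fastforce
      show "u - r * x \<in> M" if "x \<in> set ?fs" "u \<in> M" "r \<in> KC" for x u r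
      proof -
        have "x * r \<in> P" using absorb that(1,3) f by auto
        then show ?thesis using that(2) A.diff_mem unfolding M_def P_def
          by (auto simp: lookup_minus mult.commute)
      qed
      show "b * ?fs ! i \<in> rspan KC (set (take i ?fs))" using that by simp
    qed (use that in simp_all)
    then show ?thesis .
  qed
  show "weak_regular_sequence A.L (A.ext P) xs"
    unfolding weak_regular_sequence_def
  proof (intro allI impI subsetI)
    fix i z assume i: "i < length xs"
    let ?I = "genideal A.L (set (take i xs))"
    have id: "i < d" using i len by simp
    have "set (take i xs) \<subseteq> carrier A.L"
      using xsP set_take_subset[of i xs] PR unfolding A.ext_def by auto
    then have I: "ideal ?I A.L" by (rule A.L.genideal_ideal)
    assume "z \<in> ideal_prod A.L (A.ext P) (ideal_colon A.L ?I (xs ! i))"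
    then show "z \<in> ?I"
    proof (induction rule: ideal_prod.induct)
      case (prod e b)
      obtain q t where q: "e = A.frac_of q t" "q \<in> P" "t \<in> M" using prod(1) unfolding A.ext_def by auto
      have "b \<in> carrier A.L" and bx: "b \<otimes>\<^bsub>A.L\<^esub> (xs ! i) \<in> ?I" using prod(2) unfolding ideal_colon_def by auto
      then obtain p s where p: "b = A.frac_of p s" "p \<in> KS" "s \<in> M" by (auto elim: A.carrier_LE)
      have fi: "f i \<in> KS" "g i \<in> M" using f g id PR by auto
      have "A.frac_of (p * f i) (s * g i) \<in> ?I"
        using bx p fi xs[OF id] by (simp add: A.mult_L)
      then obtain u where u: "u \<in> M" "u * (p * f i) \<in> rspan KS (set (take i ?fs))"
        using gen[of "p * f i" "s * g i" i] p fi id by auto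
      have uR: "u \<in> KS" using u A.M_R by auto
      have "(u * p) * f i \<in> rspan KC (set (take i ?fs))" using u rspan_SC by (auto simp: mult.assoc)
      then obtain u' where u': "u' \<in> M" "u' * (u * p) \<in> rspan KC (set (take i ?fs))"
        using reg[OF id, of "u * p"] uR p KS_sub_KC A.mult_mem by blast
      have "q * h \<in> rspan KS (set (take i ?fs))" if "h \<in> rspan KC (set (take i ?fs))" for h
        using that
      proof (induction rule: rspan.induct)
        case zero
        show ?case by (simp add: rspan.zero)
      next
        case (step r x h)
        have "q * r \<in> KS" using absorb[OF q(2) step(1)] PR by auto
        from rspan.step[OF this step(2,4)] show ?case by (simp add: algebra_simps)
      qed
      from this[OF u'(2)] have "(u' * u) * (q * p) \<in> rspan KS (set (take i ?fs))"
        by (simp add: algebra_simps)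
      then have ex: "\<exists>u\<in>M. u * (q * p) \<in> rspan KS (set (take i ?fs))"
        using u(1) u'(1) by (intro bexI[of _ "u' * u"]) auto
      have "q * p \<in> KS" "t * s \<in> M" using q p PR by auto
      then have "A.frac_of (q * p) (t * s) \<in> ?I"
        using iffD2[OF gen ex] id by simp
      then show ?case using q p PR by (auto simp: A.mult_L)
    next
      case (sum x y)
      then show ?case using additive_subgroup.a_closed[OF ideal.axioms(1)[OF I]] by auto
    qed
  qed
qed

text \<open>The system of parameters is given by the monomials of \<open>N a\<^sub>j\<close>. Its ideal has the right radical: an exponent of a high
  power of an element of \<open>P\<close> has large coordinate sum, hence a coordinate so large that after subtracting \<open>N a\<^sub>j\<close> the
  remaining vector cannot be a gap.\<close>
lemma buchsbaum_only_if:
  assumes B: "buchsbaum_semigroup K S" and h: "h \<in> gaps S"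
  shows "h \<in> pseudo_frobenius S"
proof -
  obtain L0 :: nat where L0: "\<And>h j. h \<in> gaps S \<Longrightarrow> j < d \<Longrightarrow> coord j h < of_nat L0" using gaps_bounded by blast
  have in_S: "c \<in> S" if "c \<in> C" "j < d" "of_nat L0 \<le> coord j c" for c j
    using that L0[of c j] unfolding gaps_def by fastforce
  define N where "N = Suc L0"
  let ?y = "\<lambda>j. monomial (N *s a j) :: (nat ^ 'd) \<Rightarrow>\<^sub>0 'k"
  let ?xs = "map (\<lambda>j. A.frac_of (?y j) 1) [0..<d]"
  have Na: "N *s a j \<in> S" if "j < d" for j using that a_in_S smult_S by auto
  have yP: "?y j \<in> P" if "j < d" for j
  proof (rule monomial_mem_P[OF Na[OF that]])
    have "coord j (N *s a j) \<noteq> 0" unfolding coord_smult coord_a[OF that that] N_def by simp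
    then show "N *s a j \<noteq> 0" using coord_0 by auto
  qed
  have PR: "P \<subseteq> KS" unfolding P_def by auto
  have gen: "A.frac_of p s \<in> genideal A.L (set (take k ?xs)) \<longleftrightarrow>
      (\<exists>u\<in>M. \<forall>c\<in>keys (u * p). \<exists>j<k. \<exists>t\<in>S. c = N *s a j + t)"
    if "p \<in> KS" "s \<in> M" "k \<le> d" for p s k
  proof -
    let ?E = "(\<lambda>j. N *s a j) ` {..<k}"
    have E: "?E \<subseteq> S" using Na that(3) by auto
    have "A.frac_of p s \<in> genideal A.L (set (take k ?xs)) \<longleftrightarrow> (\<exists>u\<in>M. u * p \<in> rspan KS (monomial ` ?E))"
    proof (rule A.genideal_frac)
      show "monomial ` ?E \<subseteq> KS" using E by (auto simp: monoid_algebra_def)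
      have tx: "set (take k ?xs) = (\<lambda>e. A.frac_of (monomial e) 1) ` ?E" using that(3) by (auto simp: take_map)
      show "\<exists>f\<in>monomial ` ?E. \<exists>s\<in>M. x = A.frac_of f s" if "x \<in> set (take k ?xs)" for x
        using that A.M_one unfolding tx by blast
      show "\<exists>s\<in>M. A.frac_of q s \<in> set (take k ?xs)" if "q \<in> monomial ` ?E" for q
        using that A.M_one unfolding tx by blast
    qed (use that in auto)
    also have "\<dots> \<longleftrightarrow> (\<exists>u\<in>M. \<forall>c\<in>keys (u * p). \<exists>j<k. \<exists>t\<in>S. c = N *s a j + t)"
      unfolding rspan_monomials[OF submonoid_S E] by (simp add: Bex_def)
    finally show ?thesis .
  qed
  have take_d: "take d ?xs = ?xs" by simp
  have xsP: "set ?xs \<subseteq> A.ext P" using A.frac_extI[OF yP A.M_one] by auto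
  have "system_of_parameters A.L (A.ext P) ?xs"
    unfolding system_of_parameters_def
  proof (intro conjI Set.set_eqI iffI)
    show "set ?xs \<subseteq> A.ext P" by (rule xsP)
    show "enat (length ?xs) = krull_dim A.L" unfolding krull_dim_A by simp
  next
    fix x assume "x \<in> ideal_radical A.L (genideal A.L (set ?xs))"
    then obtain n :: nat where x: "x \<in> carrier A.L" "x [^]\<^bsub>A.L\<^esub> n \<in> genideal A.L (set ?xs)"
      unfolding ideal_radical_def by auto
    obtain p s where p: "x = A.frac_of p s" "p \<in> KS" "s \<in> M" using x(1) by (auto elim: A.carrier_LE)
    have "genideal A.L (set ?xs) \<subseteq> A.ext P"
      by (rule A.L.genideal_minimal[OF A.ideal_ext[OF prime_set_ideal[OF prime_P]] xsP])
    then have "A.frac_of (p ^ n) (s ^ n) \<in> A.ext P" using x(2) A.frac_of_power[OF p(2,3), of n] p(1) by auto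
    then have "p ^ n \<in> P" using extP_iff A.frac_of_power[OF p(2,3), of n] by auto
    then have "p \<in> P" using prime_set_power[OF A.subring_of_axioms prime_P p(2), of 1 n] prime_setD(3)[OF prime_P] by auto
    then show "x \<in> A.ext P" using p unfolding A.ext_def by auto
  next
    fix x assume "x \<in> A.ext P"
    then obtain p s where p: "x = A.frac_of p s" "p \<in> P" "s \<in> M" unfolding A.ext_def by auto
    \<comment> \<open>An additive weight that is positive on nonzero elements of \<open>S\<close>, so it grows linearly in powers of \<open>p\<close>.\<close>
    define \<sigma> where "\<sigma> c = (\<Sum>j<d. coord j c)" for c
    have \<sigma>_add: "\<sigma> (b + c) = \<sigma> b + \<sigma> c" for b c unfolding \<sigma>_def by (simp add: coord_add sum.distrib)
    have pos: "0 < \<sigma> c" if "c \<in> keys p" for c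
    proof -
      have c: "c \<in> S" "c \<noteq> 0" using that p(2) unfolding P_def monoid_algebra_def by (auto simp: in_keys_iff)
      obtain j where "j < d" "coord j c \<noteq> 0" using coord_eq_0 c(2) by blast
      then show ?thesis unfolding \<sigma>_def using coord_nonneg[OF c(1)]
        by (intro sum_pos2[of _ j]) (auto simp: order.strict_iff_order)
    qed
    define \<epsilon> where "\<epsilon> = Min (insert 1 (\<sigma> ` keys p))"
    have \<epsilon>: "0 < \<epsilon>" "\<And>c. c \<in> keys p \<Longrightarrow> \<epsilon> \<le> \<sigma> c" unfolding \<epsilon>_def using pos by auto
    have keys: "of_nat n * \<epsilon> \<le> \<sigma> c" if "c \<in> keys (p ^ n)" for c n
      using that
    proof (induction n arbitrary: c)
      case 0
      then show ?case by (simp add: \<sigma>_def coord_0)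
    next
      case (Suc n)
      then obtain b e where "c = b + e" "b \<in> keys p" "e \<in> keys (p ^ n)" using keys_mult[of p "p ^ n"] by auto
      then show ?case using Suc.IH[of e] \<epsilon>(2)[of b] by (simp add: \<sigma>_add algebra_simps)
    qed
    obtain n :: nat where n: "of_nat d * of_nat (N + L0) / \<epsilon> < of_nat n" using reals_Archimedean2 by blast
    then have n': "of_nat d * of_nat (N + L0) < of_nat n * \<epsilon>" using \<epsilon>(1) by (simp add: pos_divide_less_eq)
    have pn: "p ^ n \<in> KS" "s ^ n \<in> M" using A.frac_of_power[of p s n] p PR by auto
    have "\<exists>j<d. \<exists>t\<in>S. c = N *s a j + t" if c: "c \<in> keys (p ^ n)" for c
    proof -
      have cC: "c \<in> C" using pn c S_sub_C unfolding monoid_algebra_def by auto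
      have "\<exists>j<d. of_nat (N + L0) \<le> coord j c"
      proof (rule ccontr)
        assume "\<not> ?thesis"
        then have "\<sigma> c \<le> (\<Sum>j<d. of_nat (N + L0))" unfolding \<sigma>_def by (intro sum_mono) auto
        then show False using keys[OF c] n' by simp
      qed
      then obtain j where j: "j < d" "of_nat (N + L0) \<le> coord j c" by blast
      then obtain e where e: "e \<in> C" "c = N *s a j + e" using subtract[OF cC j(1), of N] by auto
      have "coord j c = of_nat N + coord j e" unfolding e(2) coord_add coord_smult coord_a[OF j(1) j(1)] by simp
      then have "e \<in> S" using in_S[OF e(1) j(1)] j(2) by simp
      then show ?thesis using e j by blast
    qed
    then have "A.frac_of (p ^ n) (s ^ n) \<in> genideal A.L (set (take d ?xs))"
      using gen[OF pn order_refl] A.M_one by (metis mult_1)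
    then have "x [^]\<^bsub>A.L\<^esub> n \<in> genideal A.L (set ?xs)"
      using A.frac_of_power[of p s n] p PR unfolding take_d by auto
    then show "x \<in> ideal_radical A.L (genideal A.L (set ?xs))"
      unfolding ideal_radical_def using p PR by auto
  qed
  then have "weak_regular_sequence A.L (A.ext P) ?xs" using B unfolding buchsbaum_iff by blast
  then have weak: "ideal_prod A.L (A.ext P) (ideal_colon A.L (genideal A.L (set (take 1 ?xs))) (?xs ! 1))
      \<subseteq> genideal A.L (set (take 1 ?xs))"
    using dim_gt_1 unfolding weak_regular_sequence_def by (elim allE[of _ 1]) auto
  have d01: "0 < d" "1 < d" using dim_gt_1 by auto
  have hC: "h \<in> C" using h unfolding gaps_def by auto
  have hS: "h + N *s a j \<in> S" if "j < d" for j
  proof (rule in_S[OF _ that])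
    show "h + N *s a j \<in> C" using hC Na[OF that] S_sub_C submonoid_C unfolding submonoid_set_def by auto
    have "0 \<le> coord j h" using hC that C_iff by auto
    then show "of_nat L0 \<le> coord j (h + N *s a j)" unfolding coord_add coord_smult coord_a[OF that that] N_def by simp
  qed
  have "h + s \<in> S" if s: "s \<in> S - {0}" for s
  proof -
    let ?b = "monomial (h + N *s a 0) :: (nat ^ 'd) \<Rightarrow>\<^sub>0 'k"
    have bR: "?b \<in> KS" using hS[OF d01(1)] unfolding monoid_algebra_def by simp
    have y1: "?y 1 \<in> KS" using yP[OF d01(2)] PR by auto
    \<comment> \<open>The right-hand side exhibits the product as a multiple of \<open>t\<^bsup>N a\<^sub>0\<^esup>\<close>.\<close>
    have b_y1: "?b * ?y 1 = monomial (N *s a 0 + (h + N *s a 1))" by (simp add: mult_single algebra_simps)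
    have "A.frac_of (?b * ?y 1) (1 * 1) \<in> genideal A.L (set (take 1 ?xs))"
    proof (subst gen)
      show "\<exists>u\<in>M. \<forall>c\<in>keys (u * (?b * ?y 1)). \<exists>j<1. \<exists>t\<in>S. c = N *s a j + t"
        unfolding b_y1 using hS[OF d01(2)] by (intro bexI[of _ 1]) auto
    qed (use bR y1 d01 in auto)
    then have colon: "A.frac_of ?b 1 \<in> ideal_colon A.L (genideal A.L (set (take 1 ?xs))) (?xs ! 1)"
      unfolding ideal_colon_def using bR y1 d01 by (simp add: A.mult_L)
    have sP: "monomial s \<in> P" using s by (intro monomial_mem_P) auto
    have "A.frac_of (monomial s) 1 \<otimes>\<^bsub>A.L\<^esub> A.frac_of ?b 1 \<in> genideal A.L (set (take 1 ?xs))"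
      by (rule subsetD[OF weak ideal_prod.prod[OF A.frac_extI[OF sP A.M_one] colon]])
    then have "A.frac_of (monomial s * ?b) 1 \<in> genideal A.L (set (take 1 ?xs))"
      using bR sP PR by (simp add: A.mult_L subset_iff)
    then obtain u where u: "u \<in> M" "\<forall>c\<in>keys (u * (monomial s * ?b)). \<exists>j<1. \<exists>t\<in>S. c = N *s a j + t"
      using gen[of "monomial s * ?b" 1 1] bR sP PR d01 by (auto simp: subset_iff)
    let ?c = "s + (h + N *s a 0)"
    \<comment> \<open>The denominator \<open>u\<close> has a constant term, so \<open>s + h + N a\<^sub>0\<close> is an exponent of the product.\<close>
    have "lookup (monomial ?c * u) (?c + 0) = 1 * lookup u 0" by (rule lookup_single_mult)
    then have "?c \<in> keys (u * (monomial s * ?b))"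
      using u(1) unfolding M_def by (simp add: mult_single in_keys_iff mult.commute)
    then obtain t where "t \<in> S" "?c = N *s a 0 + t" using u(2) by auto
    then have "(h + s) + N *s a 0 = t + N *s a 0" by (simp add: ac_simps)
    then have "h + s = t" by (rule add_right_imp_eq)
    then show ?thesis using \<open>t \<in> S\<close> by simp
  qed
  then show ?thesis using h unfolding pseudo_frobenius_def by auto
qed

end

theorem theorem3p2:
  fixes S :: "(nat ^ 'd) set"
  assumes "CARD('d) > 1"
    and "C_semigroup S"
    and "simplicial S"
  shows "buchsbaum_semigroup TYPE('k::field) S \<longleftrightarrow> gaps S = pseudo_frobenius S"
proof -
  obtain a lam where *: "\<And>j. j < CARD('d) \<Longrightarrow> a j \<in> S"
    "\<And>j v w. lam j (v + w) = lam j v + lam j w"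
    "\<And>j c v. lam j (c *s v) = c * lam j v"
    "\<And>j k. j < CARD('d) \<Longrightarrow> k < CARD('d) \<Longrightarrow> lam j (rat_vec (a k)) = (if j = k then 1 else 0)"
    "\<And>v. v = (\<Sum>j<CARD('d). lam j v *s rat_vec (a j))"
    "rat_cone S = {v. \<forall>j<CARD('d). 0 \<le> lam j v}"
    using simplicial_coordinates[OF assms(3)] by blast
  interpret simplicial_C_semigroup S a lam "CARD('d)" "TYPE('k)"
    by unfold_locales (use assms * in auto)
  have "pseudo_frobenius S \<subseteq> gaps S" unfolding pseudo_frobenius_def by auto
  then show ?thesis using buchsbaum_if buchsbaum_only_if by blast
qed

end
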